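(* Let $\Sigma\subset\mathbb{L}=\mathrm{T}S^2$ be a twisting holomorphic sphere, i.e. the image of a global holomorphic section of $\pi:\mathbb{L}\to S^2$ which is not lagrangian, equipped with the metric induced by the neutral Kähler metric $\mathbb{G}$. Then the geodesic flow on $\Sigma$ is completely integrable. Geodesics with zero angular momentum reach the lagrangian circle (the set of points of $\Sigma$ where $\Omega|_\Sigma=0$) within a finite time, where the flow blows up, while geodesics with non-zero angular momentum oscillate between a maximum and a minimum distance from the lagrangian circle.
   Context: The space $\mathbb{L}$ of oriented affine lines in $\mathbb{R}^3$ is identified with $\mathrm{T}S^2$; $\pi:\mathbb{L}\to S^2$ sends a line to its direction. Let $\xi$ be the complex coordinate on $S^2\setminus\{\text{south pole}\}$ given by stereographic projection from the south pole (so $\xi=0$ is the north pole and $|\xi|=1$ the equator). Local complex coordinates $(\xi,\eta)$ on $\mathbb{L}$ are defined by $(\xi,\eta)\leftrightarrow \eta\frac{\partial}{\partial\xi}+\bar\eta\frac{\partial}{\partial\bar\xi}\in \mathrm{T}_\xi S^2$, and these are holomorphic coordinates for the complex structure $\mathbb{J}$ on $\mathbb{L}$. The symplectic form and neutral Kähler metric on $\mathbb{L}$ are $$\Omega=\frac{2}{(1+\xi\bar\xi)^2}\Big(d\eta\wedge d\bar\xi+d\bar\eta\wedge d\xi+\frac{2(\xi\bar\eta-\bar\xi\eta)}{1+\xi\bar\xi}d\xi\wedge d\bar\xi\Big),$$ $$\mathbb{G}=\frac{2i}{(1+\xi\bar\xi)^2}\Big(d\eta\otimes d\bar\xi-d\bar\eta\otimes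 d\xi+\frac{2(\xi\bar\eta-\bar\xi\eta)}{1+\xi\bar\xi}d\xi\otimes d\bar\xi\Big)$$ (products in $\mathbb{G}$ are understood as symmetrised). Both are invariant under the action on $\mathbb{L}$ of the orientation-preserving Euclidean group of $\mathbb{R}^3$, generated by translations $(\xi,\eta)\mapsto(\xi,\eta+\alpha_1-a_1\xi-\bar\alpha_1\xi^2)$ with $\alpha_1\in\mathbb{C},a_1\in\mathbb{R}$, and rotations $\xi\mapsto\frac{\alpha_2\xi+\alpha_3}{-\bar\alpha_3\xi+\bar\alpha_2}$, $\eta\mapsto\frac{\eta}{(-\bar\alpha_3\xi+\bar\alpha_2)^2}$ with $|\alpha_2|^2+|\alpha_3|^2=1$. A surface $\Sigma\subset\mathbb{L}$ is lagrangian if $\Omega|_\Sigma=0$, and twisting if it is not lagrangian. Global holomorphic sections of $\pi$ are given by $\eta=\beta_1+\beta_2\xi+\beta_3\xi^2$ with $\beta_j\in\mathbb{C}$. By a Euclidean motion each can be put in the form $\eta=ci\xi$ with $c\ge 0$, and it is twisting iff $c>0$. In this normal form the lagrangian points form the circle $|\xi|=1$, along which the induced metric is degenerate; the induced metric is definite on each of the two complementary open discs, and the geodesic flow is that of the induced metric on these discs. Complete integrability means the existence of two Poisson-commuting first integrals that are functionally independent on an open dense set. In normal form the angular momentum of an affinely parameterised geodesic $t\mapsto\xi(t)$ is $$\mathrm{I}_2=\frac{1-\xi\bar\xi}{2i(1+\xi\bar\xi)^3}\big(\bar\xi\dot\xi-\xi\dot{\bar\xi}\big).$$ Geodesics are non-constant,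 and time is the affine parameter. "The flow blows up" means that $|\dot\xi|\to\infty$ as the geodesic approaches the lagrangian circle (in normal form). The induced metric in normal form is invariant under $\xi\mapsto e^{i\phi}\xi$, so the distance of a point from the lagrangian circle is a function of $R=|\xi|$, strictly monotone on each disc; "oscillate between a maximum and a minimum distance" means that $R$ oscillates between two extreme values in the open disc, the degenerate case in which $R$ is constant (maximum equals minimum) being included. *)

theory Defs
  imports "HOL-Complex_Analysis.Complex_Analysis"
begin

section \<open>Calculus in a chart\<close>

text \<open>The open sets \<open>S\<close> below lie in finite-dimensional spaces, so that continuity of all iterated
  directional derivatives is the usual notion of class \<open>C\<^sup>\<infinity>\<close>.\<close>

primrec Ck_on :: "nat \<Rightarrow> 'a::euclidean_space set \<Rightarrow> ('a \<Rightarrow> 'b::real_normed_vector) \<Rightarrow> bool" where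
  "Ck_on 0 S f \<longleftrightarrow> continuous_on S f"
| "Ck_on (Suc k) S f \<longleftrightarrow> (\<forall>x\<in>S. f differentiable (at x)) \<and>
     (\<forall>v. Ck_on k S (\<lambda>x. frechet_derivative f (at x) v))"

definition smooth_on :: "'a::euclidean_space set \<Rightarrow> ('a \<Rightarrow> 'b::real_normed_vector) \<Rightarrow> bool" where
  "smooth_on S f \<longleftrightarrow> (\<forall>k. Ck_on k S f)"

definition dir_deriv :: "('a::euclidean_space \<Rightarrow> 'b::real_normed_vector) \<Rightarrow> 'a \<Rightarrow> 'a \<Rightarrow> 'b" where
  "dir_deriv f x v = frechet_derivative f (at x) v"

text \<open>A (pseudo-Riemannian) metric in a chart is a function \<open>g x X Y\<close>. The Christoffel symbols of
  the first kind give the Levi-Civita connection with lowered index: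
  \<open>g x (\<nabla>\<^sub>X Y) Z = g x (D\<^sub>X Y) Z + christoffel g x X Y Z\<close>.\<close>

definition christoffel :: "('a::euclidean_space \<Rightarrow> 'a \<Rightarrow> 'a \<Rightarrow> real) \<Rightarrow> 'a \<Rightarrow> 'a \<Rightarrow> 'a \<Rightarrow> 'a \<Rightarrow> real" where
  "christoffel g x X Y Z =
     (dir_deriv (\<lambda>y. g y Y Z) x X + dir_deriv (\<lambda>y. g y X Z) x Y - dir_deriv (\<lambda>y. g y X Y) x Z) / 2"

text \<open>The geodesic equation at time \<open>t\<close>, i.e. vanishing of the covariant acceleration, where \<open>g\<close> is
  nondegenerate at \<open>x t\<close>.\<close>

definition geodesic_eq_at ::
    "('a::euclidean_space \<Rightarrow> 'a \<Rightarrow> 'a \<Rightarrow> real) \<Rightarrow> (real \<Rightarrow> 'a) \<Rightarrow> real \<Rightarrow> bool" where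
  "geodesic_eq_at g x t \<longleftrightarrow>
     (\<exists>v a. (\<forall>\<^sub>F r in nhds t. (x has_vector_derivative v r) (at r)) \<and>
            (v has_vector_derivative a) (at t) \<and>
            (\<forall>Z. g (x t) a Z + christoffel g (x t) (v t) (v t) Z = 0))"

definition sharp :: "('a::euclidean_space \<Rightarrow> 'a \<Rightarrow> 'a \<Rightarrow> real) \<Rightarrow> 'a \<Rightarrow> 'a \<Rightarrow> 'a" where
  "sharp g x p = (THE v. \<forall>Y. g x v Y = p \<bullet> Y)"

text \<open>The canonical Poisson bracket on the cotangent bundle, in coordinates \<open>(x, p)\<close>.\<close>

definition poisson :: "('a::euclidean_space \<times> 'a \<Rightarrow> real) \<Rightarrow> ('a \<times> 'a \<Rightarrow> real) \<Rightarrow> 'a \<times> 'a \<Rightarrow> real" where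
  "poisson F G z = (\<Sum>e\<in>Basis. dir_deriv F z (e, 0) * dir_deriv G z (0, e)
                            - dir_deriv F z (0, e) * dir_deriv G z (e, 0))"


section \<open>The space of oriented lines\<close>

text \<open>A pair \<open>(u, v)\<close> in \<open>TS\<^sup>2\<close> is the oriented line with direction \<open>u\<close> whose point closest to the
  origin is \<open>v\<close>. The projection to the sphere of directions is \<^const>\<open>fst\<close>.\<close>

type_synonym vec3 = "real^3"
type_synonym line = "vec3 \<times> vec3"

definition S2 :: "vec3 set" where
  "S2 = sphere 0 1"

definition TS2 :: "line set" where
  "TS2 = {(u, v). u \<in> S2 \<and> u \<bullet> v = 0}"

text \<open>The two stereographic charts, named after the pole from which one projects. The coordinate of
  \<open>South\<close> is \<open>\<xi>\<close>, that of \<open>North\<close> is \<open>1/\<xi>\<close>; the change of charts \<open>(\<xi>, \<eta>) \<mapsto> (1/\<xi>, -\<eta>/\<xi>\<^sup>2)\<close> of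
  \<^const>\<open>TS2\<close> is the rotation by \<open>\<pi>\<close> about the first axis, which leaves \<open>\<Omega>\<close> and \<open>\<G>\<close> invariant.
  Hence these tensors have the same coordinate expression in both charts.\<close>

datatype pole = South | North

primrec pole_pt :: "pole \<Rightarrow> vec3" where
  "pole_pt South = vector [0, 0, -1]"
| "pole_pt North = vector [0, 0, 1]"

primrec dir_coord :: "pole \<Rightarrow> vec3 \<Rightarrow> complex" where
  "dir_coord South u = Complex (u$1) (u$2) / of_real (1 + u$3)"
| "dir_coord North u = Complex (u$1) (- (u$2)) / of_real (1 - u$3)"

primrec dir_param :: "pole \<Rightarrow> complex \<Rightarrow> vec3" where
  "dir_param South x = (1 / (1 + (cmod x)\<^sup>2)) *\<^sub>R vector [2 * Re x, 2 * Im x, 1 - (cmod x)\<^sup>2]"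
| "dir_param North x = (1 / (1 + (cmod x)\<^sup>2)) *\<^sub>R vector [2 * Re x, - 2 * Im x, (cmod x)\<^sup>2 - 1]"

definition fibre_coord :: "pole \<Rightarrow> line \<Rightarrow> complex" where
  "fibre_coord P l = dir_deriv (dir_coord P) (fst l) (snd l)"

text \<open>The tensors at a point \<open>(\<xi>, \<eta>)\<close>, evaluated on vectors \<open>A = (d\<xi>(A), d\<eta>(A))\<close> and \<open>B\<close>.\<close>

definition Omega :: "complex \<times> complex \<Rightarrow> complex \<times> complex \<Rightarrow> complex \<times> complex \<Rightarrow> complex" where
  "Omega = (\<lambda>(\<xi>, \<eta>) (A\<xi>, A\<eta>) (B\<xi>, B\<eta>).
     2 / (1 + \<xi> * cnj \<xi>)\<^sup>2 *
       ((A\<eta> * cnj B\<xi> - B\<eta> * cnj A\<xi>) + (cnj A\<eta> * B\<xi> - cnj B\<eta> * A\<xi>)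
        + 2 * (\<xi> * cnj \<eta> - cnj \<xi> * \<eta>) / (1 + \<xi> * cnj \<xi>) * (A\<xi> * cnj B\<xi> - B\<xi> * cnj A\<xi>)))"

definition G_tensor :: "complex \<times> complex \<Rightarrow> complex \<times> complex \<Rightarrow> complex \<times> complex \<Rightarrow> complex" where
  "G_tensor = (\<lambda>(\<xi>, \<eta>) (A\<xi>, A\<eta>) (B\<xi>, B\<eta>).
     2 * \<i> / (1 + \<xi> * cnj \<xi>)\<^sup>2 *
       (A\<eta> * cnj B\<xi> - cnj A\<eta> * B\<xi>
        + 2 * (\<xi> * cnj \<eta> - cnj \<xi> * \<eta>) / (1 + \<xi> * cnj \<xi>) * (A\<xi> * cnj B\<xi>)))"

text \<open>The symmetrisation of \<^const>\<open>G_tensor\<close> takes real values only.\<close>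

definition G_metric :: "complex \<times> complex \<Rightarrow> complex \<times> complex \<Rightarrow> complex \<times> complex \<Rightarrow> real" where
  "G_metric q A B = Re ((G_tensor q A B + G_tensor q B A) / 2)"

text \<open>The motion \<open>x \<mapsto> A x + b\<close> of space acting on lines: the image line passes through
  \<open>A v + b\<close>, which is then projected to the plane orthogonal to the new direction \<open>A u\<close>.\<close>

definition euclidean_act :: "real^3^3 \<Rightarrow> vec3 \<Rightarrow> line \<Rightarrow> line" where
  "euclidean_act A b = (\<lambda>(u, v). (A *v u, A *v v + b - (b \<bullet> (A *v u)) *\<^sub>R (A *v u)))"


section \<open>Holomorphic spheres\<close>

text \<open>A holomorphic sphere is the image of \<^const>\<open>S2\<close> under a section \<open>s\<close>. Only the values of \<open>s\<close> on
  \<^const>\<open>S2\<close> matter.\<close>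

definition global_holomorphic_section :: "(vec3 \<Rightarrow> line) \<Rightarrow> bool" where
  "global_holomorphic_section s \<longleftrightarrow>
     (\<forall>u\<in>S2. s u \<in> TS2 \<and> fst (s u) = u) \<and>
     (\<forall>P. (\<lambda>x. fibre_coord P (s (dir_param P x))) holomorphic_on UNIV)"

definition surf :: "(vec3 \<Rightarrow> line) \<Rightarrow> line set" where
  "surf s = s ` S2"

definition surf_param :: "(vec3 \<Rightarrow> line) \<Rightarrow> pole \<Rightarrow> complex \<Rightarrow> line" where
  "surf_param s P x = s (dir_param P x)"

definition surf_coord :: "(vec3 \<Rightarrow> line) \<Rightarrow> pole \<Rightarrow> complex \<Rightarrow> complex \<times> complex" where
  "surf_coord s P x = (x, fibre_coord P (surf_param s P x))"

definition induced_metric :: "(vec3 \<Rightarrow> line) \<Rightarrow> pole \<Rightarrow> complex \<Rightarrow> complex \<Rightarrow> complex \<Rightarrow> real" where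
  "induced_metric s P x X Y =
     G_metric (surf_coord s P x) (dir_deriv (surf_coord s P) x X) (dir_deriv (surf_coord s P) x Y)"

definition induced_Omega :: "(vec3 \<Rightarrow> line) \<Rightarrow> pole \<Rightarrow> complex \<Rightarrow> complex \<Rightarrow> complex \<Rightarrow> complex" where
  "induced_Omega s P x X Y =
     Omega (surf_coord s P x) (dir_deriv (surf_coord s P) x X) (dir_deriv (surf_coord s P) x Y)"

definition lagrangian_circle :: "(vec3 \<Rightarrow> line) \<Rightarrow> line set" where
  "lagrangian_circle s = {surf_param s P x | P x. \<forall>X Y. induced_Omega s P x X Y = 0}"

definition lagrangian :: "(vec3 \<Rightarrow> line) \<Rightarrow> bool" where
  "lagrangian s \<longleftrightarrow> (\<forall>P x X Y. induced_Omega s P x X Y = 0)"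

definition twisting :: "(vec3 \<Rightarrow> line) \<Rightarrow> bool" where
  "twisting s \<longleftrightarrow> \<not> lagrangian s"

definition reg_surf :: "(vec3 \<Rightarrow> line) \<Rightarrow> line set" where
  "reg_surf s = surf s - lagrangian_circle s"


section \<open>The geodesic flow\<close>

definition geodesic :: "(vec3 \<Rightarrow> line) \<Rightarrow> real set \<Rightarrow> (real \<Rightarrow> line) \<Rightarrow> bool" where
  "geodesic s J \<gamma> \<longleftrightarrow>
     open J \<and> is_interval J \<and> continuous_on J \<gamma> \<and> \<gamma> ` J \<subseteq> reg_surf s \<and> \<not> \<gamma> constant_on J \<and>
     (\<forall>t\<in>J. \<forall>P. fst (\<gamma> t) \<noteq> pole_pt P \<longrightarrow>
        geodesic_eq_at (induced_metric s P) (\<lambda>r. dir_coord P (fst (\<gamma> r))) t)"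

definition maximal_geodesic :: "(vec3 \<Rightarrow> line) \<Rightarrow> real set \<Rightarrow> (real \<Rightarrow> line) \<Rightarrow> bool" where
  "maximal_geodesic s J \<gamma> \<longleftrightarrow> geodesic s J \<gamma> \<and>
     (\<forall>J' \<gamma>'. geodesic s J' \<gamma>' \<and> J \<subseteq> J' \<and> (\<forall>t\<in>J. \<gamma>' t = \<gamma> t) \<longrightarrow> J' = J)"

text \<open>The phase space is the tangent bundle of the complement of the lagrangian circle, consisting of
  pairs of a point and a velocity vector in the ambient space of \<^typ>\<open>line\<close>.\<close>

definition tangent_param :: "(vec3 \<Rightarrow> line) \<Rightarrow> pole \<Rightarrow> complex \<times> complex \<Rightarrow> line \<times> line" where
  "tangent_param s P = (\<lambda>(x, X). (surf_param s P x, dir_deriv (surf_param s P) x X))"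

definition phase_dom :: "(vec3 \<Rightarrow> line) \<Rightarrow> pole \<Rightarrow> (complex \<times> complex) set" where
  "phase_dom s P = {(x, X). surf_param s P x \<in> reg_surf s}"

definition phase_space :: "(vec3 \<Rightarrow> line) \<Rightarrow> (line \<times> line) set" where
  "phase_space s = (\<Union>P. tangent_param s P ` phase_dom s P)"

definition smooth_phase_fun :: "(vec3 \<Rightarrow> line) \<Rightarrow> (line \<times> line \<Rightarrow> real) \<Rightarrow> bool" where
  "smooth_phase_fun s F \<longleftrightarrow> (\<forall>P. smooth_on (phase_dom s P) (F \<circ> tangent_param s P))"

definition first_integral :: "(vec3 \<Rightarrow> line) \<Rightarrow> (line \<times> line \<Rightarrow> real) \<Rightarrow> bool" where
  "first_integral s F \<longleftrightarrow> smooth_phase_fun s F \<and>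
     (\<forall>J \<gamma>. geodesic s J \<gamma> \<longrightarrow> (\<lambda>t. F (\<gamma> t, vector_derivative \<gamma> (at t))) constant_on J)"

text \<open>The Poisson structure on the tangent bundle is the one transported from the cotangent bundle by
  the metric (the Legendre transformation).\<close>

definition cotangent_form :: "(vec3 \<Rightarrow> line) \<Rightarrow> pole \<Rightarrow> (line \<times> line \<Rightarrow> real) \<Rightarrow> complex \<times> complex \<Rightarrow> real" where
  "cotangent_form s P F = (\<lambda>(x, p). F (tangent_param s P (x, sharp (induced_metric s P) x p)))"

definition poisson_commute :: "(vec3 \<Rightarrow> line) \<Rightarrow> (line \<times> line \<Rightarrow> real) \<Rightarrow> (line \<times> line \<Rightarrow> real) \<Rightarrow> bool" where
  "poisson_commute s F1 F2 \<longleftrightarrow>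
     (\<forall>P. \<forall>z\<in>phase_dom s P. poisson (cotangent_form s P F1) (cotangent_form s P F2) z = 0)"

definition independent_at ::
    "(vec3 \<Rightarrow> line) \<Rightarrow> (line \<times> line \<Rightarrow> real) \<Rightarrow> (line \<times> line \<Rightarrow> real) \<Rightarrow> line \<times> line \<Rightarrow> bool" where
  "independent_at s F1 F2 q \<longleftrightarrow>
     (\<forall>P. \<forall>z\<in>phase_dom s P. tangent_param s P z = q \<longrightarrow>
        (\<forall>a b. (\<forall>Z. a * dir_deriv (F1 \<circ> tangent_param s P) z Z
                  + b * dir_deriv (F2 \<circ> tangent_param s P) z Z = 0) \<longrightarrow> a = 0 \<and> b = 0))"

definition completely_integrable :: "(vec3 \<Rightarrow> line) \<Rightarrow> bool" where
  "completely_integrable s \<longleftrightarrow>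
     (\<exists>F1 F2 U. first_integral s F1 \<and> first_integral s F2 \<and> poisson_commute s F1 F2 \<and>
        openin (top_of_set (phase_space s)) U \<and> phase_space s \<subseteq> closure U \<and>
        (\<forall>q\<in>U. independent_at s F1 F2 q))"


section \<open>The normal form\<close>

text \<open>The motion \<open>(A, b)\<close> puts the sphere into the form \<open>\<eta> = c \<i> \<xi>\<close>.\<close>

definition normalises :: "real^3^3 \<Rightarrow> vec3 \<Rightarrow> real \<Rightarrow> (vec3 \<Rightarrow> line) \<Rightarrow> bool" where
  "normalises A b c s \<longleftrightarrow> orthogonal_matrix A \<and> det A = 1 \<and> 0 \<le> c \<and>
     (\<forall>l \<in> euclidean_act A b ` surf s. fst l \<noteq> pole_pt South \<longrightarrow>
        fibre_coord South l = of_real c * \<i> * dir_coord South (fst l))"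

definition normal_xi :: "real^3^3 \<Rightarrow> vec3 \<Rightarrow> (real \<Rightarrow> line) \<Rightarrow> real \<Rightarrow> complex" where
  "normal_xi A b \<gamma> t = dir_coord South (fst (euclidean_act A b (\<gamma> t)))"

definition angular_momentum :: "complex \<Rightarrow> complex \<Rightarrow> complex" where
  "angular_momentum \<xi> \<xi>' = (1 - \<xi> * cnj \<xi>) / (2 * \<i> * (1 + \<xi> * cnj \<xi>) ^ 3) * (cnj \<xi> * \<xi>' - \<xi> * cnj \<xi>')"

text \<open>The coordinate \<open>\<xi>\<close> is undefined at the south pole. A geodesic stays there for isolated times
  only, and its angular momentum is the value at all other times.\<close>

definition has_angular_momentum ::
    "real^3^3 \<Rightarrow> vec3 \<Rightarrow> real set \<Rightarrow> (real \<Rightarrow> line) \<Rightarrow> real \<Rightarrow> bool" where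
  "has_angular_momentum A b J \<gamma> \<mu> \<longleftrightarrow>
     (\<forall>t\<in>J. fst (euclidean_act A b (\<gamma> t)) \<noteq> pole_pt South \<longrightarrow>
        angular_momentum (normal_xi A b \<gamma> t) (vector_derivative (normal_xi A b \<gamma>) (at t)) = of_real \<mu>)"

text \<open>Both ends of the (bounded) maximal interval of existence are covered: the geodesic reaches the
  lagrangian circle and blows up in finite forward time and in finite backward time.\<close>

definition blows_up_at :: "real^3^3 \<Rightarrow> vec3 \<Rightarrow> (vec3 \<Rightarrow> line) \<Rightarrow> (real \<Rightarrow> line) \<Rightarrow> real filter \<Rightarrow> bool" where
  "blows_up_at A b s \<gamma> E \<longleftrightarrow>
     (\<exists>p\<in>lagrangian_circle s. (\<gamma> \<longlongrightarrow> p) E) \<and>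
     filterlim (\<lambda>t. cmod (vector_derivative (normal_xi A b \<gamma>) (at t))) at_top E"

definition reaches_circle_in_finite_time ::
    "real^3^3 \<Rightarrow> vec3 \<Rightarrow> (vec3 \<Rightarrow> line) \<Rightarrow> real set \<Rightarrow> (real \<Rightarrow> line) \<Rightarrow> bool" where
  "reaches_circle_in_finite_time A b s J \<gamma> \<longleftrightarrow>
     (\<exists>t0 t1. t0 < t1 \<and> J = {t0<..<t1} \<and>
        blows_up_at A b s \<gamma> (at_right t0) \<and> blows_up_at A b s \<gamma> (at_left t1))"

text \<open>The extreme values of \<open>R = |\<xi>|\<close> lie in one of the open discs \<open>R < 1\<close>, \<open>R > 1\<close>, and each of them
  is attained again and again, both in the future and in the past.\<close>

definition oscillates :: "real^3^3 \<Rightarrow> vec3 \<Rightarrow> real set \<Rightarrow> (real \<Rightarrow> line) \<Rightarrow> bool" where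
  "oscillates A b J \<gamma> \<longleftrightarrow> J = UNIV \<and>
     (\<exists>m M. (M < 1 \<or> 1 < m) \<and>
        (\<forall>t. fst (euclidean_act A b (\<gamma> t)) \<noteq> pole_pt South \<and> cmod (normal_xi A b \<gamma> t) \<in> {m..M}) \<and>
        (\<forall>R\<in>{m, M}. \<forall>T. (\<exists>t>T. cmod (normal_xi A b \<gamma> t) = R) \<and> (\<exists>t<T. cmod (normal_xi A b \<gamma> t) = R)))"

end

theory Submission
  imports Defs
begin

text \<open>
  Identify the oriented lines with \<open>TS\<^sup>2\<close>. By Liouville's theorem every global holomorphic section
  has the form \<open>u \<mapsto> (u, b - (b \<bullet> u) u + w \<times> u)\<close> with two vectors \<open>b\<close> and \<open>w\<close> of space
  (\<open>global_holomorphic_section_hsec\<close>). The first part is a translation and does not contribute to the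
  induced tensors; the second one gives both of them the common factor \<open>w \<bullet> u\<close>, the height over the
  great circle orthogonal to \<open>w\<close> (\<open>twist_factor\<close>). So the sphere is twisting iff \<open>w \<noteq> 0\<close>, the great
  circle is the lagrangian circle, and the induced metric is \<open>- (w \<bullet> u)\<close> times the round metric of the
  sphere of directions. A rotation that turns \<open>w\<close> to the north pole and a translation that removes \<open>b\<close>
  produce the normal form.

  This makes it possible to work in space: geodesics are the solutions \<open>u\<close> on the unit sphere of one
  second order equation (\<open>geodesic_imp_geo\<close>, \<open>geo_imp_geodesic\<close>). It has two integrals, the energy
  \<open>(w \<bullet> u) |u'|\<^sup>2\<close> and, from the rotations about \<open>w\<close>, the angular momentum
  \<open>(w \<bullet> u) (w \<bullet> (u \<times> u'))\<close>. They commute because the rotation field is a Killing field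
  (\<open>conf_along_rot\<close>), and they are independent wherever \<open>w\<close> is not orthogonal to \<open>u'\<close>
  (\<open>independent_energy_momentum\<close>). Since a nonzero polynomial has few zeros, this is an open dense
  condition. That proves complete integrability.

  For the behaviour of geodesics, let \<open>z\<close> be the height for the unit normal of the great circle, \<open>k\<close>
  the energy and \<open>l\<close> the angular momentum. Then \<open>(z z')\<^sup>2 = k z (1 - z\<^sup>2) - l\<^sup>2\<close>, and \<open>q = z z'\<close>
  satisfies \<open>q'' = - \<omega> q\<close> with \<open>\<omega> \<ge> 2 k\<close>. By Sturm's comparison argument \<open>q\<close> changes its sign again and
  again on every half-line of times, unless \<open>z\<close> is constant (\<open>height_system_turning_points\<close>). The existence of geodesics is
  governed by an extension principle (\<open>geo_extend_right\<close>): a maximal geodesic can end at a finite time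
  only by approaching the lagrangian circle.

  If \<open>l \<noteq> 0\<close>, the cubic \<open>k z (1 - z\<^sup>2) \<ge> l\<^sup>2\<close> keeps \<open>z\<close> away from zero. So the geodesic exists for all
  times, and the sign changes of \<open>q\<close> make \<open>z\<close> oscillate between the two positive solutions
  of \<open>k z (1 - z\<^sup>2) = l\<^sup>2\<close> (\<open>height_system_oscillates\<close>). If \<open>l = 0\<close>, a turning point of the required kind does not exist, so the
  geodesic cannot exist on a half-line. It moves on a meridian and converges at the end of its life,
  necessarily to a point of the lagrangian circle, where the energy forces infinite speed
  (\<open>radial_geo_endpoint\<close>).
\<close>

section \<open>Stereographic charts\<close>

abbreviation cross :: "vec3 \<Rightarrow> vec3 \<Rightarrow> vec3" (infixr \<open>\<otimes>\<close> 80) where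
  "u \<otimes> v \<equiv> cross3 u v"

text \<open>In both charts the stereographic projection has the same shape once the plane orthogonal to the
  pole is identified with the complex numbers: \<^const>\<open>South\<close> uses the identity, \<^const>\<open>North\<close> a
  reflection. This identification and its adjoint allow both charts to be treated at once.\<close>

primrec emb :: "pole \<Rightarrow> complex \<Rightarrow> vec3" where
  "emb South x = vector [Re x, Im x, 0]"
| "emb North x = vector [Re x, - Im x, 0]"

primrec coemb :: "pole \<Rightarrow> vec3 \<Rightarrow> complex" where
  "coemb South u = Complex (u$1) (u$2)"
| "coemb North u = Complex (u$1) (- (u$2))"

definition sq1 :: "complex \<Rightarrow> real" where
  "sq1 x = 1 + x \<bullet> x"

lemma sq1_pos [simp]: "sq1 x > 0" "sq1 x \<noteq> 0"
  unfolding sq1_def by (smt (verit) inner_ge_zero)+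

lemma sq1_cmod: "sq1 x = 1 + (cmod x)\<^sup>2"
  by (simp add: sq1_def dot_square_norm)

lemma inner_self_sq1: "x \<bullet> x = sq1 x - 1"
  by (simp add: sq1_def)

lemma has_derivative_sq1: "(sq1 has_derivative (\<lambda>X. 2 * (x \<bullet> X))) (at x within S)"
  unfolding sq1_def[abs_def] by (auto intro!: derivative_eq_intros simp: inner_commute)

lemma has_derivative_sq1_compose [derivative_intros]:
  "(f has_derivative f') (at x within S) \<Longrightarrow>
     ((\<lambda>x. sq1 (f x)) has_derivative (\<lambda>X. 2 * (f x \<bullet> f' X))) (at x within S)"
  using has_derivative_compose[OF _ has_derivative_sq1] by blast

lemma linear_emb: "linear (emb P)"
  by (cases P) (auto intro!: linearI simp: vec_eq_iff forall_3)

lemma linear_coemb: "linear (coemb P)"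
  by (cases P) (auto intro!: linearI simp: complex_eq_iff)

lemmas bounded_linear_emb = linear_emb[THEN linear_conv_bounded_linear[THEN iffD1]]
lemmas bounded_linear_coemb = linear_coemb[THEN linear_conv_bounded_linear[THEN iffD1]]

lemma emb_linear_simps [simp]:
  "emb P (x + y) = emb P x + emb P y" "emb P (r *\<^sub>R x) = r *\<^sub>R emb P x"
  "emb P (x - y) = emb P x - emb P y" "emb P 0 = 0" "emb P (- x) = - emb P x"
  using linear_emb[of P] by (auto simp: linear_add linear_scale linear_diff linear_0 linear_neg)

lemma coemb_linear_simps [simp]:
  "coemb P (x + y) = coemb P x + coemb P y" "coemb P (r *\<^sub>R x) = r *\<^sub>R coemb P x"
  "coemb P (x - y) = coemb P x - coemb P y" "coemb P 0 = 0" "coemb P (- x) = - coemb P x"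
  using linear_coemb[of P] by (auto simp: linear_add linear_scale linear_diff linear_0 linear_neg)

lemma emb_inner: "emb P x \<bullet> u = x \<bullet> coemb P u"
  by (cases P) (auto simp: inner_vec_def sum_3 inner_complex_def)

lemma emb_inner': "u \<bullet> emb P x = x \<bullet> coemb P u"
  by (metis emb_inner inner_commute)

lemma coemb_emb [simp]: "coemb P (emb P x) = x"
  by (cases P) (auto simp: complex_eq_iff)

lemma coemb_pole [simp]: "coemb P (pole_pt P) = 0"
  by (cases P) (auto simp: complex_eq_iff)

lemma pole_inner_pole [simp]: "pole_pt P \<bullet> pole_pt P = 1"
  by (cases P) (auto simp: inner_vec_def sum_3)

lemma emb_inner_pole [simp]: "emb P x \<bullet> pole_pt P = 0" "pole_pt P \<bullet> emb P x = 0"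
  by (simp_all add: emb_inner emb_inner')

lemma emb_coemb: "emb P (coemb P u) = u - (u \<bullet> pole_pt P) *\<^sub>R pole_pt P"
  by (cases P) (auto simp: inner_vec_def sum_3 vec_eq_iff forall_3)

lemma inner_coemb: "coemb P u \<bullet> coemb P v = u \<bullet> v - (u \<bullet> pole_pt P) * (v \<bullet> pole_pt P)"
  by (simp add: emb_inner[symmetric] emb_coemb inner_diff_left inner_commute[of "pole_pt P"])

lemma dir_param_eq:
  "dir_param P x = (2 / sq1 x) *\<^sub>R (emb P x - pole_pt P) + pole_pt P"
proof -
  define D where "D = sq1 x"
  have *: "(cmod x)\<^sup>2 = D - 1" by (simp add: sq1_cmod D_def)
  have "D \<noteq> 0" by (simp add: D_def)
  then show ?thesis
    unfolding D_def[symmetric]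
    by (cases P) (auto simp: vec_eq_iff forall_3 * field_simps)
qed

lemma dir_coord_eq: "dir_coord P u = (1 / (1 - u \<bullet> pole_pt P)) *\<^sub>R coemb P u"
  by (cases P) (auto simp: inner_vec_def sum_3 scaleR_conv_of_real)

lemma dir_param_inner_pole: "dir_param P x \<bullet> pole_pt P = 1 - 2 / sq1 x"
  by (simp add: dir_param_eq inner_add_left inner_diff_left)

lemma dir_param_inner: "w \<bullet> dir_param P x = (2 / sq1 x) * (x \<bullet> coemb P w - w \<bullet> pole_pt P) + w \<bullet> pole_pt P"
  by (simp add: dir_param_eq inner_add_right inner_diff_right emb_inner')

lemma norm_dir_param: "dir_param P x \<bullet> dir_param P x = 1"
proof -
  have "sq1 x \<noteq> 0" by simp
  then show ?thesis
    unfolding dir_param_eq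
    by (simp add: inner_add_left inner_add_right inner_diff_left inner_diff_right emb_inner inner_self_sq1
        field_simps power2_eq_square)
qed

lemma S2_iff: "u \<in> S2 \<longleftrightarrow> u \<bullet> u = 1"
  by (simp add: S2_def norm_eq_1)

lemma dir_param_S2 [simp]: "dir_param P x \<in> S2"
  by (simp add: S2_iff norm_dir_param)

lemma dir_param_not_pole [simp]: "dir_param P x \<noteq> pole_pt P"
proof
  assume "dir_param P x = pole_pt P"
  then have "dir_param P x \<bullet> pole_pt P = 1" by simp
  then show False by (simp add: dir_param_inner_pole)
qed

lemma S2_not_pole_iff: assumes "u \<in> S2" shows "u \<noteq> pole_pt P \<longleftrightarrow> u \<bullet> pole_pt P \<noteq> 1"
proof -
  have "(u - pole_pt P) \<bullet> (u - pole_pt P) = 2 - 2 * (u \<bullet> pole_pt P)"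
    using assms by (simp add: S2_iff inner_diff_left inner_diff_right inner_commute)
  then show ?thesis by auto
qed

lemma dir_coord_param [simp]: "dir_coord P (dir_param P x) = x"
  by (simp add: dir_coord_eq dir_param_inner_pole) (simp add: dir_param_eq)

lemma dir_param_coord:
  assumes "u \<in> S2" "u \<noteq> pole_pt P"
  shows "dir_param P (dir_coord P u) = u"
proof -
  define s where "s = u \<bullet> pole_pt P"
  have s1: "1 - s \<noteq> 0" using S2_not_pole_iff[OF assms(1)] assms(2) s_def by auto
  have c: "coemb P u \<bullet> coemb P u = (1 - s) * (1 + s)"
    using assms by (simp add: inner_coemb S2_iff s_def algebra_simps)
  have D: "sq1 (dir_coord P u) = 2 / (1 - s)"
    using s1 by (simp add: sq1_def dir_coord_eq c s_def[symmetric]) (simp add: field_simps)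
  have h: "2 / (2 / (1 - s)) = 1 - s" and h': "(1 - s) *\<^sub>R emb P (dir_coord P u) = u - s *\<^sub>R pole_pt P"
    using s1 by (simp_all add: dir_coord_eq s_def[symmetric] emb_coemb)
  show ?thesis
    unfolding dir_param_eq D h scaleR_diff_right h' by (simp add: scaleR_left_diff_distrib)
qed

text \<open>The first and second derivatives of \<^const>\<open>dir_param\<close>, and the derivative of
  \<^const>\<open>dir_coord\<close>.\<close>

definition dparam :: "pole \<Rightarrow> complex \<Rightarrow> complex \<Rightarrow> vec3" where
  "dparam P x X = (2 / sq1 x) *\<^sub>R emb P X - (4 * (x \<bullet> X) / (sq1 x)\<^sup>2) *\<^sub>R (emb P x - pole_pt P)"

definition d2param :: "pole \<Rightarrow> complex \<Rightarrow> complex \<Rightarrow> complex \<Rightarrow> vec3" where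
  "d2param P x X Y = (16 * (x \<bullet> X) * (x \<bullet> Y) / (sq1 x)^3 - 4 * (X \<bullet> Y) / (sq1 x)\<^sup>2) *\<^sub>R (emb P x - pole_pt P)
     - (4 * (x \<bullet> Y) / (sq1 x)\<^sup>2) *\<^sub>R emb P X - (4 * (x \<bullet> X) / (sq1 x)\<^sup>2) *\<^sub>R emb P Y"

definition dcoord :: "pole \<Rightarrow> vec3 \<Rightarrow> vec3 \<Rightarrow> complex" where
  "dcoord P u v = (1 / (1 - u \<bullet> pole_pt P)) *\<^sub>R coemb P v
     + ((v \<bullet> pole_pt P) / (1 - u \<bullet> pole_pt P)\<^sup>2) *\<^sub>R coemb P u"

lemmas has_derivative_emb [derivative_intros] = bounded_linear.has_derivative[OF bounded_linear_emb]
lemmas has_derivative_coemb [derivative_intros] = bounded_linear.has_derivative[OF bounded_linear_coemb]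

lemma has_derivative_dir_param: "(dir_param P has_derivative dparam P x) (at x within S)"
proof -
  have *: "dir_param P = (\<lambda>x. (2 / sq1 x) *\<^sub>R (emb P x - pole_pt P) + pole_pt P)"
    using dir_param_eq by blast
  have "sq1 x \<noteq> 0" by simp
  then show ?thesis
    unfolding *
    apply (auto intro!: derivative_eq_intros)
    apply (rule ext)
    apply (simp add: dparam_def inner_commute power2_eq_square field_simps)
    done
qed

lemma has_derivative_dparam: "((\<lambda>y. dparam P y X) has_derivative d2param P x X) (at x within S)"
proof -
  have ne: "sq1 x \<noteq> 0" by simp
  then have ne2: "sq1 x * sq1 x \<noteq> 0" by auto
  show ?thesis
    unfolding dparam_def using ne ne2
    apply (auto intro!: derivative_eq_intros)
    apply (rule ext)
    apply (simp add: d2param_def inner_commute power2_eq_square power3_eq_cube power4_eq_xxxx divide_simps)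
    apply (simp add: algebra_simps)
    apply (simp add: scaleR_left_distrib[symmetric])
    apply (simp add: field_simps)
    done
qed

lemma d2param_commute: "d2param P x X Y = d2param P x Y X"
  by (simp add: d2param_def inner_commute algebra_simps)

lemma linear_dparam: "linear (dparam P x)"
  using has_derivative_dir_param has_derivative_linear by blast

lemma has_derivative_dir_coord:
  assumes "u \<bullet> pole_pt P \<noteq> 1"
  shows "(dir_coord P has_derivative dcoord P u) (at u within S)"
proof -
  have *: "dir_coord P = (\<lambda>u. (1 / (1 - u \<bullet> pole_pt P)) *\<^sub>R coemb P u)"
    using dir_coord_eq by blast
  have "1 - u \<bullet> pole_pt P \<noteq> 0" using assms by auto
  then show ?thesis
    unfolding *
    apply (auto intro!: derivative_eq_intros)
    apply (rule ext)
    apply (simp add: dcoord_def power2_eq_square)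
    done
qed

text \<open>The charts are conformal, so the round metric is \<open>4 |dx|\<^sup>2 / (1 + |x|\<^sup>2)\<^sup>2\<close>.\<close>

lemma dparam_inner_dparam: "dparam P x X \<bullet> dparam P x Y = 4 / (sq1 x)\<^sup>2 * (X \<bullet> Y)"
proof -
  have ne: "sq1 x \<noteq> 0" by simp
  show ?thesis
    unfolding dparam_def
    apply (simp add: inner_diff_left inner_diff_right emb_inner inner_commute[of "pole_pt P"])
    using ne apply (simp add: divide_simps inner_commute inner_self_sq1)
    apply (simp add: algebra_simps power2_eq_square power4_eq_xxxx inner_commute)
    done
qed

lemma dparam_inner_dir_param: "dparam P x X \<bullet> dir_param P x = 0"
proof -
  have ne: "sq1 x \<noteq> 0" by simp
  show ?thesis
    unfolding dparam_def dir_param_eq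
    apply (simp add: inner_diff_left inner_diff_right inner_add_right emb_inner inner_commute[of "pole_pt P"])
    using ne apply (simp add: divide_simps inner_commute inner_self_sq1)
    apply (simp add: algebra_simps power2_eq_square power4_eq_xxxx inner_commute)
    done
qed

lemma dparam_dcoord:
  assumes "dir_param P x = u" "u \<bullet> v = 0"
  shows "dparam P x (dcoord P u v) = v"
proof -
  have ne: "sq1 x \<noteq> 0" by simp
  have up: "1 - u \<bullet> pole_pt P = 2 / sq1 x" using dir_param_inner_pole assms by force
  have cu: "coemb P u = (2 / sq1 x) *\<^sub>R x" using assms(1) by (simp add: dir_param_eq flip: assms(1))
  define r where "r = v \<bullet> pole_pt P"
  define y where "y = coemb P v"
  have 0: "v = emb P y + r *\<^sub>R pole_pt P" by (simp add: y_def r_def emb_coemb)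
  have 1: "2 * (x \<bullet> y) = r * (2 - sq1 x)"
    using assms(2) ne unfolding assms(1)[symmetric] dir_param_eq 0
    by (simp add: inner_add_left inner_add_right inner_diff_left emb_inner inner_self_sq1 field_simps)
  have 2: "dcoord P u v = (sq1 x / 2) *\<^sub>R (y + r *\<^sub>R x)"
    unfolding dcoord_def up cu using ne by (simp add: r_def y_def power2_eq_square field_simps scaleR_add_right)
  have 3: "x \<bullet> dcoord P u v = sq1 x / 2 * (r * (2 - sq1 x) / 2 + r * (sq1 x - 1))"
    unfolding 2 using 1 by (simp add: inner_add_right inner_self_sq1)
  also have "\<dots> = (sq1 x)\<^sup>2 / 4 * r"
    by (simp add: power2_eq_square field_simps)
  finally have 3: "4 * (x \<bullet> dcoord P u v) / (sq1 x)\<^sup>2 = r" by (simp add: field_simps)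
  show ?thesis
    unfolding dparam_def 3 unfolding 2 unfolding 0
    by (simp add: scaleR_add_right scaleR_diff_right)
qed

declare emb.simps [simp del] coemb.simps [simp del] dir_param.simps [simp del] dir_coord.simps [simp del] pole_pt.simps [simp del]

section \<open>Global holomorphic sections\<close>

text \<open>The polynomials that occur as coordinates of the conformal fields of the sphere: half of this one
  is the coordinate of the tangential part of the constant vector \<open>a\<close>, and \<open>- \<i> / 2\<close> times it
  is the coordinate of the rotation \<open>u \<mapsto> a \<times> u\<close>.\<close>

definition quad :: "pole \<Rightarrow> vec3 \<Rightarrow> complex \<Rightarrow> complex" where
  "quad P a x = coemb P a + of_real (2 * (a \<bullet> pole_pt P)) * x - cnj (coemb P a) * x\<^sup>2"

lemma dcoord_at_param:
  "dcoord P (dir_param P x) v = (sq1 x / 2) *\<^sub>R (coemb P v + (v \<bullet> pole_pt P) *\<^sub>R x)"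
proof -
  have up: "1 - dir_param P x \<bullet> pole_pt P = 2 / sq1 x" using dir_param_inner_pole by force
  have cu: "coemb P (dir_param P x) = (2 / sq1 x) *\<^sub>R x" by (simp add: dir_param_eq)
  show ?thesis
    unfolding dcoord_def up cu by (simp add: power2_eq_square scaleR_add_right)
qed

lemma quad_alt: "quad P a x = sq1 x *\<^sub>R coemb P a + (2 * (a \<bullet> pole_pt P - x \<bullet> coemb P a)) *\<^sub>R x"
  by (simp add: quad_def complex_eq_iff sq1_def inner_complex_def power2_eq_square algebra_simps)

lemma dcoord_translation:
  "dcoord P (dir_param P x) (b - (b \<bullet> dir_param P x) *\<^sub>R dir_param P x) = quad P b x / 2"
proof -
  have up: "dir_param P x \<bullet> pole_pt P = 1 - 2 / sq1 x" using dir_param_inner_pole by force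
  have cu: "coemb P (dir_param P x) = (2 / sq1 x) *\<^sub>R x" by (simp add: dir_param_eq)
  define r where "r = b \<bullet> dir_param P x"
  have r: "sq1 x * (b \<bullet> pole_pt P - r) = 2 * (b \<bullet> pole_pt P - x \<bullet> coemb P b)"
    unfolding r_def dir_param_inner by (simp add: field_simps)
  have "dcoord P (dir_param P x) (b - r *\<^sub>R dir_param P x)
      = (sq1 x / 2) *\<^sub>R (coemb P b + (b \<bullet> pole_pt P - r) *\<^sub>R x)"
    by (simp add: dcoord_at_param inner_diff_left up cu scaleR_add_right[symmetric] field_simps)
      (simp add: scaleR_conv_of_real field_simps)
  also have "\<dots> = (1/2) *\<^sub>R (sq1 x *\<^sub>R coemb P b + (sq1 x * (b \<bullet> pole_pt P - r)) *\<^sub>R x)"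
    by (simp add: scaleR_add_right)
  also have "\<dots> = quad P b x / 2"
    unfolding r quad_alt by (simp add: scaleR_conv_of_real)
  finally show ?thesis unfolding r_def .
qed

lemma coemb_cross_pole: "coemb P (w \<otimes> pole_pt P) = \<i> * coemb P w"
  by (cases P) (simp_all add: pole_pt.simps emb.simps coemb.simps cross3_def complex_eq_iff)

lemma coemb_cross_emb: "coemb P (w \<otimes> emb P x) = - \<i> * of_real (w \<bullet> pole_pt P) * x"
  by (cases P) (simp_all add: pole_pt.simps emb.simps coemb.simps cross3_def complex_eq_iff inner_vec_def sum_3)

lemma cross_emb_inner_pole: "(w \<otimes> emb P x) \<bullet> pole_pt P = Im (cnj x * coemb P w)"
  by (cases P) (simp_all add: pole_pt.simps emb.simps coemb.simps cross3_def inner_vec_def sum_3)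

lemma dcoord_rotation: "dcoord P (dir_param P x) (w \<otimes> dir_param P x) = - (\<i> / 2) * quad P w x"
proof -
  have c: "w \<otimes> dir_param P x = (2 / sq1 x) *\<^sub>R (w \<otimes> emb P x - w \<otimes> pole_pt P) + w \<otimes> pole_pt P"
    by (simp add: dir_param_eq cross_add_right cross_mult_right Cross3.right_diff_distrib)
  have 1: "(sq1 x / 2) *\<^sub>R coemb P (w \<otimes> dir_param P x)
     = (- \<i> * of_real (w \<bullet> pole_pt P) * x - \<i> * coemb P w) + (sq1 x / 2) *\<^sub>R (\<i> * coemb P w)"
    unfolding c by (simp add: coemb_cross_pole coemb_cross_emb scaleR_add_right)
  have 2: "sq1 x / 2 * ((w \<otimes> dir_param P x) \<bullet> pole_pt P) = Im (cnj x * coemb P w)"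
    unfolding c by (simp add: inner_add_left inner_diff_left cross_emb_inner_pole dot_cross_self)
  have "dcoord P (dir_param P x) (w \<otimes> dir_param P x)
      = (sq1 x / 2) *\<^sub>R coemb P (w \<otimes> dir_param P x) + (sq1 x / 2 * ((w \<otimes> dir_param P x) \<bullet> pole_pt P)) *\<^sub>R x"
    by (simp add: dcoord_at_param scaleR_add_right)
  also have "\<dots> = - (\<i> / 2) * quad P w x"
    unfolding 1 2 by (simp add: quad_def complex_eq_iff sq1_def inner_complex_def power2_eq_square field_simps)
  finally show ?thesis .
qed

lemma inner_dparam: "w \<bullet> dparam P x X = 2 / (sq1 x)\<^sup>2 * (quad P w x \<bullet> X)"
proof -
  have "(sq1 x)\<^sup>2 * (w \<bullet> dparam P x X) = (2 * sq1 x) * (coemb P w \<bullet> X) - 4 * (x \<bullet> X) * (coemb P w \<bullet> x - w \<bullet> pole_pt P)"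
    unfolding dparam_def
    by (simp add: inner_diff_right inner_add_right emb_inner' power2_eq_square field_simps inner_commute)
  also have "\<dots> = 2 * (quad P w x \<bullet> X)"
    unfolding quad_alt by (simp add: inner_add_left inner_commute algebra_simps)
  finally show ?thesis by (simp add: field_simps)
qed

lemma dparam_rotation: "dparam P x (- (\<i> / 2) * quad P w x) = w \<otimes> dir_param P x"
  using dparam_dcoord[of P x "dir_param P x" "w \<otimes> dir_param P x"]
  by (simp add: dcoord_rotation dot_cross_self)

text \<open>The section \<open>u \<mapsto> w \<times> u\<close>, translated by \<open>b\<close>. There are six real parameters, as many as in \<open>\<beta>\<^sub>1 + \<beta>\<^sub>2 \<xi> + \<beta>\<^sub>3 \<xi>\<^sup>2\<close>.\<close>

definition hsec :: "vec3 \<Rightarrow> vec3 \<Rightarrow> vec3 \<Rightarrow> line" where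
  "hsec b w u = (u, b - (b \<bullet> u) *\<^sub>R u + w \<otimes> u)"

lemma fibre_coord_eq:
  assumes "u \<bullet> pole_pt P \<noteq> 1"
  shows "fibre_coord P (u, v) = dcoord P u v"
  unfolding fibre_coord_def dir_deriv_def
  using frechet_derivative_at[OF has_derivative_dir_coord[OF assms]] by simp

lemma dir_param_inner_pole_ne [simp]: "dir_param P x \<bullet> pole_pt P \<noteq> 1"
  by (simp add: dir_param_inner_pole)

lemma linear_dcoord: "linear (dcoord P u)"
  by (rule linearI) (auto simp: dcoord_def inner_add_left scaleR_add_right add_divide_distrib scaleR_add_left)

lemma fibre_coord_hsec:
  "fibre_coord P (hsec b w (dir_param P x)) = quad P b x / 2 - (\<i> / 2) * quad P w x"
  by (simp add: hsec_def fibre_coord_eq linear_add[OF linear_dcoord] dcoord_translation dcoord_rotation)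

lemma dir_param_transition:
  assumes "x \<noteq> 0" shows "dir_param South x = dir_param North (1 / x)" 
proof -
  define n where "n = (cmod x)\<^sup>2"
  have n: "n \<noteq> 0" "n > 0" using assms by (auto simp: n_def)
  have 1: "(cmod (1 / x))\<^sup>2 = 1 / n" by (simp add: norm_divide n_def power_divide)
  have 2: "Re (1 / x) = Re x / n" "Im (1 / x) = - Im x / n"
    by (simp_all add: Re_divide Im_divide n_def cmod_power2)
  show ?thesis
    using n by (simp add: dir_param.simps 1 2 n_def[symmetric] vec_eq_iff forall_3 field_simps)
qed

text \<open>The change of charts is \<open>x \<mapsto> 1 / x\<close>, and a vector is multiplied by the derivative
  \<open>- 1 / x\<^sup>2\<close>.\<close>

lemma fibre_coord_transition:
  assumes "x \<noteq> 0" "dir_param South x \<bullet> v = 0"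
  shows "fibre_coord North (dir_param South x, v) = - fibre_coord South (dir_param South x, v) / x\<^sup>2"
proof -
  let ?u = "dir_param South x"
  have ne: "?u \<bullet> pole_pt North \<noteq> 1"
    using dir_param_transition[OF assms(1)] by simp
  define X where "X = dcoord South ?u v"
  have v: "v = dparam South x X" using dparam_dcoord assms unfolding X_def by metis
  have "((\<lambda>y. dir_coord North (dir_param South y)) has_derivative (\<lambda>X. dcoord North ?u (dparam South x X))) (at x)"
    using ne by (intro has_derivative_compose[OF has_derivative_dir_param has_derivative_dir_coord]) auto
  then have "((\<lambda>y. 1 / y) has_derivative (\<lambda>X. dcoord North ?u (dparam South x X))) (at x)"
    by (rule has_derivative_transform_within_open[of _ _ _ _ "- {0}"])
       (use assms in \<open>auto simp: dir_param_transition\<close>)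
  moreover have "((\<lambda>y. 1 / y) has_derivative (\<lambda>X. - X / x\<^sup>2)) (at x)"
    using assms by (auto intro!: derivative_eq_intros simp: power2_eq_square divide_simps)
  ultimately have "(\<lambda>X. dcoord North ?u (dparam South x X)) = (\<lambda>X. - X / x\<^sup>2)"
    by (rule has_derivative_unique)
  then have "dcoord North ?u v = - X / x\<^sup>2" unfolding v by metis
  then show ?thesis using ne by (simp add: fibre_coord_eq X_def)
qed

lemma hsec_TS2: "u \<in> S2 \<Longrightarrow> hsec b w u \<in> TS2"
  by (simp add: hsec_def TS2_def S2_iff inner_add_right inner_diff_right dot_cross_self inner_commute)

lemma fibre_coord_inject:
  assumes "dir_param P x \<bullet> v = 0" "dir_param P x \<bullet> v' = 0"
    and "fibre_coord P (dir_param P x, v) = fibre_coord P (dir_param P x, v')"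
  shows "v = v'"
  using assms dparam_dcoord[of P x "dir_param P x"] by (metis dir_param_inner_pole_ne fibre_coord_eq)

lemma isCont_quad: "isCont (quad P a) x"
  unfolding quad_def[abs_def] by (intro continuous_intros)

text \<open>The coordinate of the section in the chart \<^const>\<open>South\<close> is an entire function. Its growth is at
  most quadratic, because the coordinate in the other chart is bounded near the remaining pole, so it
  is a quadratic polynomial by Liouville. The three complex coefficients determine \<open>b\<close> and \<open>w\<close>.\<close>

theorem global_holomorphic_section_hsec:
  assumes "global_holomorphic_section s"
  obtains b w where "\<And>u. u \<in> S2 \<Longrightarrow> s u = hsec b w u"
proof -
  define f where "f = (\<lambda>P x. fibre_coord P (s (dir_param P x)))"
  have hol: "f P holomorphic_on UNIV" for P
    using assms unfolding global_holomorphic_section_def f_def by auto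
  have s: "s u = (u, snd (s u))" "u \<bullet> snd (s u) = 0" if "u \<in> S2" for u
    using assms that unfolding global_holomorphic_section_def TS2_def by (auto simp: prod_eq_iff)
  have f: "f P x = fibre_coord P (dir_param P x, snd (s (dir_param P x)))" for P x
    unfolding f_def using s(1)[OF dir_param_S2] by metis
  have trans: "f North (1 / x) = - f South x / x\<^sup>2" if "x \<noteq> 0" for x
    unfolding f dir_param_transition[OF that, symmetric]
    using fibre_coord_transition[OF that] s(2) by simp
  have "compact (f North ` cball 0 1)"
    by (intro compact_continuous_image holomorphic_on_imp_continuous_on holomorphic_on_subset[OF hol]) auto
  then obtain B where B: "\<And>y. cmod y \<le> 1 \<Longrightarrow> cmod (f North y) \<le> B"
    by (meson bounded_iff compact_imp_bounded image_eqI mem_cball_0)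
  have sum: "f South x = (\<Sum>k\<le>2. (deriv^^k) (f South) 0 / fact k * x ^ k)" for x
  proof (rule Liouville_polynomial[OF hol[of South], of 1 B])
    fix z :: complex assume z: "1 \<le> cmod z"
    then have z0: "z \<noteq> 0" by auto
    have "cmod (f North (1 / z)) \<le> B" using z z0 by (intro B) (simp add: norm_divide divide_le_eq)
    then have "cmod (f South z) / (cmod z)\<^sup>2 \<le> B"
      using trans[OF z0] by (simp add: norm_divide norm_power)
    then show "cmod (f South z) \<le> B * cmod z ^ 2"
      using z0 by (simp add: divide_le_eq)
  qed
  define c where "c = (\<lambda>k. (deriv ^^ k) (f South) 0 / fact k)"
  have c: "f South x = c 0 + c 1 * x + c 2 * x\<^sup>2" for x
    by (subst sum) (simp add: c_def numeral_2_eq_2)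
  \<comment> \<open>The solution of \<open>coemb b - \<i> coemb w = 2 c\<^sub>0\<close> and \<open>cnj (coemb b) - \<i> cnj (coemb w) = - 2 c\<^sub>2\<close>.\<close>
  define b where "b = emb South (c 0 - cnj (c 2)) + Re (c 1) *\<^sub>R pole_pt South"
  define w where "w = emb South (\<i> * (c 0 + cnj (c 2))) - Im (c 1) *\<^sub>R pole_pt South"
  have fS: "f South x = fibre_coord South (hsec b w (dir_param South x))" for x
    unfolding fibre_coord_hsec c quad_def b_def w_def
    by (simp add: inner_add_left inner_diff_left)
       (simp add: complex_eq_iff power2_eq_square field_simps)
  have sh: "s u = hsec b w u" if "u = dir_param P x" "f P x = fibre_coord P (hsec b w u)" for u P x
  proof -
    have "u \<bullet> snd (hsec b w u) = 0" using hsec_TS2[of u b w] that by (auto simp: TS2_def hsec_def)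
    then have "snd (s u) = snd (hsec b w u)"
      using that s(2)[of u] by (intro fibre_coord_inject[of P x]) (auto simp: f hsec_def)
    then show ?thesis using s(1)[of u] that by (simp add: hsec_def)
  qed
  \<comment> \<open>The pole that the chart misses is reached by continuity in the other chart.\<close>
  have "s u = hsec b w u" if u: "u \<in> S2" for u
  proof (cases "u = pole_pt South")
    case False
    then show ?thesis
      using dir_param_coord[OF u False] fS by (intro sh[of _ South "dir_coord South u"]) auto
  next
    case True
    have u0: "u = dir_param North 0"
      using True by (simp add: dir_param.simps pole_pt.simps vec_eq_iff forall_3)
    define g where "g = (\<lambda>y. fibre_coord North (hsec b w (dir_param North y)))"
    have "f North y = g y" if "y \<noteq> 0" for y
    proof -
      define x where "x = 1 / y"
      have x: "x \<noteq> 0" "y = 1 / x" using that by (auto simp: x_def)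
      have "f North y = - f South x / x\<^sup>2" using trans x by simp
      also have "\<dots> = g y"
        unfolding fS g_def x(2) dir_param_transition[OF x(1), symmetric]
        using fibre_coord_transition[OF x(1), of "snd (hsec b w (dir_param South x))"] hsec_TS2[of "dir_param South x" b w]
        by (simp add: hsec_def TS2_def)
      finally show ?thesis .
    qed
    then have ev: "\<forall>\<^sub>F y in at 0. f North y = g y"
      by (simp add: eventually_at_filter)
    have "isCont (f North) 0"
      using hol[of North] by (metis UNIV_I continuous_on_eq_continuous_at holomorphic_on_imp_continuous_on open_UNIV)
    moreover have "isCont g 0"
      unfolding g_def fibre_coord_hsec by (intro continuous_intros isCont_quad) simp_all
    ultimately have "(g \<longlongrightarrow> f North 0) (at 0)" "(g \<longlongrightarrow> g 0) (at 0)"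
      unfolding isCont_def using tendsto_cong[OF ev] by auto
    then have "f North 0 = g 0" by (rule LIM_unique)
    then show ?thesis
      unfolding g_def u0 by (intro sh[of _ North 0] refl)
  qed
  then show thesis by (rule that)
qed

section \<open>The geodesic equation on the sphere of directions\<close>

definition dquad :: "pole \<Rightarrow> vec3 \<Rightarrow> complex \<Rightarrow> complex" where
  "dquad P a x = of_real (2 * (a \<bullet> pole_pt P)) - 2 * cnj (coemb P a) * x"

lemma has_field_derivative_quad: "(quad P a has_field_derivative dquad P a x) (at x within S)"
  unfolding quad_def[abs_def] dquad_def by (auto intro!: derivative_eq_intros)

text \<open>The conformal factor of the induced metric with respect to \<open>|dx|\<^sup>2\<close>. It depends on \<open>w\<close>
  alone, since translations are isometries that fix all directions.\<close>

definition conf :: "pole \<Rightarrow> vec3 \<Rightarrow> complex \<Rightarrow> real" where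
  "conf P w x = - 4 * (w \<bullet> dir_param P x) / (sq1 x)\<^sup>2"

text \<open>The geodesic equation of the metric \<open>(w \<bullet> u) g\<close> on the unit sphere with round metric \<open>g\<close> says that the
  tangential part of \<open>((w \<bullet> u) u')'\<close> is that of \<open>(|u'|\<^sup>2 / 2) w\<close>. Together with
  \<open>u \<bullet> u'' = - |u'|\<^sup>2\<close> this determines \<open>u''\<close>. The value does not change when \<open>w\<close> is
  multiplied by a nonzero scalar.\<close>

definition acc :: "vec3 \<Rightarrow> vec3 \<Rightarrow> vec3 \<Rightarrow> vec3" where
  "acc w u v = (1 / (w \<bullet> u)) *\<^sub>R (((v \<bullet> v) / 2) *\<^sub>R w - (w \<bullet> v) *\<^sub>R v) - (3 / 2 * (v \<bullet> v)) *\<^sub>R u"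

definition geo :: "vec3 \<Rightarrow> real set \<Rightarrow> (real \<Rightarrow> vec3) \<Rightarrow> (real \<Rightarrow> vec3) \<Rightarrow> bool" where
  "geo w J u v \<longleftrightarrow> (\<forall>t\<in>J. (u has_vector_derivative v t) (at t) \<and>
     (v has_vector_derivative acc w (u t) (v t)) (at t) \<and> u t \<bullet> u t = 1 \<and> w \<bullet> u t \<noteq> 0)"

lemma dparam_compose:
  assumes "(f has_derivative f') (at x within S)" "(g has_derivative g') (at x within S)"
  shows "((\<lambda>r. dparam P (f r) (g r)) has_derivative
           (\<lambda>h. d2param P (f x) (g x) (f' h) + dparam P (f x) (g' h))) (at x within S)"
proof -
  have ne: "sq1 (f x) \<noteq> 0" by simp
  then have ne2: "sq1 (f x) * sq1 (f x) \<noteq> 0" by auto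
  show ?thesis
    unfolding dparam_def using ne ne2
    apply (auto intro!: derivative_eq_intros assms)
    apply (rule ext)
    apply (simp add: d2param_def inner_commute power2_eq_square power3_eq_cube power4_eq_xxxx divide_simps)
    apply (simp add: algebra_simps)
    apply (simp add: scaleR_left_distrib[symmetric])
    apply (simp add: field_simps)
    done
qed

lemma dparam_along_curve:
  assumes "(x has_vector_derivative X t) (at t)" "(X has_vector_derivative A) (at t)"
  shows "((\<lambda>r. dparam P (x r) (X r)) has_vector_derivative (d2param P (x t) (X t) (X t) + dparam P (x t) A)) (at t)"
proof -
  have "((\<lambda>r. dparam P (x r) (X r)) has_derivative
      (\<lambda>h. d2param P (x t) (X t) (h *\<^sub>R X t) + dparam P (x t) (h *\<^sub>R A))) (at t)"
    using assms unfolding has_vector_derivative_def by (rule dparam_compose)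
  then show ?thesis
    unfolding has_vector_derivative_def linear_scale[OF has_derivative_linear[OF has_derivative_dparam]]
      linear_scale[OF linear_dparam] by (simp add: scaleR_add_right)
qed

lemma orth_determined:
  fixes a :: vec3
  assumes u: "u \<bullet> u = 1" "u \<bullet> v = 0" "u \<bullet> a = - (v \<bullet> v)" and h: "w \<bullet> u \<noteq> 0"
    and eq: "\<And>y. u \<bullet> y = 0 \<Longrightarrow> (w \<bullet> u) * (a \<bullet> y) + (w \<bullet> v) * (v \<bullet> y) - (v \<bullet> v) / 2 * (w \<bullet> y) = 0"
  shows "a = acc w u v"
proof -
  \<comment> \<open>The difference is tangential, and the equation for it says that it is orthogonal to itself.\<close>
  define r where "r = a - acc w u v"
  have "u \<bullet> acc w u v = - (v \<bullet> v)"
    using u h by (simp add: acc_def inner_diff_right inner_add_right inner_commute field_simps)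
  then have ru: "u \<bullet> r = 0" using u by (simp add: r_def inner_diff_right)
  have "(w \<bullet> u) * (acc w u v \<bullet> r) + (w \<bullet> v) * (v \<bullet> r) - (v \<bullet> v) / 2 * (w \<bullet> r) = 0"
    using h ru by (simp add: acc_def inner_diff_left inner_add_left field_simps)
  with eq[OF ru] have "(w \<bullet> u) * (r \<bullet> r) = 0"
    by (simp add: r_def inner_diff_left algebra_simps)
  then show ?thesis using h by (simp add: r_def)
qed

lemma acc_tangential:
  assumes "u \<bullet> y = 0" "w \<bullet> u \<noteq> 0"
  shows "(w \<bullet> u) * (acc w u v \<bullet> y) + (w \<bullet> v) * (v \<bullet> y) - (v \<bullet> v) / 2 * (w \<bullet> y) = 0"
  using assms by (simp add: acc_def inner_diff_left inner_add_left field_simps)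

lemma has_vector_derivative_cong_nhds:
  assumes "\<forall>\<^sub>F r in nhds t. g r = f r" "(f has_vector_derivative d) (at t)"
  shows "(g has_vector_derivative d) (at t)"
proof -
  obtain S where S: "open S" "t \<in> S" "\<And>r. r \<in> S \<Longrightarrow> g r = f r"
    using assms(1) unfolding eventually_nhds by blast
  show ?thesis
    by (rule has_vector_derivative_transform_within_open[OF assms(2) S(1,2)]) (simp add: S(3))
qed

lemma geo_velocity:
  assumes "geo w J u v" "open J" "t \<in> J"
  shows "u t \<bullet> v t = 0"
proof -
  have d: "(u has_vector_derivative v t) (at t)"
    using assms unfolding geo_def by blast
  have 1: "((\<lambda>r. u r \<bullet> u r) has_vector_derivative (u t \<bullet> v t + v t \<bullet> u t)) (at t)"
    using bounded_bilinear.has_vector_derivative[OF bounded_bilinear_inner d d] .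
  have 2: "((\<lambda>r. u r \<bullet> u r) has_vector_derivative 0) (at t)"
    by (rule has_vector_derivative_transform_within_open[of "\<lambda>_. 1", OF _ assms(2,3)])
       (use assms in \<open>auto simp: geo_def\<close>)
  show ?thesis using vector_derivative_unique_at[OF 1 2] by (simp add: inner_commute)
qed

text \<open>The parameters \<open>b\<close> and \<open>w\<close> are those of \<open>global_holomorphic_section_hsec\<close>.\<close>

locale hsphere =
  fixes s :: "vec3 \<Rightarrow> line" and b w :: vec3
  assumes s: "u \<in> S2 \<Longrightarrow> s u = hsec b w u"
begin

lemma fst_s: "u \<in> S2 \<Longrightarrow> fst (s u) = u"
  by (simp add: s hsec_def)

lemma surf_param_eq: "surf_param s P x = hsec b w (dir_param P x)"
  by (simp add: surf_param_def s)

definition fibre :: "pole \<Rightarrow> complex \<Rightarrow> complex" where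
  "fibre P x = quad P b x / 2 - (\<i> / 2) * quad P w x"

definition dfibre :: "pole \<Rightarrow> complex \<Rightarrow> complex" where
  "dfibre P x = dquad P b x / 2 - (\<i> / 2) * dquad P w x"

lemma surf_coord_eq: "surf_coord s P = (\<lambda>x. (x, fibre P x))"
  by (simp add: fun_eq_iff surf_coord_def surf_param_eq fibre_coord_hsec fibre_def)

lemma dir_deriv_surf_coord: "dir_deriv (surf_coord s P) x X = (X, dfibre P x * X)"
proof -
  have "(fibre P has_field_derivative dfibre P x) (at x)"
    unfolding fibre_def[abs_def] dfibre_def
    by (auto intro!: derivative_eq_intros has_field_derivative_quad)
  then have "(surf_coord s P has_derivative (\<lambda>X. (X, dfibre P x * X))) (at x)"
    unfolding surf_coord_eq has_field_derivative_def by (auto intro!: derivative_eq_intros)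
  from frechet_derivative_at[OF this, symmetric] show ?thesis unfolding dir_deriv_def by simp
qed

text \<open>The common factor of \<open>\<Omega>\<close> and \<open>\<G>\<close> on the sphere is the height \<open>w \<bullet> u\<close>. Hence the
  lagrangian points form the great circle orthogonal to \<open>w\<close>, and the metric is minus the height
  times the round metric.\<close>

lemma twist_factor:
  "dfibre P x - cnj (dfibre P x) + 2 * (x * cnj (fibre P x) - cnj x * fibre P x) / (1 + x * cnj x)
     = 2 * \<i> * of_real (w \<bullet> dir_param P x)"
proof -
  define D where "D = sq1 x"
  have D0: "D \<noteq> 0" by (simp add: D_def)
  have D: "D = 1 + (Re x)\<^sup>2 + (Im x)\<^sup>2" by (simp add: D_def sq1_def inner_complex_def power2_eq_square)
  have 1: "1 + x * cnj x = of_real D" by (simp add: complex_eq_iff D power2_eq_square)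
  have "of_real D * (dfibre P x - cnj (dfibre P x)) + 2 * (x * cnj (fibre P x) - cnj x * fibre P x)
     = 2 * \<i> * of_real (2 * (x \<bullet> coemb P w - w \<bullet> pole_pt P) + D * (w \<bullet> pole_pt P))"
    unfolding fibre_def dfibre_def quad_def dquad_def D
    by (simp add: complex_eq_iff inner_complex_def power2_eq_square field_simps)
  also have "\<dots> = of_real D * (2 * \<i> * of_real (w \<bullet> dir_param P x))"
    unfolding dir_param_inner D_def[symmetric] using D0 by (simp add: field_simps)
  finally have "dfibre P x - cnj (dfibre P x) + 2 * (x * cnj (fibre P x) - cnj x * fibre P x) / of_real D
     = 2 * \<i> * of_real (w \<bullet> dir_param P x)"
    using D0 by (simp add: field_simps)
  then show ?thesis unfolding 1 .
qed

lemma one_plus_cnj: "1 + x * cnj x = of_real (sq1 x)"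
  by (simp add: complex_eq_iff sq1_def inner_complex_def)

lemma induced_metric_eq: "induced_metric s P x X Y = conf P w x * (X \<bullet> Y)"
proof -
  let ?T = "dfibre P x - cnj (dfibre P x) + 2 * (x * cnj (fibre P x) - cnj x * fibre P x) / (1 + x * cnj x)"
  have XY: "X * cnj Y + Y * cnj X = of_real (2 * (X \<bullet> Y))"
    by (simp add: complex_eq_iff inner_complex_def)
  have gen: "(2 * \<i> / Q * (F * X * cY - cF * cX * Y + K * (X * cY))
      + 2 * \<i> / Q * (F * Y * cX - cF * cY * X + K * (Y * cX))) / 2
    = \<i> / Q * ((F - cF + K) * (X * cY + Y * cX))" for Q F K X Y cX cY cF :: complex
    by (cases "Q = 0") (simp_all add: field_simps)
  let ?A = "(X, dfibre P x * X)" and ?B = "(Y, dfibre P x * Y)"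
  have "(G_tensor (x, fibre P x) ?A ?B + G_tensor (x, fibre P x) ?B ?A) / 2
     = \<i> / (1 + x * cnj x)\<^sup>2 * (?T * (X * cnj Y + Y * cnj X))"
    unfolding G_tensor_def prod.case complex_cnj_mult by (rule gen)
  also have "\<dots> = of_real (conf P w x * (X \<bullet> Y))"
    unfolding twist_factor XY unfolding one_plus_cnj conf_def by (simp add: complex_eq_iff field_simps)
  finally show ?thesis
    unfolding induced_metric_def G_metric_def dir_deriv_surf_coord by (simp add: surf_coord_eq)
qed

lemma induced_Omega_eq:
  "induced_Omega s P x X Y = 4 * \<i> * of_real (w \<bullet> dir_param P x) / of_real ((sq1 x)\<^sup>2) * (X * cnj Y - Y * cnj X)"
proof -
  let ?T = "dfibre P x - cnj (dfibre P x) + 2 * (x * cnj (fibre P x) - cnj x * fibre P x) / (1 + x * cnj x)"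
  have gen: "2 / Q * (F * X * cY - F * Y * cX + (cF * cX * Y - cF * cY * X) + K * (X * cY - Y * cX))
    = 2 / Q * ((F - cF + K) * (X * cY - Y * cX))" for Q F K X Y cX cY cF :: complex
    by (cases "Q = 0") (simp_all add: field_simps)
  have "induced_Omega s P x X Y = 2 / (1 + x * cnj x)\<^sup>2 * (?T * (X * cnj Y - Y * cnj X))"
    unfolding induced_Omega_def dir_deriv_surf_coord
    unfolding surf_coord_eq Omega_def prod.case complex_cnj_mult by (rule gen)
  also have "\<dots> = 4 * \<i> * of_real (w \<bullet> dir_param P x) / of_real ((sq1 x)\<^sup>2) * (X * cnj Y - Y * cnj X)"
    unfolding twist_factor unfolding one_plus_cnj by simp
  finally show ?thesis .
qed

lemma induced_Omega_zero_iff: "(\<forall>X Y. induced_Omega s P x X Y = 0) \<longleftrightarrow> w \<bullet> dir_param P x = 0"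
proof
  assume "\<forall>X Y. induced_Omega s P x X Y = 0"
  then have "induced_Omega s P x 1 \<i> = 0" by blast
  then show "w \<bullet> dir_param P x = 0" unfolding induced_Omega_eq by simp
qed (simp add: induced_Omega_eq)

lemma South_ne_North: "pole_pt South \<noteq> pole_pt North"
  by (simp add: pole_pt.simps vec_eq_iff forall_3)

lemma ex_chart: assumes "u \<in> S2" obtains P x where "u \<noteq> pole_pt P" "u = dir_param P x"
  by (metis South_ne_North assms dir_param_coord)

lemma lagrangian_circle_eq: "lagrangian_circle s = s ` {u \<in> S2. w \<bullet> u = 0}"
proof -
  have "lagrangian_circle s = {surf_param s P x | P x. w \<bullet> dir_param P x = 0}"
    unfolding lagrangian_circle_def induced_Omega_zero_iff ..
  also have "\<dots> = s ` {u \<in> S2. w \<bullet> u = 0}"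
  proof (rule set_eqI, rule iffI)
    fix l assume "l \<in> s ` {u \<in> S2. w \<bullet> u = 0}"
    then obtain u where u: "u \<in> S2" "w \<bullet> u = 0" "l = s u" by blast
    obtain P x where "u = dir_param P x" using ex_chart[OF u(1)] by metis
    then show "l \<in> {surf_param s P x | P x. w \<bullet> dir_param P x = 0}"
      using u unfolding surf_param_def by blast
  qed (auto simp: surf_param_def)
  finally show ?thesis .
qed

lemma lagrangian_iff: "lagrangian s \<longleftrightarrow> w = 0"
proof
  assume "lagrangian s"
  then have *: "w \<bullet> dir_param P x = 0" for P x
    using induced_Omega_zero_iff unfolding lagrangian_def by blast
  show "w = 0"
  proof (rule ccontr)
    assume "w \<noteq> 0"
    then have "(1 / norm w) *\<^sub>R w \<in> S2" by (simp add: S2_def)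
    then obtain P x where "(1 / norm w) *\<^sub>R w = dir_param P x" by (metis ex_chart)
    then have "w \<bullet> ((1 / norm w) *\<^sub>R w) = 0" using * by metis
    then show False using \<open>w \<noteq> 0\<close> by simp
  qed
qed (simp add: lagrangian_def induced_Omega_eq)

lemma reg_surf_eq: "reg_surf s = s ` {u \<in> S2. w \<bullet> u \<noteq> 0}"
  unfolding reg_surf_def surf_def lagrangian_circle_eq
proof -
  have "inj_on s S2" using fst_s by (intro inj_onI) metis
  then have "s ` S2 - s ` {u \<in> S2. w \<bullet> u = 0} = s ` (S2 - {u \<in> S2. w \<bullet> u = 0})"
    by (subst inj_on_image_set_diff[of s S2]) auto
  also have "S2 - {u \<in> S2. w \<bullet> u = 0} = {u \<in> S2. w \<bullet> u \<noteq> 0}" by blast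
  finally show "s ` S2 - s ` {u \<in> S2. w \<bullet> u = 0} = s ` {u \<in> S2. w \<bullet> u \<noteq> 0}" .
qed

lemma reg_surfD: assumes "l \<in> reg_surf s" shows "fst l \<in> S2" "w \<bullet> fst l \<noteq> 0" "l = s (fst l)"
  using assms fst_s unfolding reg_surf_eq by auto

lemma surf_param_reg_iff: "surf_param s P x \<in> reg_surf s \<longleftrightarrow> w \<bullet> dir_param P x \<noteq> 0"
proof
  assume "surf_param s P x \<in> reg_surf s"
  from reg_surfD(2)[OF this] show "w \<bullet> dir_param P x \<noteq> 0"
    by (simp add: surf_param_def fst_s)
next
  assume "w \<bullet> dir_param P x \<noteq> 0"
  then show "surf_param s P x \<in> reg_surf s"
    unfolding reg_surf_eq surf_param_def by (intro imageI) simp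
qed

lemma induced_metric_eq': "induced_metric s P x X Y = - (w \<bullet> dir_param P x) * (dparam P x X \<bullet> dparam P x Y)"
  by (simp add: induced_metric_eq conf_def dparam_inner_dparam)

lemma dir_deriv_metric:
  "dir_deriv (\<lambda>y. induced_metric s P y X Y) x Z = - (w \<bullet> dparam P x Z) * (dparam P x X \<bullet> dparam P x Y)
     - (w \<bullet> dir_param P x) * (d2param P x X Z \<bullet> dparam P x Y + dparam P x X \<bullet> d2param P x Y Z)"
proof -
  have "((\<lambda>y. induced_metric s P y X Y) has_derivative (\<lambda>Z. - (w \<bullet> dparam P x Z) * (dparam P x X \<bullet> dparam P x Y)
     - (w \<bullet> dir_param P x) * (d2param P x X Z \<bullet> dparam P x Y + dparam P x X \<bullet> d2param P x Y Z))) (at x)"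
    unfolding induced_metric_eq'
    by (auto intro!: derivative_eq_intros has_derivative_dir_param has_derivative_dparam simp: fun_eq_iff algebra_simps)
  from frechet_derivative_at[OF this, symmetric] show ?thesis unfolding dir_deriv_def by simp
qed

text \<open>For a metric \<open>- (w \<bullet> u) (D\<^sub>X u \<bullet> D\<^sub>Y u)\<close> pulled back from space, the terms with the second
  derivative of the chart in the Christoffel symbols combine, by symmetry of that derivative, into the
  acceleration of the curve in space. No explicit Christoffel symbols are needed.\<close>

lemma covariant_acceleration:
  fixes P x X A
  defines "V \<equiv> dparam P x X" and "U \<equiv> d2param P x X X + dparam P x A"
  shows "induced_metric s P x A Z + christoffel (induced_metric s P) x X X Z
    = - ((w \<bullet> dir_param P x) * (U \<bullet> dparam P x Z) + (w \<bullet> V) * (V \<bullet> dparam P x Z) - (V \<bullet> V) / 2 * (w \<bullet> dparam P x Z))"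
  unfolding christoffel_def dir_deriv_metric U_def V_def
  by (simp add: induced_metric_eq' inner_add_left d2param_commute[of P x Z X] inner_commute[of "d2param P x X Z"] field_simps)

text \<open>At each time there is a chart around the position. The chart equation gives the tangential part
  of the acceleration in space, the constraint \<open>u \<bullet> u = 1\<close> gives the normal part.\<close>

lemma geodesic_imp_geo:
  assumes g: "geodesic s J \<gamma>"
  obtains v where "geo w J (\<lambda>t. fst (\<gamma> t)) v" "\<And>t. t \<in> J \<Longrightarrow> \<gamma> t = s (fst (\<gamma> t))"
proof -
  define u where "u = (\<lambda>t. fst (\<gamma> t))"
  define v where "v = (\<lambda>t. vector_derivative u (at t))"
  have J: "open J" "continuous_on J \<gamma>" and reg: "\<And>t. t \<in> J \<Longrightarrow> \<gamma> t \<in> reg_surf s"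
    and eq: "\<And>t P. t \<in> J \<Longrightarrow> u t \<noteq> pole_pt P \<Longrightarrow>
        geodesic_eq_at (induced_metric s P) (\<lambda>r. dir_coord P (u r)) t"
    using g unfolding geodesic_def u_def by blast+
  have uS: "u t \<in> S2" "w \<bullet> u t \<noteq> 0" if "t \<in> J" for t
    using reg[OF that] reg_surfD u_def by auto
  have cu: "continuous_on J u" unfolding u_def by (intro continuous_intros J)
  have "(u has_vector_derivative v t) (at t) \<and> (v has_vector_derivative acc w (u t) (v t)) (at t)"
    if t: "t \<in> J" for t
  proof -
    obtain P where P: "u t \<noteq> pole_pt P" using South_ne_North by metis
    define x where "x = (\<lambda>r. dir_coord P (u r))"
    obtain X A where X: "\<forall>\<^sub>F r in nhds t. (x has_vector_derivative X r) (at r)"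
      and A: "(X has_vector_derivative A) (at t)"
      and E: "\<And>Z. induced_metric s P (x t) A Z + christoffel (induced_metric s P) (x t) (X t) (X t) Z = 0"
      using eq[OF t P] unfolding geodesic_eq_at_def x_def by blast
    have "open (J \<inter> u -` (- {pole_pt P}))" by (rule continuous_open_preimage[OF cu J(1)]) auto
    also have "J \<inter> u -` (- {pole_pt P}) = {r \<in> J. u r \<noteq> pole_pt P}" by auto
    finally have evP: "\<forall>\<^sub>F r in nhds t. r \<in> {r \<in> J. u r \<noteq> pole_pt P}"
      using t P by (intro eventually_nhds_in_open) auto
    have ev: "\<forall>\<^sub>F r in nhds t. u r = dir_param P (x r)"
      using evP by eventually_elim (use uS in \<open>auto simp: x_def dir_param_coord\<close>)
    have ut: "u t = dir_param P (x t)" using ev eventually_nhds_x_imp_x by fast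
    have evd: "\<forall>\<^sub>F r in nhds t. (u has_vector_derivative dparam P (x r) (X r)) (at r)"
      using eventually_eventually[THEN iffD2, OF ev] X
    proof eventually_elim
      case (elim r)
      have "((\<lambda>r. dir_param P (x r)) has_derivative (\<lambda>h. dparam P (x r) (h *\<^sub>R X r))) (at r)"
        using elim(2) unfolding has_vector_derivative_def
        by (rule has_derivative_compose[OF _ has_derivative_dir_param])
      then have "((\<lambda>r. dir_param P (x r)) has_vector_derivative dparam P (x r) (X r)) (at r)"
        unfolding has_vector_derivative_def linear_scale[OF linear_dparam] .
      then show ?case
        by (rule has_vector_derivative_cong_nhds[OF elim(1)])
    qed
    then have evv: "\<forall>\<^sub>F r in nhds t. v r = dparam P (x r) (X r)"
      by eventually_elim (simp add: v_def vector_derivative_at)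
    then have vt: "v t = dparam P (x t) (X t)" using eventually_nhds_x_imp_x by fast
    have Xt: "(x has_vector_derivative X t) (at t)" using X eventually_nhds_x_imp_x by fast
    define U where "U = d2param P (x t) (X t) (X t) + dparam P (x t) A"
    have "((\<lambda>r. dparam P (x r) (X r)) has_vector_derivative U) (at t)"
      unfolding U_def by (rule dparam_along_curve[OF Xt A])
    then have vU: "(v has_vector_derivative U) (at t)"
      by (rule has_vector_derivative_cong_nhds[OF evv])
    have ud: "\<forall>\<^sub>F r in nhds t. (u has_vector_derivative v r) (at r)"
      using evd evv by eventually_elim simp
    have utd: "(u has_vector_derivative v t) (at t)" using ud eventually_nhds_x_imp_x by fast
    have uv: "\<forall>\<^sub>F r in nhds t. u r \<bullet> v r = 0"
      using ev evv by eventually_elim (metis dparam_inner_dir_param inner_commute)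
    have "((\<lambda>r. u r \<bullet> v r) has_vector_derivative (u t \<bullet> U + v t \<bullet> v t)) (at t)"
      using bounded_bilinear.has_vector_derivative[OF bounded_bilinear_inner utd vU] .
    moreover have "((\<lambda>r. u r \<bullet> v r) has_vector_derivative 0) (at t)"
      by (rule has_vector_derivative_cong_nhds[OF uv]) simp
    ultimately have uU: "u t \<bullet> U = - (v t \<bullet> v t)"
      using vector_derivative_unique_at by (smt (verit))
    have "U = acc w (u t) (v t)"
    proof (rule orth_determined)
      show "u t \<bullet> u t = 1" "w \<bullet> u t \<noteq> 0" using uS[OF t] by (auto simp: S2_iff)
      show "u t \<bullet> v t = 0" using uv eventually_nhds_x_imp_x by fast
      show "u t \<bullet> U = - (v t \<bullet> v t)" by (rule uU)
      fix y assume "u t \<bullet> y = 0"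
      then obtain Z where Z: "y = dparam P (x t) Z" using dparam_dcoord ut by metis
      show "(w \<bullet> u t) * (U \<bullet> y) + (w \<bullet> v t) * (v t \<bullet> y) - v t \<bullet> v t / 2 * (w \<bullet> y) = 0"
        using E[of Z] unfolding covariant_acceleration Z ut vt U_def by simp
    qed
    then show ?thesis using utd vU by simp
  qed
  then have "geo w J u v" unfolding geo_def using uS by (auto simp: S2_iff)
  then show thesis using that reg reg_surfD unfolding u_def by blast
qed

text \<open>The converse is needed to extend geodesics, since the ordinary differential equation is solved in
  space.\<close>

lemma geo_imp_geodesic:
  assumes g: "geo w J u v" and J: "open J" "is_interval J" and nc: "\<not> u constant_on J"
    and \<gamma>: "\<And>t. t \<in> J \<Longrightarrow> \<gamma> t = s (u t)"
  shows "geodesic s J \<gamma>"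
proof -
  have uS: "u t \<in> S2" "w \<bullet> u t \<noteq> 0" if "t \<in> J" for t using g that by (auto simp: geo_def S2_iff)
  have fst: "fst (\<gamma> t) = u t" if "t \<in> J" for t using \<gamma> that uS fst_s by simp
  have cu: "continuous_on J u"
    by (intro continuous_at_imp_continuous_on ballI has_vector_derivative_continuous) (use g geo_def in blast)
  have "continuous_on J (\<lambda>t. hsec b w (u t))"
    unfolding hsec_def by (intro continuous_intros cu continuous_on_cross)
  then have c\<gamma>: "continuous_on J \<gamma>"
    by (rule continuous_on_eq) (use \<gamma> uS s in auto)
  have "geodesic_eq_at (induced_metric s P) (\<lambda>r. dir_coord P (fst (\<gamma> r))) t"
    if t: "t \<in> J" and P: "fst (\<gamma> t) \<noteq> pole_pt P" for t P
  proof -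
    define x where "x = (\<lambda>r. dir_coord P (fst (\<gamma> r)))"
    define X where "X = (\<lambda>r. dcoord P (u r) (v r))"
    have ne: "1 - u t \<bullet> pole_pt P \<noteq> 0" using P S2_not_pole_iff[OF uS(1)[OF t]] fst[OF t] by auto
    have "open (J \<inter> u -` (- {pole_pt P}))" by (rule continuous_open_preimage[OF cu J(1)]) auto
    also have "J \<inter> u -` (- {pole_pt P}) = {r \<in> J. u r \<noteq> pole_pt P}" by auto
    finally have evP: "\<forall>\<^sub>F r in nhds t. r \<in> {r \<in> J. u r \<noteq> pole_pt P}"
      using t P fst by (intro eventually_nhds_in_open) auto
    have evX: "\<forall>\<^sub>F r in nhds t. (x has_vector_derivative X r) (at r)"
      using evP
    proof eventually_elim
      case (elim r)
      then have d: "(u has_derivative (\<lambda>h. h *\<^sub>R v r)) (at r)"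
        using g by (auto simp: geo_def has_vector_derivative_def)
      have "((\<lambda>r. dir_coord P (u r)) has_derivative (\<lambda>h. dcoord P (u r) (h *\<^sub>R v r))) (at r)"
        by (rule has_derivative_compose[OF d has_derivative_dir_coord])
          (use elim S2_not_pole_iff uS in auto)
      then have "((\<lambda>r. dir_coord P (u r)) has_vector_derivative X r) (at r)"
        unfolding has_vector_derivative_def linear_scale[OF linear_dcoord] X_def .
      then show ?case
        by (rule has_vector_derivative_transform_within_open[OF _ J(1)])
           (use elim fst x_def in auto)
    qed
    have ut: "(u has_derivative (\<lambda>h. h *\<^sub>R v t)) (at t)"
     and vt: "(v has_derivative (\<lambda>h. h *\<^sub>R acc w (u t) (v t))) (at t)"
      using g t by (auto simp: geo_def has_vector_derivative_def)
    have "X differentiable (at t)"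
      unfolding X_def dcoord_def differentiable_def using ne
      by (intro exI) (rule derivative_eq_intros ut vt refl | simp)+
    then obtain A where A: "(X has_vector_derivative A) (at t)"
      using vector_derivative_works by blast
    have ev: "\<forall>\<^sub>F r in nhds t. u r = dir_param P (x r)"
      using evP by eventually_elim (use uS fst in \<open>auto simp: x_def dir_param_coord\<close>)
    have xt: "u t = dir_param P (x t)" using ev eventually_nhds_x_imp_x by fast
    have evv: "\<forall>\<^sub>F r in nhds t. v r = dparam P (x r) (X r)"
      using ev evP
    proof eventually_elim
      case (elim r)
      show ?case
        unfolding X_def using elim geo_velocity[OF g J(1), of r] by (intro dparam_dcoord[symmetric]) simp_all
    qed
    have vx: "v t = dparam P (x t) (X t)" using evv eventually_nhds_x_imp_x by fast
    have Xt: "(x has_vector_derivative X t) (at t)" using evX eventually_nhds_x_imp_x by fast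
    define U where "U = d2param P (x t) (X t) (X t) + dparam P (x t) A"
    have "((\<lambda>r. dparam P (x r) (X r)) has_vector_derivative U) (at t)"
      unfolding U_def by (rule dparam_along_curve[OF Xt A])
    then have "(v has_vector_derivative U) (at t)"
      by (rule has_vector_derivative_cong_nhds[OF evv])
    then have U: "U = acc w (u t) (v t)"
      by (rule vector_derivative_unique_at) (use g t in \<open>simp add: geo_def\<close>)
    have "induced_metric s P (x t) A Z + christoffel (induced_metric s P) (x t) (X t) (X t) Z = 0" for Z
    proof -
      have "u t \<bullet> dparam P (x t) Z = 0" unfolding xt by (metis dparam_inner_dir_param inner_commute)
      from acc_tangential[OF this uS(2)[OF t], of "v t"]
      show ?thesis
        unfolding covariant_acceleration U_def[symmetric] U vx[symmetric] xt[symmetric] by simp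
    qed
    then show ?thesis
      unfolding geodesic_eq_at_def x_def[symmetric] using evX A by blast
  qed
  moreover have "\<not> \<gamma> constant_on J"
    using nc fst unfolding constant_on_def by metis
  moreover have "\<gamma> ` J \<subseteq> reg_surf s"
    using \<gamma> uS unfolding reg_surf_eq by auto
  ultimately show ?thesis unfolding geodesic_def using J c\<gamma> by blast
qed

end

section \<open>Local solutions of ordinary differential equations\<close>

text \<open>Picard iteration as a contraction on bounded continuous functions. To have one complete space
  to work on, the field is composed with the nearest-point projection to the ball, and the
  integral is taken up to the time clamped to \<open>[0, \<delta>]\<close>. A solution on the interval stays in the
  ball, where both changes are invisible.\<close>

lemma picard_local_solution:
  fixes f :: "'a::euclidean_space \<Rightarrow> 'a"
  assumes r: "r > 0" and lip: "L-lipschitz_on (cball y0 r) f"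
  obtains \<delta> y where "\<delta> > 0" "y 0 = y0" "\<And>t. t \<in> {0..\<delta>} \<Longrightarrow> y t \<in> cball y0 r"
    "\<And>t. t \<in> {0..\<delta>} \<Longrightarrow> (y has_vector_derivative f (y t)) (at t within {0..\<delta>})"
proof -
  have L0: "L \<ge> 0" using lip by (rule lipschitz_on_nonneg)
  have cb: "closed (cball y0 r)" "cball y0 r \<noteq> {}" "convex (cball y0 r)" using r by auto
  define g where "g = (\<lambda>y. f (closest_point (cball y0 r) y))"
  have cpin: "closest_point (cball y0 r) y \<in> cball y0 r" for y
    using cb by (intro closest_point_in_set) auto
  have glip: "dist (g x) (g y) \<le> L * dist x y" for x y
  proof -
    have "dist (g x) (g y) \<le> L * dist (closest_point (cball y0 r) x) (closest_point (cball y0 r) y)"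
      unfolding g_def by (rule lipschitz_onD[OF lip]) (use cpin in auto)
    also have "\<dots> \<le> L * dist x y"
      using closest_point_lipschitz[OF cb(3,1,2)] L0 by (intro mult_left_mono) auto
    finally show ?thesis .
  qed
  have "continuous_on (cball y0 r) f"
    using lipschitz_on_continuous_on[OF lip] .
  then have "bounded (f ` cball y0 r)"
    using compact_continuous_image compact_imp_bounded compact_cball by blast
  then obtain B where B: "\<And>y. y \<in> cball y0 r \<Longrightarrow> norm (f y) \<le> B" "B > 0"
    unfolding bounded_pos by (metis imageI)
  have gB: "norm (g y) \<le> B" for y unfolding g_def using B(1)[OF cpin] .
  have gcont: "continuous_on S g" for S
    by (rule lipschitz_on_continuous_on[of L]) (use glip L0 in \<open>auto intro!: lipschitz_onI\<close>)
  \<comment> \<open>The first bound keeps the curve in the ball, the second gives the contraction constant \<open>1 / 2\<close>.\<close>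
  define \<delta> where "\<delta> = min (r / B) (1 / (2 * (L + 1)))"
  have d0: "\<delta> > 0" using r B L0 by (simp add: \<delta>_def)
  have dB: "B * \<delta> \<le> r" using B by (simp add: \<delta>_def min_def field_simps)
  have dL: "L * \<delta> \<le> 1 / 2"
  proof -
    have "L * \<delta> \<le> L * (1 / (2 * (L + 1)))" using L0 by (intro mult_left_mono) (auto simp: \<delta>_def)
    also have "\<dots> \<le> 1 / 2" using L0 by (simp add: field_simps)
    finally show ?thesis .
  qed
  define cl where "cl = (\<lambda>t. max 0 (min t \<delta>))"
  have cl: "cl t \<in> {0..\<delta>}" for t using d0 by (auto simp: cl_def)
  have clid: "t \<in> {0..\<delta>} \<Longrightarrow> cl t = t" for t by (auto simp: cl_def)
  define I where "I = (\<lambda>(y :: real \<Rightarrow>\<^sub>C 'a) t. y0 + integral {0..cl t} (\<lambda>s. g (apply_bcontfun y s)))"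
  have gy: "continuous_on S (\<lambda>s. g (apply_bcontfun y s))" for S y
    by (rule continuous_on_compose2[OF gcont[of UNIV]]) (auto intro: continuous_on_apply_bcontfun)
  have Ibnd: "norm (I y t - y0) \<le> B * cl t" for y t
    unfolding I_def using integral_bound[of 0 "cl t" "\<lambda>s. g (apply_bcontfun y s)" B] gy gB cl by auto
  have Ic: "continuous_on UNIV (I y)" for y
  proof -
    have "continuous_on {0..\<delta>} (\<lambda>\<tau>. integral {0..\<tau>} (\<lambda>s. g (apply_bcontfun y s)))"
      by (intro indefinite_integral_continuous_1 integrable_continuous_real gy)
    then have "continuous_on UNIV (\<lambda>t. integral {0..cl t} (\<lambda>s. g (apply_bcontfun y s)))"
      by (rule continuous_on_compose2) (use cl in \<open>auto simp: cl_def intro!: continuous_intros\<close>)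
    then show ?thesis unfolding I_def by (intro continuous_intros)
  qed
  have Ib: "I y \<in> bcontfun" for y
  proof -
    have "norm (I y t) \<le> norm y0 + B * \<delta>" for t
    proof -
      have "B * cl t \<le> B * \<delta>" using cl[of t] B by (intro mult_left_mono) auto
      then show ?thesis using Ibnd[of y t] norm_triangle_sub[of "I y t" y0] by simp
    qed
    then have "bounded (range (I y))" by (auto simp: bounded_iff)
    then show ?thesis using Ic by (simp add: bcontfun_def)
  qed
  define T where "T = (\<lambda>y. Bcontfun (I y))"
  have T: "apply_bcontfun (T y) = I y" for y unfolding T_def by (simp add: Bcontfun_inverse[OF Ib])
  have "\<exists>!y. T y = y"
  proof (rule banach_fix_type[of "1/2"])
    show "\<forall>y z. dist (T y) (T z) \<le> 1 / 2 * dist y z"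
    proof (intro allI dist_bound)
      fix y z t
      have "norm (integral {0..cl t} (\<lambda>s. g (apply_bcontfun y s) - g (apply_bcontfun z s))) \<le> (L * dist y z) * (cl t - 0)"
      proof (rule integral_bound)
        show "0 \<le> cl t" using cl by auto
        show "continuous_on {0..cl t} (\<lambda>s. g (apply_bcontfun y s) - g (apply_bcontfun z s))"
          by (intro continuous_intros gy)
        fix s
        have "norm (g (apply_bcontfun y s) - g (apply_bcontfun z s)) \<le> L * dist (apply_bcontfun y s) (apply_bcontfun z s)"
          using glip by (simp add: dist_norm)
        also have "\<dots> \<le> L * dist y z" using L0 by (intro mult_left_mono dist_bounded)
        finally show "norm (g (apply_bcontfun y s) - g (apply_bcontfun z s)) \<le> L * dist y z" .
      qed
      moreover have "integral {0..cl t} (\<lambda>s. g (apply_bcontfun y s) - g (apply_bcontfun z s)) = I y t - I z t"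
        unfolding I_def by (subst Henstock_Kurzweil_Integration.integral_diff) (auto intro!: integrable_continuous_real gy)
      ultimately have "dist (I y t) (I z t) \<le> L * dist y z * cl t" by (simp add: dist_norm)
      also have "\<dots> \<le> L * dist y z * \<delta>" using cl[of t] L0 by (intro mult_left_mono) auto
      also have "\<dots> = L * \<delta> * dist y z" by simp
      also have "\<dots> \<le> 1 / 2 * dist y z" using dL by (intro mult_right_mono) auto
      finally show "dist (apply_bcontfun (T y) t) (apply_bcontfun (T z) t) \<le> 1 / 2 * dist y z"
        unfolding T .
    qed
  qed auto
  then obtain Y where "T Y = Y" by blast
  define y where "y = apply_bcontfun Y"
  have y: "y t = y0 + integral {0..t} (\<lambda>s. g (y s))" if "t \<in> {0..\<delta>}" for t
    using T[of Y] clid[OF that] unfolding \<open>T Y = Y\<close> y_def I_def by metis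
  have yin: "y t \<in> cball y0 r" if t: "t \<in> {0..\<delta>}" for t
  proof -
    have "norm (y t - y0) \<le> B * t"
      using Ibnd[of Y t] T[of Y] clid[OF t] unfolding \<open>T Y = Y\<close> y_def by simp
    also have "\<dots> \<le> B * \<delta>" using t B by (intro mult_left_mono) auto
    finally show ?thesis using dB by (simp add: dist_norm norm_minus_commute)
  qed
  show thesis
  proof (rule that[of \<delta> y])
    show "\<delta> > 0" by (rule d0)
    show "y 0 = y0" using y[of 0] d0 by simp
    show "y t \<in> cball y0 r" if "t \<in> {0..\<delta>}" for t by (rule yin[OF that])
    fix t assume t: "t \<in> {0..\<delta>}"
    have "((\<lambda>t. integral {0..t} (\<lambda>s. g (y s))) has_vector_derivative g (y t)) (at t within {0..\<delta>})"
      using gy[of _ Y] t unfolding y_def by (intro integral_has_vector_derivative)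
    then have "((\<lambda>t. y0 + integral {0..t} (\<lambda>s. g (y s))) has_vector_derivative g (y t)) (at t within {0..\<delta>})"
      by (auto intro!: derivative_eq_intros)
    then have "(y has_vector_derivative g (y t)) (at t within {0..\<delta>})"
      by (rule has_vector_derivative_transform[OF t, rotated]) (simp add: y)
    then show "(y has_vector_derivative f (y t)) (at t within {0..\<delta>})"
      using closest_point_self[OF yin[OF t]] by (simp add: g_def)
  qed
qed

text \<open>A solution with a limit at the right end is continued by a local solution starting at this limit.
  At the junction the two one-sided solutions satisfy one integral equation, which gives the
  derivative there.\<close>

lemma ode_extend_right:
  fixes f :: "'a::euclidean_space \<Rightarrow> 'a"
  assumes ac: "a < c" and y: "\<And>t. t \<in> {a<..<c} \<Longrightarrow> (y has_vector_derivative f (y t)) (at t)"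
    and lim: "(y \<longlongrightarrow> y1) (at_left c)"
    and r: "r > 0" and lip: "L-lipschitz_on (cball y1 r) f"
  obtains \<delta> z where "\<delta> > 0" "\<And>t. t < c \<Longrightarrow> z t = y t" "z c = y1"
    "\<And>t. t \<in> {c..<c + \<delta>} \<Longrightarrow> z t \<in> cball y1 r"
    "\<And>t. t \<in> {a<..<c + \<delta>} \<Longrightarrow> (z has_vector_derivative f (z t)) (at t)"
proof -
  obtain \<delta> p where d0: "\<delta> > 0" and p0: "p 0 = y1" and pin: "\<And>t. t \<in> {0..\<delta>} \<Longrightarrow> p t \<in> cball y1 r"
    and p': "\<And>t. t \<in> {0..\<delta>} \<Longrightarrow> (p has_vector_derivative f (p t)) (at t within {0..\<delta>})"
    using picard_local_solution[OF r lip] by metis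
  define z where "z = (\<lambda>t. if t < c then y t else p (t - c))"
  have "\<forall>\<^sub>F t in at_left c. y t \<in> ball y1 r"
    using lim r by (auto simp: tendsto_iff dist_commute)
  then obtain \<alpha>0 where \<alpha>0: "\<alpha>0 < c" "\<And>t. \<alpha>0 < t \<Longrightarrow> t < c \<Longrightarrow> y t \<in> ball y1 r"
    unfolding eventually_at_left_field by blast
  define \<alpha> where "\<alpha> = (max a \<alpha>0 + c) / 2"
  have \<alpha>: "a < \<alpha>" "\<alpha> < c" "\<alpha>0 < \<alpha>" using ac \<alpha>0 by (auto simp: \<alpha>_def)
  have zin: "z t \<in> cball y1 r" if "t \<in> {\<alpha>..c + \<delta>}" for t
    using that \<alpha>0(2)[of t] pin[of "t - c"] \<alpha> by (auto simp: z_def less_imp_le)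
  have zl: "(z has_vector_derivative f (z t)) (at t)" if "t \<in> {a<..<c}" for t
  proof (rule has_vector_derivative_transform_within_open[of y _ _ "{a<..<c}"])
    show "(y has_vector_derivative f (z t)) (at t)" using y[OF that] that by (simp add: z_def)
  qed (use that in \<open>auto simp: z_def\<close>)
  have zr: "(z has_vector_derivative f (z t)) (at t)" if "t \<in> {c<..<c + \<delta>}" for t
  proof -
    have "(p has_vector_derivative f (p (t - c))) (at (t - c) within {0<..<\<delta>})"
      by (rule has_vector_derivative_within_subset[OF p']) (use that in auto)
    then have "(p has_vector_derivative f (p (t - c))) (at (t - c))"
      using that at_within_open[of "t - c" "{0<..<\<delta>}"] by simp
    then have "((p \<circ> (\<lambda>t. t - c)) has_vector_derivative (1 *\<^sub>R f (p (t - c)))) (at t)"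
      by (intro vector_diff_chain_at) (auto intro!: derivative_eq_intros)
    moreover have "1 *\<^sub>R f (p (t - c)) = f (z t)" using that by (simp add: z_def)
    ultimately have "((p \<circ> (\<lambda>t. t - c)) has_vector_derivative f (z t)) (at t)" by simp
    then show ?thesis
      by (rule has_vector_derivative_transform_within_open[of _ _ _ "{c<..<c + \<delta>}"])
         (use that in \<open>auto simp: z_def\<close>)
  qed
  have pc: "continuous_on {0..\<delta>} p"
    by (rule continuous_on_vector_derivative) (rule p')
  have zc: "isCont z c"
  proof -
    have "(z \<longlongrightarrow> y1) (at_left c)"
      by (rule Lim_transform_eventually[OF lim]) (auto simp: z_def eventually_at_filter)
    moreover have "(z \<longlongrightarrow> y1) (at_right c)"
    proof -
      have "(p \<longlongrightarrow> p 0) (at 0 within {0..\<delta>})" using pc d0 by (auto simp: continuous_on_def)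
      then have "(p \<longlongrightarrow> y1) (at_right 0)" using d0 p0 by (simp add: at_within_Icc_at_right)
      then have "((\<lambda>t. p (t - c)) \<longlongrightarrow> y1) (at_right c)"
        unfolding at_right_to_0[of c] filterlim_filtermap by simp
      then show ?thesis
        by (rule Lim_transform_eventually) (auto simp: z_def eventually_at_filter)
    qed
    ultimately show ?thesis by (simp add: isCont_def filterlim_split_at z_def p0)
  qed
  have zcont: "continuous_on {\<alpha>..c + \<delta> / 2} z"
  proof (rule continuous_at_imp_continuous_on, rule ballI)
    fix t assume "t \<in> {\<alpha>..c + \<delta> / 2}"
    then consider "t \<in> {a<..<c}" | "t = c" | "t \<in> {c<..<c + \<delta>}" using \<alpha> d0 by force
    then show "isCont z t"
      by cases (use zl zr zc has_vector_derivative_continuous in blast)+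
  qed
  have fz: "continuous_on {\<alpha>..c + \<delta> / 2} (\<lambda>t. f (z t))"
    by (rule continuous_on_compose2[OF lipschitz_on_continuous_on[OF lip] zcont]) (use zin d0 in auto)
  have z_int: "z t = z \<alpha> + integral {\<alpha>..t} (\<lambda>t. f (z t))" if t: "t \<in> {\<alpha>..c + \<delta> / 2}" for t
  proof -
    have "((\<lambda>t. f (z t)) has_integral (z t - z \<alpha>)) {\<alpha>..t}"
    proof (rule fundamental_theorem_of_calculus_interior_strong[of "{c}"])
      show "continuous_on {\<alpha>..t} z" using zcont t by (auto intro: continuous_on_subset)
      fix x assume "x \<in> {\<alpha><..<t} - {c}"
      then show "(z has_vector_derivative f (z x)) (at x)"
        using zl[of x] zr[of x] t \<alpha> d0 by (cases "x < c") auto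
    qed (use t in auto)
    then show ?thesis by (simp add: integral_unique)
  qed
  have zmid: "(z has_vector_derivative f (z c)) (at c)"
  proof -
    have c: "c \<in> {\<alpha><..<c + \<delta> / 2}" using \<alpha> d0 by auto
    have "((\<lambda>t. integral {\<alpha>..t} (\<lambda>t. f (z t))) has_vector_derivative f (z c)) (at c within {\<alpha>..c + \<delta> / 2})"
      using c by (intro integral_has_vector_derivative fz) auto
    then have "((\<lambda>t. z \<alpha> + integral {\<alpha>..t} (\<lambda>t. f (z t))) has_vector_derivative f (z c)) (at c within {\<alpha>..c + \<delta> / 2})"
      by (auto intro!: derivative_eq_intros)
    then have "(z has_vector_derivative f (z c)) (at c within {\<alpha>..c + \<delta> / 2})"
      by (rule has_vector_derivative_transform[rotated 2]) (use c in auto, rule z_int, auto)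
    then have "(z has_vector_derivative f (z c)) (at c within {\<alpha><..<c + \<delta> / 2})"
      by (rule has_vector_derivative_within_subset) auto
    then show ?thesis using at_within_open[OF c] by simp
  qed
  show thesis
  proof (rule that[of \<delta> z])
    show "(z has_vector_derivative f (z t)) (at t)" if "t \<in> {a<..<c + \<delta>}" for t
      using zl[of t] zr[of t] zmid that by (cases t c rule: linorder_cases) auto
    show "z t \<in> cball y1 r" if "t \<in> {c..<c + \<delta>}" for t using zin[of t] \<alpha> that by auto
  qed (use d0 in \<open>auto simp: z_def p0\<close>)
qed

section \<open>Conserved quantities and extension of geodesics\<close>

lemma lipschitz_on_bilinear:
  fixes f :: "'c::metric_space \<Rightarrow> 'a::real_normed_vector" and g :: "'c \<Rightarrow> 'b::real_normed_vector"
  assumes "bounded_bilinear pr" "compact S" "\<exists>L. L-lipschitz_on S f" "\<exists>L. L-lipschitz_on S g"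
  shows "\<exists>L. L-lipschitz_on S (\<lambda>x. pr (f x) (g x))"
proof -
  interpret bounded_bilinear pr by fact
  obtain Lf Lg where Lf: "Lf-lipschitz_on S f" and Lg: "Lg-lipschitz_on S g" using assms by blast
  have L0: "Lf \<ge> 0" "Lg \<ge> 0" using Lf Lg lipschitz_on_nonneg by blast+
  obtain Bf where Bf: "\<And>x. x \<in> S \<Longrightarrow> norm (f x) \<le> Bf" "Bf > 0"
    using compact_imp_bounded[OF compact_continuous_image[OF lipschitz_on_continuous_on[OF Lf] assms(2)]]
    unfolding bounded_pos by (metis imageI)
  obtain Bg where Bg: "\<And>x. x \<in> S \<Longrightarrow> norm (g x) \<le> Bg" "Bg > 0"
    using compact_imp_bounded[OF compact_continuous_image[OF lipschitz_on_continuous_on[OF Lg] assms(2)]]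
    unfolding bounded_pos by (metis imageI)
  obtain K where K: "\<And>a b. norm (pr a b) \<le> norm a * norm b * K" "K > 0" using pos_bounded by blast
  have "(Bf * Lg * K + Lf * Bg * K)-lipschitz_on S (\<lambda>x. pr (f x) (g x))"
  proof (rule lipschitz_onI)
    fix x y assume xy: "x \<in> S" "y \<in> S"
    have "pr (f x) (g x) - pr (f y) (g y) = pr (f x) (g x - g y) + pr (f x - f y) (g y)"
      by (simp add: diff_left diff_right)
    then have "dist (pr (f x) (g x)) (pr (f y) (g y)) \<le> norm (pr (f x) (g x - g y)) + norm (pr (f x - f y) (g y))"
      by (simp add: dist_norm norm_triangle_ineq)
    also have "\<dots> \<le> norm (f x) * norm (g x - g y) * K + norm (f x - f y) * norm (g y) * K"
      by (intro add_mono K)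
    also have "\<dots> \<le> Bf * (Lg * dist x y) * K + (Lf * dist x y) * Bg * K"
      using lipschitz_onD[OF Lf xy] lipschitz_onD[OF Lg xy] Bf Bg K xy L0
      by (intro add_mono mult_right_mono mult_mono) (auto simp: dist_norm)
    also have "\<dots> = (Bf * Lg * K + Lf * Bg * K) * dist x y" by (simp add: algebra_simps)
    finally show "dist (pr (f x) (g x)) (pr (f y) (g y)) \<le> (Bf * Lg * K + Lf * Bg * K) * dist x y" .
  qed (use L0 Bf Bg K in auto)
  then show ?thesis by blast
qed

lemma lipschitz_on_inverse:
  fixes h :: "'c::metric_space \<Rightarrow> real"
  assumes "\<exists>L. L-lipschitz_on S h" "\<And>x. x \<in> S \<Longrightarrow> \<epsilon> \<le> \<bar>h x\<bar>" "\<epsilon> > 0"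
  shows "\<exists>L. L-lipschitz_on S (\<lambda>x. 1 / h x)"
proof -
  obtain L where L: "L-lipschitz_on S h" using assms by blast
  have "(L / (\<epsilon> * \<epsilon>))-lipschitz_on S (\<lambda>x. 1 / h x)"
  proof (rule lipschitz_onI)
    fix x y assume xy: "x \<in> S" "y \<in> S"
    have h: "\<epsilon> \<le> \<bar>h x\<bar>" "\<epsilon> \<le> \<bar>h y\<bar>" using assms xy by auto
    then have nz: "h x \<noteq> 0" "h y \<noteq> 0" using assms(3) by auto
    have "dist (1 / h x) (1 / h y) = dist (h x) (h y) / (\<bar>h x\<bar> * \<bar>h y\<bar>)"
      using nz by (simp add: dist_real_def divide_simps abs_mult[symmetric]) (simp add: abs_mult abs_minus_commute)
    also have "\<dots> \<le> (L * dist x y) / (\<epsilon> * \<epsilon>)"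
      using lipschitz_onD[OF L xy] h assms(3) lipschitz_on_nonneg[OF L] by (intro frac_le mult_mono) auto
    finally show "dist (1 / h x) (1 / h y) \<le> L / (\<epsilon> * \<epsilon>) * dist x y" by simp
  qed (use lipschitz_on_nonneg[OF L] assms in auto)
  then show ?thesis by blast
qed

definition geo_field :: "vec3 \<Rightarrow> vec3 \<times> vec3 \<Rightarrow> vec3 \<times> vec3" where
  "geo_field w = (\<lambda>(u, v). (v, acc w u v))"

lemma lipschitz_geo_field:
  assumes S: "compact S" and h: "\<And>z. z \<in> S \<Longrightarrow> \<epsilon> \<le> \<bar>w \<bullet> fst z\<bar>" and e: "\<epsilon> > 0"
  shows "\<exists>L. L-lipschitz_on S (geo_field w)"
proof -
  have fst: "\<exists>L. L-lipschitz_on S (fst :: vec3 \<times> vec3 \<Rightarrow> _)" and snd: "\<exists>L. L-lipschitz_on S (snd :: vec3 \<times> vec3 \<Rightarrow> _)"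
    by (intro exI[of _ 1] lipschitz_onI; simp add: dist_fst_le dist_snd_le)+
  have const: "\<exists>L. L-lipschitz_on S (\<lambda>_. c)" for c :: "'x::metric_space"
    using lipschitz_on_constant by blast
  note bil = lipschitz_on_bilinear[OF bounded_bilinear_inner S] lipschitz_on_bilinear[OF bounded_bilinear_scaleR S]
    lipschitz_on_bilinear[OF bounded_bilinear_mult S]
  have diff: "\<exists>L. L-lipschitz_on S (\<lambda>x. f x - g x)" if "\<exists>L. L-lipschitz_on S f" "\<exists>L. L-lipschitz_on S g" for f g :: "_ \<Rightarrow> vec3"
    using that lipschitz_on_diff by blast
  have inv: "\<exists>L. L-lipschitz_on S (\<lambda>z. 1 / (w \<bullet> fst z))"
    by (rule lipschitz_on_inverse[OF _ h e]) (intro bil const fst)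
  have "\<exists>L. L-lipschitz_on S (\<lambda>z. (1 / (w \<bullet> fst z)) *\<^sub>R ((1 / 2 * (snd z \<bullet> snd z)) *\<^sub>R w - (w \<bullet> snd z) *\<^sub>R snd z)
      - (3 / 2 * (snd z \<bullet> snd z)) *\<^sub>R fst z)"
    by (intro diff bil const fst snd inv)
  moreover have "geo_field w = (\<lambda>z. (snd z, (1 / (w \<bullet> fst z)) *\<^sub>R ((1 / 2 * (snd z \<bullet> snd z)) *\<^sub>R w - (w \<bullet> snd z) *\<^sub>R snd z)
      - (3 / 2 * (snd z \<bullet> snd z)) *\<^sub>R fst z))"
    by (simp add: fun_eq_iff geo_field_def acc_def)
  moreover have "\<exists>L. L-lipschitz_on S (\<lambda>z. (f z, g z))" if "\<exists>L. L-lipschitz_on S f" "\<exists>L. L-lipschitz_on S g"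
    for f g :: "_ \<Rightarrow> vec3"
    using that lipschitz_on_Pair by blast
  ultimately show ?thesis using snd by simp
qed

text \<open>Gronwall: the function times \<open>exp (- C t)\<close> decreases.\<close>

lemma linear_differential_inequality_zero:
  fixes E :: "real \<Rightarrow> real"
  assumes "\<And>t. t \<in> {c..<d} \<Longrightarrow> (E has_real_derivative E' t) (at t)"
    and "\<And>t. t \<in> {c..<d} \<Longrightarrow> E' t \<le> C * E t" "\<And>t. E t \<ge> 0" "E c = 0" and t: "t \<in> {c..<d}"
  shows "E t = 0"
proof -
  have "E t * exp (- C * t) \<le> E c * exp (- C * c)"
  proof (rule DERIV_nonpos_imp_nonincreasing[of c t "\<lambda>t. E t * exp (- C * t)"])
    fix x assume "c \<le> x" "x \<le> t"
    then have x: "x \<in> {c..<d}" using t by auto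
    have "((\<lambda>t. E t * exp (- C * t)) has_real_derivative (E' x - C * E x) * exp (- C * x)) (at x)"
      by (auto intro!: derivative_eq_intros assms(1)[OF x] simp: algebra_simps)
    moreover have "(E' x - C * E x) * exp (- C * x) \<le> 0"
      using assms(2)[OF x] by (intro mult_nonpos_nonneg) auto
    ultimately show "\<exists>y. ((\<lambda>t. E t * exp (- C * t)) has_real_derivative y) (at x) \<and> y \<le> 0" by blast
  qed (use t in auto)
  then have "E t * exp (- C * t) \<le> 0" using assms(4) by simp
  then have "E t \<le> 0" by (simp add: mult_le_0_iff)
  then show ?thesis using assms(3)[of t] by simp
qed

lemma has_real_derivative_inner:
  fixes f g :: "real \<Rightarrow> 'a::real_inner"
  assumes "(f has_vector_derivative f') (at t)" "(g has_vector_derivative g') (at t)"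
  shows "((\<lambda>t. f t \<bullet> g t) has_real_derivative (f t \<bullet> g' + f' \<bullet> g t)) (at t)"
  unfolding has_real_derivative_iff_has_vector_derivative
  using bounded_bilinear.has_vector_derivative[OF bounded_bilinear_inner assms] .

lemma has_real_derivative_inner_const:
  assumes "(f has_vector_derivative f') (at t)"
  shows "((\<lambda>t. w \<bullet> f t) has_real_derivative (w \<bullet> f')) (at t)"
  using has_real_derivative_inner[OF has_vector_derivative_const assms, of w] by simp

text \<open>The defects \<open>n = u \<bullet> u - 1\<close> and \<open>m = u \<bullet> v\<close> satisfy a linear system with bounded coefficients, so
  they vanish for all time if they vanish at the start. Thus the equation in space may be solved
  without regard to the constraint.\<close>

lemma geo_field_preserves_tangency:
  assumes z: "\<And>t. t \<in> {c..<d} \<Longrightarrow> (z has_vector_derivative geo_field w (z t)) (at t)"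
    and h: "\<And>t. t \<in> {c..<d} \<Longrightarrow> \<epsilon> \<le> \<bar>w \<bullet> fst (z t)\<bar>" "\<epsilon> > 0"
    and B: "\<And>t. t \<in> {c..<d} \<Longrightarrow> norm (snd (z t)) \<le> B"
    and init: "fst (z c) \<bullet> fst (z c) = 1" "fst (z c) \<bullet> snd (z c) = 0" and t: "t \<in> {c..<d}"
  shows "fst (z t) \<bullet> fst (z t) = 1"
proof -
  define u v where "u = (\<lambda>t. fst (z t))" and "v = (\<lambda>t. snd (z t))"
  have u': "(u has_vector_derivative v t) (at t)" and v': "(v has_vector_derivative acc w (u t) (v t)) (at t)"
    if "t \<in> {c..<d}" for t
    using bounded_linear.has_vector_derivative[OF bounded_linear_fst z[OF that]]
      bounded_linear.has_vector_derivative[OF bounded_linear_snd z[OF that]]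
    by (simp_all add: geo_field_def u_def v_def case_prod_beta)
  define n m where "n = (\<lambda>t. u t \<bullet> u t - 1)" and "m = (\<lambda>t. u t \<bullet> v t)"
  define p q where "p = (\<lambda>t. 3 / 2 * (v t \<bullet> v t))" and "q = (\<lambda>t. (w \<bullet> v t) / (w \<bullet> u t))"
  have B0: "B \<ge> 0" using B[OF t] norm_ge_zero order_trans by blast
  define C where "C = 2 + 3 / 2 * B\<^sup>2 + 2 * (norm w * B / \<epsilon>)"
  have n': "(n has_real_derivative 2 * m t) (at t)" if "t \<in> {c..<d}" for t
    unfolding n_def m_def using has_real_derivative_inner[OF u' u', OF that that]
    by (auto intro!: derivative_eq_intros simp: inner_commute)
  have m': "(m has_real_derivative - p t * n t - q t * m t) (at t)" if "t \<in> {c..<d}" for t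
  proof -
    have "w \<bullet> u t \<noteq> 0" using h(1)[OF that] h(2) by (auto simp: u_def)
    then have "u t \<bullet> acc w (u t) (v t) + v t \<bullet> v t = - p t * n t - q t * m t"
      by (simp add: acc_def p_def q_def n_def m_def inner_diff_right inner_add_right inner_commute field_simps)
    then show ?thesis unfolding m_def using has_real_derivative_inner[OF u' v', OF that that] by simp
  qed
  have "(n t)\<^sup>2 + (m t)\<^sup>2 = 0"
  proof (rule linear_differential_inequality_zero[of c d _ "\<lambda>t. 4 * (n t * m t) - 2 * p t * (n t * m t) - 2 * q t * (m t)\<^sup>2" C, OF _ _ _ _ t])
    fix t assume t: "t \<in> {c..<d}"
    show "((\<lambda>t. (n t)\<^sup>2 + (m t)\<^sup>2) has_real_derivative 4 * (n t * m t) - 2 * p t * (n t * m t) - 2 * q t * (m t)\<^sup>2) (at t)"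
      by (rule derivative_eq_intros n'[OF t] m'[OF t] refl)+ (simp add: power2_eq_square algebra_simps)
    have p: "0 \<le> p t" "p t \<le> 3 / 2 * B\<^sup>2"
      using B[OF t] B0 by (auto simp: p_def v_def dot_square_norm power_mono)
    have "\<bar>w \<bullet> v t\<bar> \<le> norm w * B"
      using Cauchy_Schwarz_ineq2[of w "v t"] mult_left_mono[OF B[OF t], of "norm w"] by (simp add: v_def)
    then have q: "\<bar>q t\<bar> \<le> norm w * B / \<epsilon>"
      unfolding q_def abs_divide using h(1)[OF t] h(2) B0 by (intro frac_le) (auto simp: u_def)
    have nm: "2 * \<bar>n t * m t\<bar> \<le> (n t)\<^sup>2 + (m t)\<^sup>2"
      using sum_squares_bound[of "\<bar>n t\<bar>" "\<bar>m t\<bar>"] by (simp add: abs_mult)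
    have 1: "4 * (n t * m t) \<le> 2 * ((n t)\<^sup>2 + (m t)\<^sup>2)" using nm by (simp add: abs_if split: if_splits)
    have "(2 * p t) * - (n t * m t) \<le> (2 * p t) * \<bar>n t * m t\<bar>"
      using p(1) by (intro mult_left_mono) auto
    then have "- (2 * p t * (n t * m t)) \<le> p t * (2 * \<bar>n t * m t\<bar>)"
      by (simp add: mult_ac)
    also have "\<dots> \<le> 3 / 2 * B\<^sup>2 * ((n t)\<^sup>2 + (m t)\<^sup>2)" using p nm by (intro mult_mono) auto
    finally have 2: "- (2 * p t * (n t * m t)) \<le> 3 / 2 * B\<^sup>2 * ((n t)\<^sup>2 + (m t)\<^sup>2)" .
    have "- q t * (m t)\<^sup>2 \<le> (norm w * B / \<epsilon>) * ((n t)\<^sup>2 + (m t)\<^sup>2)"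
      using q B0 h(2) by (intro mult_mono) auto
    then show "4 * (n t * m t) - 2 * p t * (n t * m t) - 2 * q t * (m t)\<^sup>2 \<le> C * ((n t)\<^sup>2 + (m t)\<^sup>2)"
      using 1 2 unfolding C_def by (simp add: distrib_right)
  qed (use init in \<open>auto simp: n_def m_def u_def v_def\<close>)
  then show ?thesis by (simp add: n_def u_def)
qed

lemma geo_energy:
  assumes g: "geo w J u v" and J: "open J" "is_interval J"
  obtains k where "\<And>t. t \<in> J \<Longrightarrow> (w \<bullet> u t) * (v t \<bullet> v t) = k"
proof -
  have "\<exists>k. \<forall>t\<in>J. (w \<bullet> u t) * (v t \<bullet> v t) = k"
  proof (rule has_field_derivative_zero_constant)
    show "convex J" using J by (simp add: is_interval_convex_1)
    fix t assume t: "t \<in> J"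
    then have u': "(u has_vector_derivative v t) (at t)" and v': "(v has_vector_derivative acc w (u t) (v t)) (at t)"
      and h: "w \<bullet> u t \<noteq> 0" using g by (auto simp: geo_def)
    have "((\<lambda>t. (w \<bullet> u t) * (v t \<bullet> v t)) has_real_derivative
        (w \<bullet> v t) * (v t \<bullet> v t) + (v t \<bullet> acc w (u t) (v t) + acc w (u t) (v t) \<bullet> v t) * (w \<bullet> u t)) (at t)"
      by (rule DERIV_mult[OF has_real_derivative_inner_const[OF u'] has_real_derivative_inner[OF v' v']])
    moreover have "(w \<bullet> v t) * (v t \<bullet> v t) + (v t \<bullet> acc w (u t) (v t) + acc w (u t) (v t) \<bullet> v t) * (w \<bullet> u t) = 0"
      using h geo_velocity[OF g J(1) t]
      by (simp add: acc_def inner_diff_right inner_diff_left inner_add_left inner_add_right inner_commute field_simps)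
    ultimately show "((\<lambda>t. (w \<bullet> u t) * (v t \<bullet> v t)) has_real_derivative 0) (at t within J)"
      by (metis has_field_derivative_at_within)
  qed
  then show thesis using that by blast
qed

lemma bounded_linear_cross_right: "bounded_linear (cross3 a)"
  using bilinear_cross by (simp add: bilinear_def linear_conv_bounded_linear)

lemma bounded_bilinear_cross3: "bounded_bilinear cross3"
  using bilinear_cross bilinear_conv_bounded_bilinear by blast

text \<open>The rotations about \<open>w\<close> preserve the round metric and the height; this is the integral that
  belongs to them.\<close>

lemma geo_momentum:
  assumes g: "geo w J u v" and J: "open J" "is_interval J"
  obtains l where "\<And>t. t \<in> J \<Longrightarrow> (w \<bullet> u t) * (w \<bullet> (u t \<otimes> v t)) = l"
proof -
  have "\<exists>k. \<forall>t\<in>J. (w \<bullet> u t) * (w \<bullet> (u t \<otimes> v t)) = k"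
  proof (rule has_field_derivative_zero_constant)
    show "convex J" using J by (simp add: is_interval_convex_1)
    fix t assume t: "t \<in> J"
    then have u': "(u has_vector_derivative v t) (at t)" and v': "(v has_vector_derivative acc w (u t) (v t)) (at t)"
      and h: "w \<bullet> u t \<noteq> 0" using g by (auto simp: geo_def)
    have c': "((\<lambda>t. u t \<otimes> v t) has_vector_derivative (u t \<otimes> acc w (u t) (v t) + v t \<otimes> v t)) (at t)"
      using bounded_bilinear.has_vector_derivative[OF bounded_bilinear_cross3 u' v'] .
    have "((\<lambda>t. (w \<bullet> u t) * (w \<bullet> (u t \<otimes> v t))) has_real_derivative
        (w \<bullet> v t) * (w \<bullet> (u t \<otimes> v t)) + (w \<bullet> (u t \<otimes> acc w (u t) (v t) + v t \<otimes> v t)) * (w \<bullet> u t)) (at t)"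
      by (rule DERIV_mult[OF has_real_derivative_inner_const[OF u'] has_real_derivative_inner_const[OF c']])
    moreover have "w \<bullet> (u t \<otimes> w) = 0" by (simp add: dot_cross_self)
    then have "(w \<bullet> v t) * (w \<bullet> (u t \<otimes> v t)) + (w \<bullet> (u t \<otimes> acc w (u t) (v t) + v t \<otimes> v t)) * (w \<bullet> u t) = 0"
      using h by (simp add: acc_def Cross3.right_diff_distrib cross_add_right cross_mult_right inner_diff_right inner_add_right field_simps)
    ultimately show "((\<lambda>t. (w \<bullet> u t) * (w \<bullet> (u t \<otimes> v t))) has_real_derivative 0) (at t within J)"
      by (metis has_field_derivative_at_within)
  qed
  then show thesis using that by blast
qed

lemma bounded_derivative_left_limit:
  fixes f :: "real \<Rightarrow> 'a::{banach}"
  assumes "a < c" "\<And>t. t \<in> {a..<c} \<Longrightarrow> (f has_vector_derivative f' t) (at t)" "\<And>t. t \<in> {a..<c} \<Longrightarrow> norm (f' t) \<le> B"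
  obtains l where "(f \<longlongrightarrow> l) (at_left c)"
proof -
  have B0: "0 \<le> B" using order_trans[OF norm_ge_zero assms(3)[of a]] assms(1) by simp
  have "B-lipschitz_on {a..<c} f"
  proof (rule bounded_derivative_imp_lipschitz)
    fix t assume t: "t \<in> {a..<c}"
    show "(f has_derivative (\<lambda>h. h *\<^sub>R f' t)) (at t within {a..<c})"
      using assms(2)[OF t] unfolding has_vector_derivative_def by (rule has_derivative_at_withinI)
    show "onorm (\<lambda>h. h *\<^sub>R f' t) \<le> B"
      using assms(3)[OF t] by (intro onorm_le) (simp add: mult.commute[of B] mult_left_mono)
  qed (use B0 in auto)
  then have "uniformly_continuous_on {a..<c} f" by (rule lipschitz_on_uniformly_continuous)
  moreover have "c \<in> closure {a..<c}" using assms(1) by simp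
  ultimately obtain l where "(f \<longlongrightarrow> l) (at c within {a..<c})"
    using uniformly_continuous_on_extension_at_closure by blast
  moreover have "at c within {a..<c} = at_left c"
    by (rule at_within_nhd[of c "{a<..}"]) (use assms(1) in auto)
  ultimately show thesis using that by simp
qed

text \<open>Away from the equator \<open>w \<bullet> u = 0\<close> the conserved energy bounds the speed, the equation then bounds the
  acceleration, and position and velocity converge at a finite end of the interval.\<close>

lemma geo_extend_right:
  assumes g: "geo w J u v" and J: "open J" "is_interval J"
    and a: "a \<in> J" "a < c" "{a..<c} \<subseteq> J" "J \<subseteq> {..<c}"
    and h: "\<And>t. t \<in> {a..<c} \<Longrightarrow> \<epsilon> \<le> \<bar>w \<bullet> u t\<bar>" "\<epsilon> > 0"
  obtains J' u' v' where "open J'" "is_interval J'" "J \<subseteq> J'" "c \<in> J'" "geo w J' u' v'"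
    "\<And>t. t \<in> J \<Longrightarrow> u' t = u t"
proof -
  obtain k where k: "\<And>t. t \<in> J \<Longrightarrow> (w \<bullet> u t) * (v t \<bullet> v t) = k" using geo_energy[OF g J] by blast
  have d: "(u has_vector_derivative v t) (at t)" "(v has_vector_derivative acc w (u t) (v t)) (at t)"
    "norm (u t) = 1" if "t \<in> J" for t
    using g that by (auto simp: geo_def norm_eq_1)
  define K where "K = sqrt (\<bar>k\<bar> / \<epsilon>)"
  have vK: "norm (v t) \<le> K" if t: "t \<in> {a..<c}" for t
  proof -
    have "\<bar>w \<bullet> u t\<bar> * (norm (v t))\<^sup>2 = \<bar>k\<bar>"
    proof -
      have "t \<in> J" using t a by auto
      then have "\<bar>(w \<bullet> u t) * (v t \<bullet> v t)\<bar> = \<bar>k\<bar>" using k by simp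
      then show ?thesis by (simp add: dot_square_norm abs_mult)
    qed
    then have "\<epsilon> * (norm (v t))\<^sup>2 \<le> \<bar>k\<bar>"
      using h(1)[OF t] by (metis mult_right_mono zero_le_power2)
    then show ?thesis using h(2) unfolding K_def by (intro real_le_rsqrt) (simp add: field_simps)
  qed
  have K0: "0 \<le> K" using order_trans[OF norm_ge_zero vK[of a]] a by simp
  define B where "B = 1 / \<epsilon> * (K\<^sup>2 / 2 * norm w + norm w * K * K) + 3 / 2 * K\<^sup>2"
  have accB: "norm (acc w (u t) (v t)) \<le> B" if t: "t \<in> {a..<c}" for t
  proof -
    have "norm (acc w (u t) (v t)) \<le> norm ((1 / (w \<bullet> u t)) *\<^sub>R ((v t \<bullet> v t / 2) *\<^sub>R w - (w \<bullet> v t) *\<^sub>R v t))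
        + norm ((3 / 2 * (v t \<bullet> v t)) *\<^sub>R u t)"
      unfolding acc_def by (rule norm_triangle_ineq4)
    also have "\<dots> \<le> 1 / \<epsilon> * (K\<^sup>2 / 2 * norm w + norm w * K * K) + 3 / 2 * K\<^sup>2 * 1"
    proof (rule add_mono)
      have vv: "v t \<bullet> v t \<le> K\<^sup>2" using vK[OF t] by (simp add: dot_square_norm power_mono)
      have "norm ((v t \<bullet> v t / 2) *\<^sub>R w - (w \<bullet> v t) *\<^sub>R v t)
          \<le> norm ((v t \<bullet> v t / 2) *\<^sub>R w) + norm ((w \<bullet> v t) *\<^sub>R v t)" by (rule norm_triangle_ineq4)
      also have "\<dots> \<le> K\<^sup>2 / 2 * norm w + norm w * K * K"
      proof (rule add_mono)
        show "norm ((v t \<bullet> v t / 2) *\<^sub>R w) \<le> K\<^sup>2 / 2 * norm w"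
          using vv by (simp add: mult_right_mono)
        have "\<bar>w \<bullet> v t\<bar> \<le> norm w * K"
          using Cauchy_Schwarz_ineq2[of w "v t"] mult_left_mono[OF vK[OF t], of "norm w"] by simp
        then show "norm ((w \<bullet> v t) *\<^sub>R v t) \<le> norm w * K * K"
          using vK[OF t] K0 by (simp add: mult_mono)
      qed
      finally have n: "norm ((v t \<bullet> v t / 2) *\<^sub>R w - (w \<bullet> v t) *\<^sub>R v t) \<le> K\<^sup>2 / 2 * norm w + norm w * K * K" .
      have "1 / \<bar>w \<bullet> u t\<bar> \<le> 1 / \<epsilon>" using h(1)[OF t] h(2) by (intro frac_le) auto
      from mult_mono[OF this n] show "norm ((1 / (w \<bullet> u t)) *\<^sub>R ((v t \<bullet> v t / 2) *\<^sub>R w - (w \<bullet> v t) *\<^sub>R v t))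
          \<le> 1 / \<epsilon> * (K\<^sup>2 / 2 * norm w + norm w * K * K)"
        using h(2) by simp
      show "norm ((3 / 2 * (v t \<bullet> v t)) *\<^sub>R u t) \<le> 3 / 2 * K\<^sup>2 * 1"
        using vv d(3)[of t] t a by auto
    qed
    finally show ?thesis by (simp add: B_def)
  qed
  have sub: "t \<in> J" if "t \<in> {a..<c}" for t using a that by auto
  obtain u1 where u1: "(u \<longlongrightarrow> u1) (at_left c)"
    using bounded_derivative_left_limit[OF a(2), of u v K] d(1) vK sub by blast
  obtain v1 where v1: "(v \<longlongrightarrow> v1) (at_left c)"
    using bounded_derivative_left_limit[OF a(2), of v "\<lambda>t. acc w (u t) (v t)" B] d(2) accB sub by blast
  have nt: "at_left c \<noteq> (bot :: real filter)" by simp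
  have ev: "\<forall>\<^sub>F t in at_left c. t \<in> {a..<c}"
    unfolding eventually_at_left_field using a(2) by (intro exI[of _ a]) auto
  have h1: "\<epsilon> \<le> \<bar>w \<bullet> u1\<bar>"
  proof (rule tendsto_lowerbound[OF _ _ nt])
    show "((\<lambda>t. \<bar>w \<bullet> u t\<bar>) \<longlongrightarrow> \<bar>w \<bullet> u1\<bar>) (at_left c)" by (intro tendsto_intros u1)
    show "\<forall>\<^sub>F t in at_left c. \<epsilon> \<le> \<bar>w \<bullet> u t\<bar>" using ev by eventually_elim (rule h)
  qed
  have uu: "u1 \<bullet> u1 = 1"
  proof (rule tendsto_unique[OF nt])
    show "((\<lambda>t. u t \<bullet> u t) \<longlongrightarrow> u1 \<bullet> u1) (at_left c)" by (intro tendsto_intros u1)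
    show "((\<lambda>t. u t \<bullet> u t) \<longlongrightarrow> 1) (at_left c)"
      by (rule tendsto_eventually) (use ev in eventually_elim, use g sub in \<open>auto simp: geo_def\<close>)
  qed
  have uv: "u1 \<bullet> v1 = 0"
  proof (rule tendsto_unique[OF nt])
    show "((\<lambda>t. u t \<bullet> v t) \<longlongrightarrow> u1 \<bullet> v1) (at_left c)" by (intro tendsto_intros u1 v1)
    show "((\<lambda>t. u t \<bullet> v t) \<longlongrightarrow> 0) (at_left c)"
      by (rule tendsto_eventually) (use ev in eventually_elim, use geo_velocity[OF g J(1)] sub in auto)
  qed
  \<comment> \<open>Moving \<open>u\<close> by \<open>r\<close> changes \<open>w \<bullet> u\<close> by at most half of its lower bound.\<close>
  define r where "r = \<epsilon> / (2 * (norm w + 1))"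
  have r: "r > 0" using h(2) by (auto simp: r_def intro!: divide_pos_pos add_nonneg_pos)
  have near: "\<epsilon> / 2 \<le> \<bar>w \<bullet> fst z\<bar>" if "z \<in> cball (u1, v1) r" for z
  proof -
    have "norm (u1 - fst z) \<le> r"
      using that dist_fst_le[of "(u1, v1)" z] by (simp add: dist_norm)
    then have "\<bar>w \<bullet> (u1 - fst z)\<bar> \<le> norm w * r"
      using Cauchy_Schwarz_ineq2[of w "u1 - fst z"] by (meson mult_left_mono norm_ge_zero order_trans)
    also have "\<dots> \<le> (norm w + 1) * r" using r by (intro mult_right_mono) auto
    also have "\<dots> = \<epsilon> / 2" by (simp add: r_def add_nonneg_pos field_simps add_nonneg_eq_0_iff)
    finally show ?thesis using h1 unfolding inner_diff_right by linarith
  qed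
  obtain L where L: "L-lipschitz_on (cball (u1, v1) r) (geo_field w)"
    using lipschitz_geo_field[OF compact_cball near] h(2) by (metis half_gt_zero)
  have y: "((\<lambda>t. (u t, v t)) has_vector_derivative geo_field w (u t, v t)) (at t)" if "t \<in> J" for t
    using d(1,2)[OF that] by (auto simp: geo_field_def intro: has_vector_derivative_Pair)
  obtain \<delta> z where z: "\<delta> > 0" "\<And>t. t < c \<Longrightarrow> z t = (u t, v t)" "z c = (u1, v1)"
    "\<And>t. t \<in> {c..<c + \<delta>} \<Longrightarrow> z t \<in> cball (u1, v1) r"
    "\<And>t. t \<in> {a<..<c + \<delta>} \<Longrightarrow> (z has_vector_derivative geo_field w (z t)) (at t)"
  proof (rule ode_extend_right[OF a(2) _ tendsto_Pair[OF u1 v1] r L])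
    fix t assume "t \<in> {a<..<c}"
    then show "((\<lambda>t. (u t, v t)) has_vector_derivative geo_field w (u t, v t)) (at t)"
      using sub by (intro y) auto
  qed blast
  have z1: "fst (z t) \<bullet> fst (z t) = 1" if t: "t \<in> {c..<c + \<delta>}" for t
  proof (rule geo_field_preserves_tangency[of c "c + \<delta>" z w "\<epsilon> / 2" "norm v1 + r", OF _ _ _ _ _ _ t])
    fix s assume s: "s \<in> {c..<c + \<delta>}"
    show "(z has_vector_derivative geo_field w (z s)) (at s)" using s a by (intro z(5)) auto
    show "\<epsilon> / 2 \<le> \<bar>w \<bullet> fst (z s)\<bar>" using s by (intro near z(4))
    have "norm (snd (z s) - v1) \<le> r"
      using z(4)[OF s] dist_snd_le[of "(u1, v1)" "z s"] by (simp add: dist_norm norm_minus_commute)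
    then show "norm (snd (z s)) \<le> norm v1 + r" using norm_triangle_sub[of "snd (z s)" v1] by simp
  qed (use h(2) uu uv z(3) in auto)
  define J' where "J' = J \<union> {a<..<c + \<delta>}"
  show thesis
  proof (rule that[of J' "\<lambda>t. fst (z t)" "\<lambda>t. snd (z t)"])
    show "open J'" using J by (auto simp: J'_def)
    have "(a + c) / 2 \<in> J \<inter> {a<..<c + \<delta>}" using a z(1) by (auto intro!: sub)
    then have "J \<inter> {a<..<c + \<delta>} \<noteq> {}" by blast
    then show "is_interval J'" unfolding J'_def
      using J by (simp add: is_interval_connected_1 connected_Un)
    show "c \<in> J'" using a z(1) by (auto simp: J'_def)
    show "fst (z t) = u t" if "t \<in> J" for t using that a(4) z(2)[of t] by auto
    show "geo w J' (\<lambda>t. fst (z t)) (\<lambda>t. snd (z t))"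
      unfolding geo_def
    proof
      fix t assume t: "t \<in> J'"
      have "(z has_vector_derivative geo_field w (z t)) (at t)"
      proof (cases "t < c")
        case True
        then have tJ: "t \<in> J" using t sub[of t] by (auto simp: J'_def)
        show ?thesis
          by (rule has_vector_derivative_transform_within_open[of "\<lambda>t. (u t, v t)" _ _ J])
             (use y[OF tJ] J tJ a z(2) in auto)
      next
        case False
        then show ?thesis using t a by (intro z(5)) (auto simp: J'_def)
      qed
      from bounded_linear.has_vector_derivative[OF bounded_linear_fst this]
        bounded_linear.has_vector_derivative[OF bounded_linear_snd this]
      have "((\<lambda>t. fst (z t)) has_vector_derivative snd (z t)) (at t) \<and>
         ((\<lambda>t. snd (z t)) has_vector_derivative acc w (fst (z t)) (snd (z t))) (at t)"
        by (simp add: geo_field_def case_prod_beta)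
      moreover have "fst (z t) \<bullet> fst (z t) = 1 \<and> w \<bullet> fst (z t) \<noteq> 0"
      proof (cases "t < c")
        case True
        then have tJ: "t \<in> J" using t sub[of t] by (auto simp: J'_def)
        then show ?thesis using g z(2)[OF True] by (auto simp: geo_def)
      next
        case False
        then have "t \<in> {c..<c + \<delta>}" using t a by (auto simp: J'_def)
        from z1[OF this] near[OF z(4)[OF this]] show ?thesis using h(2) by auto
      qed
      ultimately show "((\<lambda>t. fst (z t)) has_vector_derivative snd (z t)) (at t) \<and>
         ((\<lambda>t. snd (z t)) has_vector_derivative acc w (fst (z t)) (snd (z t))) (at t) \<and>
         fst (z t) \<bullet> fst (z t) = 1 \<and> w \<bullet> fst (z t) \<noteq> 0" by blast
    qed
  qed (auto simp: J'_def)
qed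

section \<open>The height of a geodesic\<close>

text \<open>Sturm: a solution of \<open>q'' = - \<omega> q\<close> with \<open>\<omega>\<close> bounded below by a positive constant cannot keep
  its sign forever. If \<open>q \<le> 0\<close> then \<open>q\<close> is convex and bounded above on a half-line, so it
  decreases; once it is negative its slope grows at a definite rate and becomes positive.\<close>

lemma sturm_nonpos_zero:
  fixes q p \<omega> :: "real \<Rightarrow> real"
  assumes q: "\<And>t. t > T \<Longrightarrow> (q has_real_derivative p t) (at t)"
    and p: "\<And>t. t > T \<Longrightarrow> (p has_real_derivative - \<omega> t * q t) (at t)"
    and \<omega>: "\<And>t. t > T \<Longrightarrow> \<omega> t \<ge> \<omega>0" "\<omega>0 > 0"
    and neg: "\<And>t. t > T \<Longrightarrow> q t \<le> 0" and t: "t > T"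
  shows "q t = 0"
proof (rule ccontr)
  assume "q t \<noteq> 0"
  then have qt: "q t < 0" using neg[OF t] by simp
  have grow: "f s \<ge> f a + m * (s - a)"
    if "T < a" "a \<le> s" "\<And>x. a \<le> x \<Longrightarrow> (f has_real_derivative f' x) (at x)" "\<And>x. a \<le> x \<Longrightarrow> f' x \<ge> m"
    for f f' :: "real \<Rightarrow> real" and a s m
  proof -
    have "f a - m * a \<le> f s - m * s"
    proof (rule DERIV_nonneg_imp_nondecreasing[OF that(2)])
      fix x assume x: "a \<le> x" "x \<le> s"
      have "((\<lambda>s. f s - m * s) has_real_derivative f' x - m) (at x)"
        by (auto intro!: derivative_eq_intros that(3)[OF x(1)])
      then show "\<exists>y. ((\<lambda>s. f s - m * s) has_real_derivative y) (at x) \<and> 0 \<le> y"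
        using that(4)[OF x(1)] by (intro exI[of _ "f' x - m"]) auto
    qed
    then show ?thesis by (simp add: algebra_simps)
  qed
  have p'0: "- \<omega> x * q x \<ge> 0" if "x > T" for x
    using \<omega>(1)[OF that] \<omega>(2) neg[OF that] by (simp add: mult_nonneg_nonpos)
  have pneg: "p s \<le> 0" if s: "s > T" for s
  proof (rule ccontr)
    assume "\<not> p s \<le> 0"
    then have ps: "p s > 0" by simp
    have "p x \<ge> p s" if "x \<ge> s" for x
      using grow[of s x p "\<lambda>x. - \<omega> x * q x" 0] p p'0 s that by auto
    then have "q (s + (1 - q s) / p s) \<ge> q s + p s * ((s + (1 - q s) / p s) - s)"
      using q s ps neg[OF s] by (intro grow[where f' = p]) (auto intro!: divide_nonneg_pos)
    then have "q (s + (1 - q s) / p s) \<ge> 1" using ps by simp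
    moreover have "(1 - q s) / p s \<ge> 0" using ps neg[OF s] by (intro divide_nonneg_pos) auto
    then have "s + (1 - q s) / p s > T" using s by simp
    ultimately show False using neg by fastforce
  qed
  have "- q x \<ge> - q t" if "x \<ge> t" for x
  proof -
    have "- q x \<ge> - q t + 0 * (x - t)"
      using t that by (intro grow[where f' = "\<lambda>s. - p s"] DERIV_minus q) (auto intro: pneg)
    then show ?thesis by simp
  qed
  then have m: "- \<omega> x * q x \<ge> \<omega>0 * - q t" if "x \<ge> t" for x
    using \<omega>(1)[of x] \<omega>(2) t that qt mult_mono[of \<omega>0 "\<omega> x" "- q t" "- q x"] by fastforce
  \<comment> \<open>At this time the lower bound for the slope reaches 1.\<close>
  define s where "s = t + (1 - p t) / (\<omega>0 * - q t)"
  have d: "\<omega>0 * - q t > 0" using qt \<omega>(2) by (simp add: mult_pos_neg)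
  have "(1 - p t) / (\<omega>0 * - q t) \<ge> 0" by (rule divide_nonneg_pos) (use d pneg[OF t] in auto)
  then have st: "s \<ge> t" unfolding s_def by linarith
  have "p s \<ge> p t + (\<omega>0 * - q t) * (s - t)"
    using p m t st by (intro grow[where f' = "\<lambda>x. - \<omega> x * q x"]) auto
  also have "(\<omega>0 * - q t) * (s - t) = 1 - p t" unfolding s_def using d qt \<omega>(2) by auto
  finally show False using pneg[of s] st t by auto
qed

lemma first_zero:
  fixes q :: "real \<Rightarrow> real"
  assumes q: "\<And>t. t \<in> {t1..t2} \<Longrightarrow> (q has_real_derivative p t) (at t)"
    and "t1 < t2" "q t1 > 0" "q t2 < 0"
  obtains t where "t1 < t" "t < t2" "q t = 0" "p t \<le> 0"
proof -
  define S where "S = {t \<in> {t1..t2}. q t \<le> 0}"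
  have cq: "continuous_on {t1..t2} q"
    using q by (meson DERIV_isCont continuous_at_imp_continuous_on)
  have S: "closed S" "t2 \<in> S" "bdd_below S"
    using assms continuous_closed_preimage[OF cq closed_atLeastAtMost, of "{..0}"]
    by (auto simp: S_def vimage_def Int_def intro!: bdd_belowI[of _ t1])
  define t where "t = Inf S"
  have tS: "t \<in> S" unfolding t_def using S by (intro closed_contains_Inf) auto
  have before: "q s > 0" if "s \<in> {t1..<t}" for s
  proof (rule ccontr)
    assume "\<not> 0 < q s"
    then have "s \<in> S" using that tS by (auto simp: S_def)
    then show False using cInf_lower[OF _ S(3), of s] that by (auto simp: t_def)
  qed
  have t1: "t1 < t" using tS assms(3) by (cases "t = t1") (auto simp: S_def)
  have qt: "(q \<longlongrightarrow> q t) (at_left t)"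
    using q[of t] tS DERIV_isCont[of q "p t" t] by (auto simp: S_def isCont_def filterlim_at_split)
  have ev: "\<forall>\<^sub>F s in at_left t. s \<in> {t1..<t}"
    unfolding eventually_at_left_field using t1 by (intro exI[of _ t1]) auto
  have "q t \<ge> 0"
    by (rule tendsto_lowerbound[OF qt]) (use ev in eventually_elim, use before in force, simp)
  then have q0: "q t = 0" using tS by (auto simp: S_def)
  have "p t \<le> 0"
  proof (rule ccontr)
    assume "\<not> p t \<le> 0"
    then obtain d where d: "d > 0" "\<And>h. h > 0 \<Longrightarrow> h < d \<Longrightarrow> q (t - h) < q t"
      using DERIV_pos_inc_left[of q "p t" t] q[of t] tS by (auto simp: S_def)
    define h where "h = min (d / 2) (t - t1)"
    have "q (t - h) < 0" using d t1 q0 by (auto simp: h_def)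
    moreover have "q (t - h) > 0" using d t1 by (intro before) (auto simp: h_def)
    ultimately show False by simp
  qed
  moreover have "t < t2" using tS q0 assms(4) by (cases "t = t2") (auto simp: S_def)
  ultimately show thesis using that t1 q0 by blast
qed

text \<open>The equations for the height \<open>z\<close> of a geodesic over the equator, for the unit vector normal to it,
  with \<open>q = z z'\<close>, energy \<open>k\<close> and squared angular momentum \<open>l\<close>.\<close>

definition height_system :: "real \<Rightarrow> real \<Rightarrow> real set \<Rightarrow> (real \<Rightarrow> real) \<Rightarrow> (real \<Rightarrow> real) \<Rightarrow> bool" where
  "height_system k l J z q \<longleftrightarrow> (\<forall>t\<in>J. 0 < z t \<and> (z has_real_derivative q t / z t) (at t) \<and>
     (q has_real_derivative k * (1 - 3 * (z t)\<^sup>2) / (2 * z t)) (at t) \<and>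
     (q t)\<^sup>2 = k * z t * (1 - (z t)\<^sup>2) - l)"

lemma height_system_subset: "height_system k l J z q \<Longrightarrow> J' \<subseteq> J \<Longrightarrow> height_system k l J' z q"
  by (auto simp: height_system_def)

lemma height_system_reverse:
  assumes "height_system k l J z q"
  shows "height_system k l (uminus ` J) (\<lambda>t. z (- t)) (\<lambda>t. - q (- t))"
  unfolding height_system_def
proof (intro ballI conjI)
  fix t assume "t \<in> uminus ` J"
  then have t: "- t \<in> J" by auto
  have d: "((\<lambda>t. z (- t)) has_real_derivative (q (- t) / z (- t)) * - 1) (at t)"
    "((\<lambda>t. q (- t)) has_real_derivative (k * (1 - 3 * (z (- t))\<^sup>2) / (2 * z (- t))) * - 1) (at t)"
    using DERIV_mirror[THEN iffD1, of z "q (- t) / z (- t)" t]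
      DERIV_mirror[THEN iffD1, of q "k * (1 - 3 * (z (- t))\<^sup>2) / (2 * z (- t))" t] assms t
    unfolding height_system_def by auto
  show "((\<lambda>t. z (- t)) has_real_derivative - q (- t) / z (- t)) (at t)" using d(1) by simp
  show "((\<lambda>t. - q (- t)) has_real_derivative k * (1 - 3 * (z (- t))\<^sup>2) / (2 * z (- t))) (at t)"
    using DERIV_minus[OF d(2)] by simp
  show "0 < z (- t)" "(- q (- t))\<^sup>2 = k * z (- t) * (1 - (z (- t))\<^sup>2) - l"
    using assms t by (auto simp: height_system_def)
qed

lemma height_le_1:
  assumes "height_system k l J z q" "k > 0" "l \<ge> 0" "t \<in> J"
  shows "z t \<le> 1"
proof -
  have z: "0 < z t" "(q t)\<^sup>2 = k * z t * (1 - (z t)\<^sup>2) - l" using assms by (auto simp: height_system_def)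
  have "0 \<le> k * z t * (1 - (z t)\<^sup>2)" using z(2) assms(3) zero_le_power2[of "q t"] by linarith
  moreover have "0 < k * z t" using z(1) assms(2) by simp
  ultimately have "(z t)\<^sup>2 \<le> 1" using zero_le_mult_iff[of "k * z t" "1 - (z t)\<^sup>2"] by linarith
  then show ?thesis using z(1) by (simp add: power2_le_iff_abs_le abs_square_le_1)
qed

text \<open>The second derivative of \<open>q = z z'\<close> is \<open>- \<omega> q\<close> with \<open>\<omega> = (k / 2) (1 / z\<^sup>3 + 3 / z) \<ge> 2 k\<close>, so \<open>q\<close>
  changes its sign again and again. Where it passes from positive to negative, \<open>q' \<le> 0\<close> means
  \<open>3 z\<^sup>2 \<ge> 1\<close>; in the other direction \<open>3 z\<^sup>2 \<le> 1\<close>. The last assumption excludes the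
  critical value of the cubic \<open>k z (1 - z\<^sup>2)\<close>, for which the height is constant.\<close>

lemma height_system_turning_points:
  assumes sys: "height_system k l {T<..} z q" and k: "k > 0" and l: "l \<ge> 0"
    and nd: "\<And>x. 3 * x\<^sup>2 = 1 \<Longrightarrow> x > 0 \<Longrightarrow> k * x * (1 - x\<^sup>2) \<noteq> l"
  shows "\<exists>t>T. q t = 0 \<and> 1 \<le> 3 * (z t)\<^sup>2" "\<exists>t>T. q t = 0 \<and> 3 * (z t)\<^sup>2 \<le> 1"
proof -
  define p where "p = (\<lambda>t. k * (1 - 3 * (z t)\<^sup>2) / (2 * z t))"
  define \<omega> where "\<omega> = (\<lambda>t. k / 2 * (1 / (z t)^3 + 3 / z t))"
  have z: "0 < z t" "z t \<le> 1" "(q t)\<^sup>2 = k * z t * (1 - (z t)\<^sup>2) - l"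
    and z': "(z has_real_derivative q t / z t) (at t)" and q': "(q has_real_derivative p t) (at t)" if "t > T" for t
    using sys that height_le_1[OF sys k l, of t] by (auto simp: height_system_def p_def)
  have p': "(p has_real_derivative - \<omega> t * q t) (at t)" if t: "t > T" for t
    unfolding p_def \<omega>_def using z(1)[OF t]
    by (auto intro!: derivative_eq_intros z'[OF t])
      (simp add: field_simps power2_eq_square power3_eq_cube)
  have om: "\<omega> t \<ge> 2 * k" if t: "t > T" for t
  proof -
    have "(z t)^3 \<le> 1" using z[OF t] by (simp add: power_le_one)
    then have "1 / (z t)^3 \<ge> 1" "3 / z t \<ge> 3" using z[OF t] by (simp_all add: le_divide_eq)
    then have "k / 2 * (1 / (z t)^3 + 3 / z t) \<ge> k / 2 * 4" using k by (intro mult_left_mono) auto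
    then show ?thesis by (simp add: \<omega>_def)
  qed
  have nz: False if "a \<ge> T" "\<And>t. t > a \<Longrightarrow> q t = 0" for a
  proof -
    have a1: "a + 1 > T" using that by simp
    have "(q has_real_derivative 0) (at (a + 1))"
      by (rule DERIV_cong_ev[THEN iffD1, OF refl _ refl DERIV_const[of 0]])
         (use that in \<open>auto simp: eventually_nhds intro!: exI[of _ "{a<..}"]\<close>)
    then have "p (a + 1) = 0" using q'[OF a1] DERIV_unique by blast
    then have "3 * (z (a + 1))\<^sup>2 = 1" using k z(1)[OF a1] by (simp add: p_def)
    then show False using nd[of "z (a + 1)"] z(1,3)[OF a1] that(2)[of "a + 1"] by simp
  qed
  have pos: "\<exists>t>a. q t > 0" if "a \<ge> T" for a
  proof (rule ccontr)
    assume *: "\<not> (\<exists>t>a. q t > 0)"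
    have "q t = 0" if "t > a" for t
    proof (rule sturm_nonpos_zero[of a q p \<omega> "2 * k"])
      fix t assume "t > a"
      then have t: "t > T" using \<open>a \<ge> T\<close> by simp
      show "(q has_real_derivative p t) (at t)" "(p has_real_derivative - \<omega> t * q t) (at t)" "2 * k \<le> \<omega> t"
        using q'[OF t] p'[OF t] om[OF t] by auto
      show "q t \<le> 0" using * \<open>t > a\<close> by (meson not_less)
    qed (use that k in auto)
    then show False using nz[OF \<open>a \<ge> T\<close>] by blast
  qed
  have neg: "\<exists>t>a. q t < 0" if "a \<ge> T" for a
  proof (rule ccontr)
    assume *: "\<not> (\<exists>t>a. q t < 0)"
    have "- q t = 0" if "t > a" for t
    proof (rule sturm_nonpos_zero[of a "\<lambda>t. - q t" "\<lambda>t. - p t" \<omega> "2 * k"])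
      fix t assume "t > a"
      then have t: "t > T" using \<open>a \<ge> T\<close> by simp
      show "((\<lambda>t. - q t) has_real_derivative - p t) (at t)" using q'[OF t] by (rule DERIV_minus)
      show "((\<lambda>t. - p t) has_real_derivative - \<omega> t * - q t) (at t)" using DERIV_minus[OF p'[OF t]] by simp
      show "2 * k \<le> \<omega> t" by (rule om[OF t])
      show "- q t \<le> 0" using * \<open>t > a\<close> by (meson neg_le_0_iff_le not_less)
    qed (use that k in auto)
    then show False using nz[OF \<open>a \<ge> T\<close>] by simp
  qed
  have p_le: "p t \<le> 0 \<longleftrightarrow> 1 \<le> 3 * (z t)\<^sup>2" "- p t \<le> 0 \<longleftrightarrow> 3 * (z t)\<^sup>2 \<le> 1" if "t > T" for t
    using z(1)[OF that] k by (simp_all add: p_def divide_le_0_iff mult_le_0_iff zero_le_divide_iff zero_le_mult_iff)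
  obtain t1 where t1: "t1 > T" "q t1 > 0" using pos by blast
  obtain t2 where t2: "t2 > t1" "q t2 < 0" using neg[of t1] t1 by auto
  obtain t3 where t3: "t3 > t2" "q t3 > 0" using pos[of t2] t1 t2 by auto
  obtain t where "t1 < t" "q t = 0" "p t \<le> 0"
    by (rule first_zero[of t1 t2 q p]) (use t1 t2 q' in auto)
  then show "\<exists>t>T. q t = 0 \<and> 1 \<le> 3 * (z t)\<^sup>2" using t1 p_le[of t] by (intro exI[of _ t]) auto
  obtain t where "t2 < t" "- q t = 0" "- p t \<le> 0"
    by (rule first_zero[of t2 t3 "\<lambda>t. - q t" "\<lambda>t. - p t"]) (use t1 t2 t3 q' in \<open>auto intro!: DERIV_minus\<close>)
  then show "\<exists>t>T. q t = 0 \<and> 3 * (z t)\<^sup>2 \<le> 1" using t1 t2 p_le[of t] by (intro exI[of _ t]) auto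
qed

text \<open>The cubic \<open>y (1 - y\<^sup>2)\<close> increases up to \<open>3 y\<^sup>2 = 1\<close> and decreases afterwards. So a root of
  \<open>y (1 - y\<^sup>2) = m\<close> on either side bounds the set where \<open>y (1 - y\<^sup>2) \<ge> m\<close>.\<close>

lemma cubic_barrier:
  fixes x y m :: real
  assumes "0 < x" "0 < y" "x * (1 - x\<^sup>2) = m" "y * (1 - y\<^sup>2) \<ge> m"
  shows "1 \<le> 3 * x\<^sup>2 \<Longrightarrow> y \<le> x" "3 * x\<^sup>2 \<le> 1 \<Longrightarrow> x \<le> y"
proof -
  have f: "(x - y) * (1 - (x\<^sup>2 + x * y + y\<^sup>2)) \<le> 0"
    using assms(3,4) by (simp add: algebra_simps power2_eq_square)
  show "y \<le> x" if x: "1 \<le> 3 * x\<^sup>2"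
  proof (rule ccontr)
    assume "\<not> y \<le> x"
    then have xy: "x < y" by simp
    then have "x\<^sup>2 < x * y" "x\<^sup>2 < y\<^sup>2" using assms(1) by (auto simp: power2_eq_square mult_strict_mono)
    then have "1 - (x\<^sup>2 + x * y + y\<^sup>2) < 0" using x by linarith
    then have "(x - y) * (1 - (x\<^sup>2 + x * y + y\<^sup>2)) > 0" using xy by (intro mult_neg_neg) auto
    then show False using f by simp
  qed
  show "x \<le> y" if x: "3 * x\<^sup>2 \<le> 1"
  proof (rule ccontr)
    assume "\<not> x \<le> y"
    then have xy: "y < x" by simp
    then have "x * y < x\<^sup>2" "y\<^sup>2 < x\<^sup>2" using assms(1,2) by (auto simp: power2_eq_square mult_strict_mono)
    then have "1 - (x\<^sup>2 + x * y + y\<^sup>2) > 0" using x by linarith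
    then have "(x - y) * (1 - (x\<^sup>2 + x * y + y\<^sup>2)) > 0" using xy by (intro mult_pos_pos) auto
    then show False using f by simp
  qed
qed

text \<open>All turning points with \<open>3 z\<^sup>2 \<ge> 1\<close> lie at the same height, the maximum, and all those with
  \<open>3 z\<^sup>2 \<le> 1\<close> at the minimum, by the barrier. They occur arbitrarily late, and by time reversal
  arbitrarily early.\<close>

lemma height_system_oscillates:
  assumes sys: "height_system k l UNIV z q" and k: "k > 0" and l: "l > 0"
  obtains z1 z2 where "0 < z1" "z2 < 1" "\<And>t. z1 \<le> z t" "\<And>t. z t \<le> z2"
    "\<And>R T. R \<in> {z1, z2} \<Longrightarrow> (\<exists>t>T. z t = R) \<and> (\<exists>t<T. z t = R)"
proof -
  have z: "0 < z t" "(q t)\<^sup>2 = k * z t * (1 - (z t)\<^sup>2) - l" for t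
    using sys by (auto simp: height_system_def)
  have cub: "z t * (1 - (z t)\<^sup>2) \<ge> l / k" for t
    using z[of t] k zero_le_power2[of "q t"] by (simp add: divide_le_eq mult.commute mult.left_commute)
  have cub0: "z t * (1 - (z t)\<^sup>2) = l / k" if "q t = 0" for t
    using z[of t] k that by (simp add: eq_divide_eq mult_ac)
  have lt1: "x < 1" if "0 < x" "x * (1 - x\<^sup>2) = l / k" for x :: real
  proof -
    have "0 < x * (1 - x\<^sup>2)" using that k l by simp
    then have "x\<^sup>2 < 1" using that(1) by (simp add: zero_less_mult_iff)
    then show ?thesis using that(1) by (simp add: abs_square_less_1)
  qed
  show thesis
  proof (cases "\<exists>x. 3 * x\<^sup>2 = 1 \<and> x > 0 \<and> k * x * (1 - x\<^sup>2) = l")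
    case True
    then obtain x where x: "3 * x\<^sup>2 = 1" "x > 0" "k * x * (1 - x\<^sup>2) = l" by blast
    then have xl: "x * (1 - x\<^sup>2) = l / k" using k by (auto simp: eq_divide_eq)
    have "z t = x" for t
      using cubic_barrier[OF x(2) z(1) xl cub, of t] x(1) by simp
    then show thesis using that[of x x] x(2) lt1[OF x(2) xl] by (metis empty_iff gt_ex insert_iff lt_ex order_refl)
  next
    case False
    then have nd: "\<And>x. 3 * x\<^sup>2 = 1 \<Longrightarrow> x > 0 \<Longrightarrow> k * x * (1 - x\<^sup>2) \<noteq> l" by blast
    note turn = height_system_turning_points[OF height_system_subset[OF sys] k less_imp_le[OF l] nd, OF subset_UNIV]
    have rev: "height_system k l UNIV (\<lambda>t. z (- t)) (\<lambda>t. - q (- t))"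
      using height_system_reverse[OF sys] by simp
    note turn' = height_system_turning_points[OF height_system_subset[OF rev] k less_imp_le[OF l] nd, OF subset_UNIV]
    obtain a where a: "q a = 0" "1 \<le> 3 * (z a)\<^sup>2" using turn(1)[of 0] by blast
    obtain b where b: "q b = 0" "3 * (z b)\<^sup>2 \<le> 1" using turn(2)[of 0] by blast
    have le: "z t \<le> z a" if "q a = 0" "1 \<le> 3 * (z a)\<^sup>2" for a t
      using cubic_barrier(1)[OF z(1) z(1) cub0[OF that(1)] cub that(2)] .
    have ge: "z b \<le> z t" if "q b = 0" "3 * (z b)\<^sup>2 \<le> 1" for b t
      using cubic_barrier(2)[OF z(1) z(1) cub0[OF that(1)] cub that(2)] .
    have eqa: "z t = z a" if "q t = 0" "1 \<le> 3 * (z t)\<^sup>2" for t using le a that by (meson order_antisym)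
    have eqb: "z t = z b" if "q t = 0" "3 * (z t)\<^sup>2 \<le> 1" for t using ge b that by (meson order_antisym)
    show thesis
    proof (rule that[of "z b" "z a"])
      show "z a < 1" using lt1[OF z(1) cub0[OF a(1)]] .
      fix R T assume R: "R \<in> {z b, z a}"
      have "\<exists>t>T. z t = z a" "\<exists>t>T. z t = z b" using turn[of T] eqa eqb by blast+
      moreover obtain t where "t > - T" "- q (- t) = 0" "1 \<le> 3 * (z (- t))\<^sup>2" using turn'(1)[of "- T"] by blast
      then have "\<exists>t<T. z t = z a" using eqa[of "- t"] by (intro exI[of _ "- t"]) auto
      moreover obtain t where "t > - T" "- q (- t) = 0" "3 * (z (- t))\<^sup>2 \<le> 1" using turn'(2)[of "- T"] by blast
      then have "\<exists>t<T. z t = z b" using eqb[of "- t"] by (intro exI[of _ "- t"]) auto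
      ultimately show "(\<exists>t>T. z t = R) \<and> (\<exists>t<T. z t = R)" using R by auto
    qed (use z(1) le[OF a] ge[OF b] in auto)
  qed
qed

text \<open>Without angular momentum the only turning point is \<open>z = 1\<close>, but on a half-line of times there would
  have to be one with \<open>3 z\<^sup>2 \<le> 1\<close>.\<close>

lemma height_system_no_momentum:
  assumes "height_system k 0 J z q" "k > 0"
  shows "\<not> {T<..} \<subseteq> J"
proof
  assume "{T<..} \<subseteq> J"
  then have sys: "height_system k 0 {T<..} z q" using assms(1) height_system_subset by blast
  have "\<exists>t>T. q t = 0 \<and> 3 * (z t)\<^sup>2 \<le> 1"
    by (rule height_system_turning_points(2)[OF sys assms(2)]) (use assms(2) in \<open>auto simp: power2_eq_square\<close>)
  then obtain t where t: "t > T" "q t = 0" "3 * (z t)\<^sup>2 \<le> 1" by blast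
  then have "0 < z t \<and> (q t)\<^sup>2 = k * z t * (1 - (z t)\<^sup>2) - 0"
    using sys unfolding height_system_def by blast
  moreover have "1 - (z t)\<^sup>2 > 0" using t(3) by simp
  ultimately show False using assms(2) t(2) by auto
qed

section \<open>From geodesics to heights\<close>

lemma acc_scale: "r \<noteq> 0 \<Longrightarrow> acc (r *\<^sub>R w) u v = acc w u v"
  by (simp add: acc_def scaleR_diff_right)

lemma geo_scale: "r \<noteq> 0 \<Longrightarrow> geo (r *\<^sub>R w) J u v \<longleftrightarrow> geo w J u v"
  by (simp add: geo_def acc_scale)

text \<open>Both terms on the left are components of \<open>v\<close> in the tangent plane at \<open>u\<close>, along and across the
  meridian, times the length of the tangential part of \<open>e\<close>.\<close>

lemma unit_frame_identity:
  fixes e u v :: vec3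
  assumes "e \<bullet> e = 1" "u \<bullet> u = 1" "u \<bullet> v = 0"
  shows "(e \<bullet> v)\<^sup>2 + (e \<bullet> (u \<otimes> v))\<^sup>2 = (v \<bullet> v) * (1 - (e \<bullet> u)\<^sup>2)"
proof -
  have 1: "(norm (e \<otimes> u))\<^sup>2 = 1 - (e \<bullet> u)\<^sup>2"
    using norm_cross_dot[of e u] assms by (simp add: norm_eq_sqrt_inner)
  have "(e \<otimes> u) \<otimes> v = (e \<bullet> v) *\<^sub>R u - (u \<bullet> v) *\<^sub>R e"
    by (simp add: cross3_def inner_vec_def sum_3 vec_eq_iff forall_3 algebra_simps)
  then have "(e \<otimes> u) \<otimes> v = (e \<bullet> v) *\<^sub>R u" using assms by simp
  then have 2: "(norm ((e \<otimes> u) \<otimes> v))\<^sup>2 = (e \<bullet> v)\<^sup>2" using assms by (simp add: norm_eq_sqrt_inner power2_abs)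
  have 3: "(e \<otimes> u) \<bullet> v = e \<bullet> (u \<otimes> v)" by (simp add: cross3_simps)
  show ?thesis
    using norm_cross_dot[of "e \<otimes> u" v] unfolding power_mult_distrib 1 2 3
    by (simp add: dot_square_norm mult.commute)
qed

lemma geo_height_system:
  assumes g: "geo e J u v" and J: "open J" and e: "e \<bullet> e = 1" and pos: "\<And>t. t \<in> J \<Longrightarrow> 0 < e \<bullet> u t"
    and k: "\<And>t. t \<in> J \<Longrightarrow> (e \<bullet> u t) * (v t \<bullet> v t) = k"
    and l: "\<And>t. t \<in> J \<Longrightarrow> (e \<bullet> u t) * (e \<bullet> (u t \<otimes> v t)) = l"
  shows "height_system k (l\<^sup>2) J (\<lambda>t. e \<bullet> u t) (\<lambda>t. (e \<bullet> u t) * (e \<bullet> v t))"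
  unfolding height_system_def
proof (intro ballI conjI)
  fix t assume t: "t \<in> J"
  have u': "(u has_vector_derivative v t) (at t)" and v': "(v has_vector_derivative acc e (u t) (v t)) (at t)"
    and uu: "u t \<bullet> u t = 1" using g t by (auto simp: geo_def)
  have uv: "u t \<bullet> v t = 0" using geo_velocity[OF g J t] .
  show z: "0 < e \<bullet> u t" by (rule pos[OF t])
  have vv: "v t \<bullet> v t = k / (e \<bullet> u t)" using k[OF t] z by (simp add: field_simps)
  show "((\<lambda>t. e \<bullet> u t) has_real_derivative (e \<bullet> u t) * (e \<bullet> v t) / (e \<bullet> u t)) (at t)"
    using has_real_derivative_inner_const[OF u', of e] z by simp
  have "((\<lambda>t. (e \<bullet> u t) * (e \<bullet> v t)) has_real_derivative
      (e \<bullet> v t) * (e \<bullet> v t) + (e \<bullet> acc e (u t) (v t)) * (e \<bullet> u t)) (at t)"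
    by (rule DERIV_mult[OF has_real_derivative_inner_const[OF u'] has_real_derivative_inner_const[OF v']])
  moreover have "(e \<bullet> v t) * (e \<bullet> v t) + (e \<bullet> acc e (u t) (v t)) * (e \<bullet> u t)
      = (v t \<bullet> v t) / 2 * (1 - 3 * (e \<bullet> u t)\<^sup>2)"
    using z e by (simp add: acc_def inner_diff_right inner_add_right field_simps power2_eq_square)
  ultimately show "((\<lambda>t. (e \<bullet> u t) * (e \<bullet> v t)) has_real_derivative k * (1 - 3 * (e \<bullet> u t)\<^sup>2) / (2 * (e \<bullet> u t))) (at t)"
    by (simp add: vv field_simps)
  have "((e \<bullet> u t) * (e \<bullet> v t))\<^sup>2 + l\<^sup>2 = (e \<bullet> u t)\<^sup>2 * ((e \<bullet> v t)\<^sup>2 + (e \<bullet> (u t \<otimes> v t))\<^sup>2)"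
    unfolding l[OF t, symmetric] by (simp add: power_mult_distrib distrib_left)
  also have "\<dots> = (e \<bullet> u t)\<^sup>2 * ((v t \<bullet> v t) * (1 - (e \<bullet> u t)\<^sup>2))"
    unfolding unit_frame_identity[OF e uu uv] ..
  also have "\<dots> = k * (e \<bullet> u t) * (1 - (e \<bullet> u t)\<^sup>2)"
    unfolding k[OF t, symmetric] by (simp add: power2_eq_square)
  finally show "((e \<bullet> u t) * (e \<bullet> v t))\<^sup>2 = k * (e \<bullet> u t) * (1 - (e \<bullet> u t)\<^sup>2) - l\<^sup>2" by simp
qed

lemma geo_reverse:
  assumes g: "geo w J u v"
  shows "geo w (uminus ` J) (\<lambda>t. u (- t)) (\<lambda>t. - v (- t))"
  unfolding geo_def
proof (intro ballI)
  fix t assume "t \<in> uminus ` J"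
  then have t: "- t \<in> J" by auto
  then have "(u has_vector_derivative v (- t)) (at (- t))"
    "(v has_vector_derivative acc w (u (- t)) (v (- t))) (at (- t))" using g by (auto simp: geo_def)
  then have d: "((\<lambda>t. u (- t)) has_vector_derivative - v (- t)) (at t)"
    "((\<lambda>t. v (- t)) has_vector_derivative - acc w (u (- t)) (v (- t))) (at t)"
    using vector_diff_chain_at[of uminus "- 1" t u] vector_diff_chain_at[of uminus "- 1" t v]
      has_vector_derivative_minus[OF has_vector_derivative_id[of "at t"]] by (auto simp: o_def)
  moreover have "acc w a (- b) = acc w a b" for a b by (simp add: acc_def)
  ultimately show "((\<lambda>t. u (- t)) has_vector_derivative - v (- t)) (at t) \<and>
      ((\<lambda>t. - v (- t)) has_vector_derivative acc w (u (- t)) (- v (- t))) (at t) \<and>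
      u (- t) \<bullet> u (- t) = 1 \<and> w \<bullet> u (- t) \<noteq> 0"
    using g t d(1) has_vector_derivative_minus[OF d(2)] by (auto simp: geo_def)
qed

text \<open>Extendibility is expressed by the curve \<open>u\<close> of directions alone, because the position in the section and the
  velocity are determined by it.\<close>

definition inextendible :: "vec3 \<Rightarrow> real set \<Rightarrow> (real \<Rightarrow> vec3) \<Rightarrow> bool" where
  "inextendible w J u \<longleftrightarrow> (\<forall>J' u' v'. open J' \<and> is_interval J' \<and> J \<subseteq> J' \<and> geo w J' u' v' \<and>
     (\<forall>t\<in>J. u' t = u t) \<longrightarrow> J' = J)"

lemma open_uminus_image: "open (uminus ` J)" if "open J" for J :: "real set"
  using that by (rule open_negations)

lemma is_interval_uminus_image: "is_interval (uminus ` J)" if "is_interval J" for J :: "real set"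
  using that by simp

lemma inextendible_reverse:
  assumes "inextendible w J u"
  shows "inextendible w (uminus ` J) (\<lambda>t. u (- t))"
  unfolding inextendible_def
proof (intro allI impI)
  fix J' u' v'
  assume *: "open J' \<and> is_interval J' \<and> uminus ` J \<subseteq> J' \<and> geo w J' u' v' \<and> (\<forall>t\<in>uminus ` J. u' t = u (- t))"
  have "J \<subseteq> uminus ` J'"
  proof
    fix x assume "x \<in> J"
    then have "- x \<in> J'" using * by auto
    then show "x \<in> uminus ` J'" by force
  qed
  then have "open (uminus ` J') \<and> is_interval (uminus ` J') \<and> J \<subseteq> uminus ` J' \<and>
      geo w (uminus ` J') (\<lambda>t. u' (- t)) (\<lambda>t. - v' (- t)) \<and> (\<forall>t\<in>J. u' (- t) = u t)"
    using * by (auto intro!: open_uminus_image is_interval_uminus_image geo_reverse)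
  then have "uminus ` J' = J" using assms unfolding inextendible_def by blast
  then show "J' = uminus ` J" by (auto simp: image_image)
qed

lemma inextendible_approaches_equator:
  assumes g: "geo w J u v" and J: "open J" "is_interval J" and inext: "inextendible w J u"
    and a: "a \<in> J" "a < c" "{a..<c} \<subseteq> J" "J \<subseteq> {..<c}" and e: "\<epsilon> > 0"
  shows "\<exists>t\<in>{a..<c}. \<bar>w \<bullet> u t\<bar> < \<epsilon>"
proof (rule ccontr)
  assume "\<not> ?thesis"
  then have h: "\<And>t. t \<in> {a..<c} \<Longrightarrow> \<epsilon> \<le> \<bar>w \<bullet> u t\<bar>" by (auto simp: not_less)
  obtain J' u' v' where "open J'" "is_interval J'" "J \<subseteq> J'" "c \<in> J'" "geo w J' u' v'" "\<And>t. t \<in> J \<Longrightarrow> u' t = u t"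
    using geo_extend_right[OF g J a h e] by metis
  then have "J' = J" using inext unfolding inextendible_def by metis
  then show False using \<open>c \<in> J'\<close> a(4) by auto
qed

section \<open>The ends of a maximal geodesic\<close>

text \<open>Without angular momentum the motion is along a meridian: \<open>N = \<surd>z (u \<times> v)\<close> is constant, where
  \<open>z = e \<bullet> u\<close>, and \<open>u\<close> lies in the plane orthogonal to \<open>N\<close>, which is spanned by \<open>e\<close> and
  \<open>m = N \<times> e\<close>. The coordinate along \<open>m\<close> has the bounded derivative \<open>\<surd>z\<close>, although the speed is
  unbounded near the equator.\<close>

lemma radial_geo_plane:
  assumes g: "geo e J u v" and J: "open J" "is_interval J" and e: "e \<bullet> e = 1"
    and pos: "\<And>t. t \<in> J \<Longrightarrow> 0 < e \<bullet> u t"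
    and k: "\<And>t. t \<in> J \<Longrightarrow> (e \<bullet> u t) * (v t \<bullet> v t) = k" "k > 0"
    and l: "\<And>t. t \<in> J \<Longrightarrow> e \<bullet> (u t \<otimes> v t) = 0"
  obtains m y where "\<And>t. t \<in> J \<Longrightarrow> u t = (e \<bullet> u t) *\<^sub>R e + y t *\<^sub>R m"
    "\<And>t. t \<in> J \<Longrightarrow> (y has_real_derivative sqrt (e \<bullet> u t)) (at t)"
proof -
  have "\<exists>N. \<forall>t\<in>J. sqrt (e \<bullet> u t) *\<^sub>R (u t \<otimes> v t) = N"
  proof (rule has_vector_derivative_zero_constant)
    show "convex J" using J by (simp add: is_interval_convex_1)
    fix t assume t: "t \<in> J"
    then have u': "(u has_vector_derivative v t) (at t)" and v': "(v has_vector_derivative acc e (u t) (v t)) (at t)"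
      and uu: "u t \<bullet> u t = 1" using g by (auto simp: geo_def)
    have uv: "u t \<bullet> v t = 0" using geo_velocity[OF g J(1) t] .
    have z: "0 < e \<bullet> u t" by (rule pos[OF t])
    have vv: "v t \<bullet> v t > 0" using k(1)[OF t] k(2) by (cases "v t = 0") auto
    define s where "s = sqrt (e \<bullet> u t)"
    have s: "s > 0" "s * s = e \<bullet> u t" using z by (simp_all add: s_def)
    have s': "((\<lambda>t. sqrt (e \<bullet> u t)) has_real_derivative (e \<bullet> v t) / (2 * s)) (at t)"
      unfolding s_def using z has_real_derivative_inner_const[OF u', of e]
      by (auto intro!: derivative_eq_intros simp: field_simps)
    have c': "((\<lambda>t. u t \<otimes> v t) has_vector_derivative (u t \<otimes> acc e (u t) (v t) + v t \<otimes> v t)) (at t)"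
      using bounded_bilinear.has_vector_derivative[OF bounded_bilinear_cross3 u' v'] .
    \<comment> \<open>Since \<open>e \<bullet> (u \<times> v) = 0\<close>, the vector \<open>e\<close> lies in the span of \<open>u\<close> and \<open>v\<close>.\<close>
    have "(v t \<bullet> v t) *\<^sub>R (u t \<otimes> e) = (e \<bullet> v t) *\<^sub>R (u t \<otimes> v t)"
    proof -
      define r where "r = (v t \<bullet> v t) *\<^sub>R e - (e \<bullet> v t) *\<^sub>R v t - ((v t \<bullet> v t) * (e \<bullet> u t)) *\<^sub>R u t"
      have ru: "r \<bullet> u t = 0" "r \<bullet> v t = 0" "r \<bullet> (u t \<otimes> v t) = 0"
        using uu uv l[OF t] by (simp_all add: r_def inner_diff_left inner_diff_right inner_commute dot_cross_self)
      have "r \<otimes> (u t \<otimes> v t) = (r \<bullet> v t) *\<^sub>R u t - (r \<bullet> u t) *\<^sub>R v t"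
        by (simp add: cross3_def inner_vec_def sum_3 vec_eq_iff forall_3 algebra_simps)
      then have "norm r * norm (u t \<otimes> v t) = 0"
        using norm_cross_dot[of r "u t \<otimes> v t"] ru by simp
      moreover have "(norm (u t \<otimes> v t))\<^sup>2 = v t \<bullet> v t"
        using norm_cross_dot[of "u t" "v t"] uu uv by (simp add: norm_eq_sqrt_inner)
      ultimately have "r = 0" using vv by auto
      then have "u t \<otimes> r = 0" by simp
      then show ?thesis by (simp add: r_def Cross3.right_diff_distrib cross_mult_right)
    qed
    note coplanar = this
    have half: "(1 / 2) *\<^sub>R a *\<^sub>R x - a *\<^sub>R x = (- a / 2) *\<^sub>R x" for a and x :: vec3
    proof -
      have "(1 / 2) *\<^sub>R a *\<^sub>R x - a *\<^sub>R x = (1 / 2 * a - a) *\<^sub>R x"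
        by (simp only: scaleR_left_diff_distrib scaleR_scaleR)
      then show ?thesis by simp
    qed
    have "u t \<otimes> acc e (u t) (v t)
      = (1 / (e \<bullet> u t)) *\<^sub>R ((1 / 2) *\<^sub>R (v t \<bullet> v t) *\<^sub>R (u t \<otimes> e) - (e \<bullet> v t) *\<^sub>R (u t \<otimes> v t))"
      by (simp add: acc_def Cross3.right_diff_distrib cross_mult_right)
    then have ca: "u t \<otimes> acc e (u t) (v t) = - ((e \<bullet> v t) / (2 * (e \<bullet> u t))) *\<^sub>R (u t \<otimes> v t)"
      unfolding coplanar half by simp
    have "((\<lambda>t. sqrt (e \<bullet> u t) *\<^sub>R (u t \<otimes> v t)) has_vector_derivative
        s *\<^sub>R (u t \<otimes> acc e (u t) (v t) + v t \<otimes> v t) + ((e \<bullet> v t) / (2 * s)) *\<^sub>R (u t \<otimes> v t)) (at t)"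
      unfolding s_def using has_vector_derivative_scaleR[OF s' c'] unfolding s_def .
    moreover have "s *\<^sub>R (u t \<otimes> acc e (u t) (v t) + v t \<otimes> v t) + ((e \<bullet> v t) / (2 * s)) *\<^sub>R (u t \<otimes> v t) = 0"
      unfolding ca s(2)[symmetric] using s(1) by (simp add: scaleR_left_distrib[symmetric])
    ultimately show "((\<lambda>t. sqrt (e \<bullet> u t) *\<^sub>R (u t \<otimes> v t)) has_vector_derivative 0) (at t within J)"
      by (metis has_vector_derivative_at_within)
  qed blast
  then obtain N where N: "\<And>t. t \<in> J \<Longrightarrow> sqrt (e \<bullet> u t) *\<^sub>R (u t \<otimes> v t) = N" by blast
  define m where "m = N \<otimes> e"
  define y where "y = (\<lambda>t. (u t \<bullet> m) / k)"
  have frame: "N \<bullet> u t = 0" "N \<bullet> e = 0" "N \<bullet> N = k" "m \<bullet> v t = sqrt (e \<bullet> u t) * k" if t: "t \<in> J" for t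
  proof -
    have uu: "u t \<bullet> u t = 1" using g t by (auto simp: geo_def)
    have uv: "u t \<bullet> v t = 0" using geo_velocity[OF g J(1) t] .
    have z: "0 < e \<bullet> u t" by (rule pos[OF t])
    show "N \<bullet> u t = 0" "N \<bullet> e = 0"
      unfolding N[OF t, symmetric] using l[OF t] by (simp_all add: dot_cross_self inner_commute)
    have c: "(u t \<otimes> v t) \<bullet> (u t \<otimes> v t) = v t \<bullet> v t"
      using norm_cross_dot[of "u t" "v t"] uu uv by (simp add: power_mult_distrib power2_norm_eq_inner)
    show "N \<bullet> N = k" unfolding N[OF t, symmetric] using c k(1)[OF t] z by (simp flip: mult.assoc)
    have "((u t \<otimes> v t) \<otimes> e) \<bullet> v t = (e \<bullet> u t) * (v t \<bullet> v t) - (u t \<bullet> v t) * (e \<bullet> v t)"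
      by (simp add: cross3_def inner_vec_def sum_3 algebra_simps)
    then show "m \<bullet> v t = sqrt (e \<bullet> u t) * k"
      unfolding m_def N[OF t, symmetric] by (simp add: cross_mult_left uv k(1)[OF t])
  qed
  have "u t = (e \<bullet> u t) *\<^sub>R e + y t *\<^sub>R m" if t: "t \<in> J" for t
  proof -
    note fr = frame[OF t]
    have mm: "m \<bullet> m = k"
      using norm_cross_dot[of N e] fr e by (simp add: m_def power_mult_distrib power2_norm_eq_inner)
    define r where "r = u t - (e \<bullet> u t) *\<^sub>R e - y t *\<^sub>R m"
    have "m \<bullet> e = 0" "e \<bullet> m = 0" "m \<bullet> N = 0" "N \<bullet> m = 0" by (simp_all add: m_def dot_cross_self)
    then have r: "r \<bullet> e = 0" "r \<bullet> N = 0" "r \<bullet> m = 0"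
      using fr e mm k(2) by (simp_all add: r_def inner_diff_left inner_diff_right y_def inner_commute)
    have "r \<otimes> (N \<otimes> e) = (r \<bullet> e) *\<^sub>R N - (r \<bullet> N) *\<^sub>R e"
      by (simp add: cross3_def inner_vec_def sum_3 vec_eq_iff forall_3 algebra_simps)
    then have "norm r * norm m = 0"
      using norm_cross_dot[of r m] r by (simp add: m_def)
    then have "r = 0" using mm k(2) by auto
    then show ?thesis by (simp add: r_def algebra_simps)
  qed
  moreover have "(y has_real_derivative sqrt (e \<bullet> u t)) (at t)" if t: "t \<in> J" for t
  proof -
    have u': "(u has_vector_derivative v t) (at t)" using g t by (auto simp: geo_def)
    have "((\<lambda>t. (m \<bullet> u t) / k) has_real_derivative (m \<bullet> v t) / k) (at t)"
      by (intro DERIV_cdivide has_real_derivative_inner_const u')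
    then show ?thesis using frame(4)[OF t] k(2) by (simp add: y_def inner_commute)
  qed
  ultimately show thesis by (rule that)
qed

text \<open>Both \<open>z\<^sup>2\<close>, where \<open>z = e \<bullet> u\<close>, and the coordinate of \<open>radial_geo_plane\<close> have bounded
  derivatives, so they converge at the end, and so does \<open>u\<close>. The limit lies on the equator since
  otherwise the geodesic could be extended. The speed is infinite there by conservation of energy.\<close>

lemma radial_geo_endpoint:
  assumes g: "geo e J u v" and J: "open J" "is_interval J" and e: "e \<bullet> e = 1"
    and pos: "\<And>t. t \<in> J \<Longrightarrow> 0 < e \<bullet> u t" and inext: "inextendible e J u"
    and k: "\<And>t. t \<in> J \<Longrightarrow> (e \<bullet> u t) * (v t \<bullet> v t) = k" "k > 0"
    and l: "\<And>t. t \<in> J \<Longrightarrow> (e \<bullet> u t) * (e \<bullet> (u t \<otimes> v t)) = 0"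
    and a: "a \<in> J" "a < c" "{a..<c} \<subseteq> J" "J \<subseteq> {..<c}"
  shows "(\<exists>u1. (u \<longlongrightarrow> u1) (at_left c) \<and> u1 \<bullet> u1 = 1 \<and> e \<bullet> u1 = 0) \<and> filterlim (\<lambda>t. norm (v t)) at_top (at_left c)"
proof -
  have sub: "t \<in> J" if "t \<in> {a..<c}" for t using a that by auto
  have l0: "e \<bullet> (u t \<otimes> v t) = 0" if "t \<in> J" for t using l[OF that] pos[OF that] by simp
  obtain m y where my: "\<And>t. t \<in> J \<Longrightarrow> u t = (e \<bullet> u t) *\<^sub>R e + y t *\<^sub>R m"
    and y': "\<And>t. t \<in> J \<Longrightarrow> (y has_real_derivative sqrt (e \<bullet> u t)) (at t)"
    using radial_geo_plane[OF g J e pos k l0] by metis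
  have sys: "height_system k 0 J (\<lambda>t. e \<bullet> u t) (\<lambda>t. (e \<bullet> u t) * (e \<bullet> v t))"
    using geo_height_system[OF g J(1) e pos k(1) l] by simp
  have z1: "e \<bullet> u t \<le> 1" if "t \<in> J" for t using height_le_1[OF sys k(2) _ that] by simp
  have nt: "at_left c \<noteq> (bot :: real filter)" by simp
  have ev: "\<forall>\<^sub>F t in at_left c. t \<in> {a..<c}"
    unfolding eventually_at_left_field using a(2) by (intro exI[of _ a]) auto
  obtain Y where Y: "(y \<longlongrightarrow> Y) (at_left c)"
    by (rule bounded_derivative_left_limit[OF a(2), of y "\<lambda>t. sqrt (e \<bullet> u t)" 1])
       (use y' sub z1 pos in \<open>auto simp: has_real_derivative_iff_has_vector_derivative less_imp_le\<close>)
  obtain Z where Z: "((\<lambda>t. (e \<bullet> u t)\<^sup>2) \<longlongrightarrow> Z) (at_left c)"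
  proof (rule bounded_derivative_left_limit[OF a(2), of "\<lambda>t. (e \<bullet> u t)\<^sup>2" "\<lambda>t. 2 * ((e \<bullet> u t) * (e \<bullet> v t))" "2 * (k + 1)"])
    fix t assume "t \<in> {a..<c}"
    then have t: "t \<in> J" by (rule sub)
    have u': "(u has_vector_derivative v t) (at t)" using g t by (auto simp: geo_def)
    show "((\<lambda>t. (e \<bullet> u t)\<^sup>2) has_vector_derivative 2 * ((e \<bullet> u t) * (e \<bullet> v t))) (at t)"
      unfolding has_real_derivative_iff_has_vector_derivative[symmetric]
      using has_real_derivative_inner_const[OF u', of e] by (auto intro!: derivative_eq_intros)
    have "((e \<bullet> u t) * (e \<bullet> v t))\<^sup>2 = k * (e \<bullet> u t) * (1 - (e \<bullet> u t)\<^sup>2)"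
      using sys t by (auto simp: height_system_def)
    also have "\<dots> \<le> k * 1 * 1"
      using k(2) pos[OF t] z1[OF t] by (intro mult_mono) (auto simp: power_le_one)
    also have "\<dots> \<le> (k + 1)\<^sup>2" using k(2) by (simp add: power2_eq_square algebra_simps)
    finally have "\<bar>(e \<bullet> u t) * (e \<bullet> v t)\<bar> \<le> k + 1" 
      using k(2) abs_le_square_iff[of "(e \<bullet> u t) * (e \<bullet> v t)" "k + 1"] by simp
    then show "norm (2 * ((e \<bullet> u t) * (e \<bullet> v t))) \<le> 2 * (k + 1)" by (simp add: abs_mult)
  qed blast
  have z0: "((\<lambda>t. e \<bullet> u t) \<longlongrightarrow> sqrt Z) (at_left c)"
    by (rule Lim_transform_eventually[OF tendsto_real_sqrt[OF Z]])
       (use ev in eventually_elim, use pos sub in \<open>auto simp: less_imp_le\<close>)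
  have "sqrt Z = 0"
  proof (rule ccontr)
    assume "sqrt Z \<noteq> 0"
    moreover have "sqrt Z \<ge> 0"
      by (rule tendsto_lowerbound[OF z0 _ nt]) (use ev in eventually_elim, use pos sub in \<open>auto simp: less_imp_le\<close>)
    ultimately have s: "sqrt Z > 0" by simp
    have "\<forall>\<^sub>F t in at_left c. e \<bullet> u t > sqrt Z / 2"
      using order_tendstoD(1)[OF z0, of "sqrt Z / 2"] s by simp
    then obtain a0 where a0: "a0 < c" "\<And>t. a0 < t \<Longrightarrow> t < c \<Longrightarrow> e \<bullet> u t > sqrt Z / 2"
      unfolding eventually_at_left_field by blast
    define a' where "a' = (max a a0 + c) / 2"
    have a': "a' \<in> {a..<c}" "a0 < a'" using a(2) a0(1) by (auto simp: a'_def)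
    have "a' \<in> J" "a' < c" "{a'..<c} \<subseteq> J" using a' sub by auto
    from inextendible_approaches_equator[OF g J inext this a(4), of "sqrt Z / 2"] s
    obtain t where "t \<in> {a'..<c}" "\<bar>e \<bullet> u t\<bar> < sqrt Z / 2" by auto
    with a0(2)[of t] a' show False by auto
  qed
  then have zlim: "((\<lambda>t. e \<bullet> u t) \<longlongrightarrow> 0) (at_left c)" using z0 by simp
  have ulim: "(u \<longlongrightarrow> 0 *\<^sub>R e + Y *\<^sub>R m) (at_left c)"
  proof (rule Lim_transform_eventually)
    show "((\<lambda>t. (e \<bullet> u t) *\<^sub>R e + y t *\<^sub>R m) \<longlongrightarrow> 0 *\<^sub>R e + Y *\<^sub>R m) (at_left c)"
      by (intro tendsto_add tendsto_scaleR zlim Y tendsto_const)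
    show "\<forall>\<^sub>F t in at_left c. (e \<bullet> u t) *\<^sub>R e + y t *\<^sub>R m = u t"
      using ev
    proof eventually_elim
      case (elim t)
      show ?case using my[OF sub[OF elim]] by (rule sym)
    qed
  qed
  define u1 where "u1 = 0 *\<^sub>R e + Y *\<^sub>R m"
  have uu: "u1 \<bullet> u1 = 1"
  proof (rule tendsto_unique[OF nt])
    show "((\<lambda>t. u t \<bullet> u t) \<longlongrightarrow> u1 \<bullet> u1) (at_left c)" by (intro tendsto_intros ulim[folded u1_def])
    show "((\<lambda>t. u t \<bullet> u t) \<longlongrightarrow> 1) (at_left c)"
      by (rule tendsto_eventually) (use ev in eventually_elim, use g sub in \<open>auto simp: geo_def\<close>)
  qed
  have eu: "e \<bullet> u1 = 0"
    by (rule tendsto_unique[OF nt _ zlim]) (intro tendsto_intros ulim[folded u1_def])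
  have "filterlim (\<lambda>t. inverse (e \<bullet> u t)) at_top (at_left c)"
    by (rule filterlim_inverse_at_top[OF zlim]) (use ev in eventually_elim, use pos sub in auto)
  then have "filterlim (\<lambda>t. k * inverse (e \<bullet> u t)) at_top (at_left c)"
    by (rule filterlim_tendsto_pos_mult_at_top[OF tendsto_const k(2)])
  then have "filterlim (\<lambda>t. sqrt (k * inverse (e \<bullet> u t))) at_top (at_left c)"
    by (rule filterlim_compose[OF sqrt_at_top])
  moreover have "\<forall>\<^sub>F t in at_left c. sqrt (k * inverse (e \<bullet> u t)) = norm (v t)"
    using ev
  proof eventually_elim
    case (elim t)
    have "v t \<bullet> v t = k * inverse (e \<bullet> u t)"
      using k(1)[OF sub[OF elim]] pos[OF sub[OF elim]] by (auto simp: field_simps)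
    then show ?case by (metis norm_eq_sqrt_inner)
  qed
  then have "filterlim (\<lambda>t. sqrt (k * inverse (e \<bullet> u t))) at_top (at_left c)
      \<longleftrightarrow> filterlim (\<lambda>t. norm (v t)) at_top (at_left c)"
    by (rule filterlim_cong[OF refl refl])
  ultimately have "filterlim (\<lambda>t. norm (v t)) at_top (at_left c)" by blast
  then show ?thesis using ulim uu eu unfolding u1_def by blast
qed

lemma open_interval_right_end:
  fixes J :: "real set"
  assumes "open J" "is_interval J" "a \<in> J"
  obtains "{a..} \<subseteq> J" | c where "a < c" "{a..<c} \<subseteq> J" "J \<subseteq> {..<c}"
proof (cases "bdd_above J")
  case True
  define c where "c = Sup J"
  have le: "t \<le> c" if "t \<in> J" for t unfolding c_def using True that by (simp add: cSup_upper)
  have lt: "t < c" if t: "t \<in> J" for t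
  proof -
    obtain \<epsilon> where \<epsilon>: "\<epsilon> > 0" "ball t \<epsilon> \<subseteq> J" using assms(1) t open_contains_ball by blast
    have "t + \<epsilon> / 2 \<in> ball t \<epsilon>" using \<epsilon>(1) by (simp add: dist_real_def)
    then have "t + \<epsilon> / 2 \<le> c" using \<epsilon>(2) le by blast
    then show ?thesis using \<epsilon>(1) by simp
  qed
  have "t \<in> J" if t: "t \<in> {a..<c}" for t
  proof -
    obtain b where "b \<in> J" "t < b" using t assms(3) less_cSup_iff[of J t] True unfolding c_def by auto
    then show ?thesis using assms(2,3) t unfolding is_interval_1 by (meson atLeastLessThan_iff less_imp_le)
  qed
  then show thesis using that(2)[of c] lt assms(3) by blast
next
  case False
  have "t \<in> J" if t: "t \<ge> a" for t
  proof -
    obtain b where "b \<in> J" "t \<le> b" using False by (meson bdd_above_def linear)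
    then show ?thesis using assms(2,3) t unfolding is_interval_1 by blast
  qed
  then show thesis using that(1) by auto
qed

definition ends_on_equator :: "vec3 \<Rightarrow> (real \<Rightarrow> vec3) \<Rightarrow> (real \<Rightarrow> vec3) \<Rightarrow> real filter \<Rightarrow> bool" where
  "ends_on_equator e u v F \<longleftrightarrow>
     (\<exists>u1. (u \<longlongrightarrow> u1) F \<and> u1 \<bullet> u1 = 1 \<and> e \<bullet> u1 = 0) \<and> filterlim (\<lambda>t. norm (v t)) at_top F"

text \<open>With angular momentum \<open>l\<close>, the inequality \<open>k z (1 - z\<^sup>2) \<ge> l\<^sup>2\<close> keeps the height \<open>z\<close> above
  \<open>l\<^sup>2 / k\<close>, and a geodesic that stays away from the equator can be extended.\<close>

lemma geo_right_end:
  assumes g: "geo e J u v" and J: "open J" "is_interval J" and e: "e \<bullet> e = 1"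
    and pos: "\<And>t. t \<in> J \<Longrightarrow> 0 < e \<bullet> u t" and inext: "inextendible e J u"
    and k: "\<And>t. t \<in> J \<Longrightarrow> (e \<bullet> u t) * (v t \<bullet> v t) = k" "k > 0"
    and l: "\<And>t. t \<in> J \<Longrightarrow> (e \<bullet> u t) * (e \<bullet> (u t \<otimes> v t)) = l"
    and a: "a \<in> J"
  shows "l \<noteq> 0 \<Longrightarrow> {a..} \<subseteq> J"
    and "l = 0 \<Longrightarrow> \<exists>c>a. {a..<c} \<subseteq> J \<and> J \<subseteq> {..<c} \<and> ends_on_equator e u v (at_left c)"
proof -
  have sys: "height_system k (l\<^sup>2) J (\<lambda>t. e \<bullet> u t) (\<lambda>t. (e \<bullet> u t) * (e \<bullet> v t))"
    by (rule geo_height_system[OF g J(1) e pos k(1) l])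
  show "{a..} \<subseteq> J" if l0: "l \<noteq> 0"
  proof (rule open_interval_right_end[OF J a])
    fix c assume c: "a < c" "{a..<c} \<subseteq> J" "J \<subseteq> {..<c}"
    have low: "e \<bullet> u t \<ge> l\<^sup>2 / k" if t: "t \<in> J" for t
    proof -
      have h: "0 < e \<bullet> u t" "((e \<bullet> u t) * (e \<bullet> v t))\<^sup>2 = k * (e \<bullet> u t) * (1 - (e \<bullet> u t)\<^sup>2) - l\<^sup>2"
        using sys t by (auto simp: height_system_def)
      then have "l\<^sup>2 \<le> k * (e \<bullet> u t) * (1 - (e \<bullet> u t)\<^sup>2)"
        using zero_le_power2[of "(e \<bullet> u t) * (e \<bullet> v t)"] by linarith
      also have "\<dots> \<le> k * (e \<bullet> u t) * 1" using h(1) k(2) by (intro mult_left_mono) auto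
      finally show ?thesis using k(2) by (simp add: divide_le_eq mult.commute)
    qed
    have "\<exists>t\<in>{a..<c}. \<bar>e \<bullet> u t\<bar> < l\<^sup>2 / k"
      by (rule inextendible_approaches_equator[OF g J inext a c]) (use l0 k(2) in simp)
    then obtain t where "t \<in> {a..<c}" "\<bar>e \<bullet> u t\<bar> < l\<^sup>2 / k" by blast
    then show "{a..} \<subseteq> J" using low[of t] c(2) by auto
  qed
  show "\<exists>c>a. {a..<c} \<subseteq> J \<and> J \<subseteq> {..<c} \<and> ends_on_equator e u v (at_left c)" if l0: "l = 0"
  proof (rule open_interval_right_end[OF J a])
    assume "{a..} \<subseteq> J"
    then have "{a<..} \<subseteq> J" by auto
    then have False using height_system_no_momentum[of k J _ _ a] sys l0 k(2) by auto
    then show ?thesis ..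
  next
    fix c assume c: "a < c" "{a..<c} \<subseteq> J" "J \<subseteq> {..<c}"
    then have "ends_on_equator e u v (at_left c)" unfolding ends_on_equator_def
      using radial_geo_endpoint[OF g J e pos inext k l[unfolded l0] a c] by blast
    then show ?thesis using c by blast
  qed
qed

theorem geo_dichotomy:
  assumes g: "geo e J u v" and J: "open J" "is_interval J" and e: "e \<bullet> e = 1"
    and pos: "\<And>t. t \<in> J \<Longrightarrow> 0 < e \<bullet> u t" and inext: "inextendible e J u"
    and k: "\<And>t. t \<in> J \<Longrightarrow> (e \<bullet> u t) * (v t \<bullet> v t) = k" "k > 0"
    and l: "\<And>t. t \<in> J \<Longrightarrow> (e \<bullet> u t) * (e \<bullet> (u t \<otimes> v t)) = l"
    and a: "a \<in> J"
  shows "l \<noteq> 0 \<Longrightarrow> J = UNIV \<and> (\<exists>z1 z2. 0 < z1 \<and> z2 < 1 \<and> (\<forall>t. e \<bullet> u t \<in> {z1..z2}) \<and>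
      (\<forall>R\<in>{z1, z2}. \<forall>T. (\<exists>t>T. e \<bullet> u t = R) \<and> (\<exists>t<T. e \<bullet> u t = R)))"
    and "l = 0 \<Longrightarrow> \<exists>t0 t1. t0 < t1 \<and> J = {t0<..<t1} \<and>
      ends_on_equator e u v (at_right t0) \<and> ends_on_equator e u v (at_left t1)"
proof -
  define u' v' where "u' = (\<lambda>t. u (- t))" and "v' = (\<lambda>t. - v (- t))"
  have g': "geo e (uminus ` J) u' v'" unfolding u'_def v'_def by (rule geo_reverse[OF g])
  have J': "open (uminus ` J)" "is_interval (uminus ` J)"
    using J by (simp_all add: open_uminus_image)
  have pos': "0 < e \<bullet> u' t" if "t \<in> uminus ` J" for t using that pos by (auto simp: u'_def)
  have inext': "inextendible e (uminus ` J) u'" unfolding u'_def by (rule inextendible_reverse[OF inext])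
  have k': "(e \<bullet> u' t) * (v' t \<bullet> v' t) = k" if "t \<in> uminus ` J" for t using that k(1) by (auto simp: u'_def v'_def)
  have l': "(e \<bullet> u' t) * (e \<bullet> (u' t \<otimes> v' t)) = - l" if "t \<in> uminus ` J" for t
    using that l by (auto simp: u'_def v'_def)
  have a': "- a \<in> uminus ` J" using a by simp
  have right: "l \<noteq> 0 \<Longrightarrow> {a..} \<subseteq> J"
    "l = 0 \<Longrightarrow> \<exists>c>a. {a..<c} \<subseteq> J \<and> J \<subseteq> {..<c} \<and> ends_on_equator e u v (at_left c)"
    using geo_right_end[OF g J e pos inext k l a] by blast+
  have left: "l \<noteq> 0 \<Longrightarrow> {- a..} \<subseteq> uminus ` J"
    "l = 0 \<Longrightarrow> \<exists>c>- a. {- a..<c} \<subseteq> uminus ` J \<and> uminus ` J \<subseteq> {..<c} \<and> ends_on_equator e u' v' (at_left c)"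
    using geo_right_end[OF g' J' e pos' inext' k' k(2) l' a'] by simp_all
  show "J = UNIV \<and> (\<exists>z1 z2. 0 < z1 \<and> z2 < 1 \<and> (\<forall>t. e \<bullet> u t \<in> {z1..z2}) \<and>
      (\<forall>R\<in>{z1, z2}. \<forall>T. (\<exists>t>T. e \<bullet> u t = R) \<and> (\<exists>t<T. e \<bullet> u t = R)))" if l0: "l \<noteq> 0"
  proof
    have r: "{a..} \<subseteq> J" and lft: "{- a..} \<subseteq> uminus ` J" using right(1) left(1) l0 by auto
    have "t \<in> J" for t
    proof (cases "t \<ge> a")
      case False
      then have "- t \<in> uminus ` J" using lft by auto
      then show ?thesis by auto
    qed (use r in auto)
    then show "J = UNIV" by auto
    then have "height_system k (l\<^sup>2) UNIV (\<lambda>t. e \<bullet> u t) (\<lambda>t. (e \<bullet> u t) * (e \<bullet> v t))"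
      using geo_height_system[OF g J(1) e pos k(1) l] by simp
    from height_system_oscillates[OF this k(2)] l0
    obtain z1 z2 where "0 < z1" "z2 < 1" "\<And>t. z1 \<le> e \<bullet> u t" "\<And>t. e \<bullet> u t \<le> z2"
      "\<And>R T. R \<in> {z1, z2} \<Longrightarrow> (\<exists>t>T. e \<bullet> u t = R) \<and> (\<exists>t<T. e \<bullet> u t = R)"
      by (metis zero_less_power2)
    then show "\<exists>z1 z2. 0 < z1 \<and> z2 < 1 \<and> (\<forall>t. e \<bullet> u t \<in> {z1..z2}) \<and>
      (\<forall>R\<in>{z1, z2}. \<forall>T. (\<exists>t>T. e \<bullet> u t = R) \<and> (\<exists>t<T. e \<bullet> u t = R))"
      by (intro exI[of _ z1] exI[of _ z2]) auto
  qed
  show "\<exists>t0 t1. t0 < t1 \<and> J = {t0<..<t1} \<and>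
      ends_on_equator e u v (at_right t0) \<and> ends_on_equator e u v (at_left t1)" if l0: "l = 0"
  proof -
    obtain c where c: "a < c" "{a..<c} \<subseteq> J" "J \<subseteq> {..<c}" "ends_on_equator e u v (at_left c)"
      using right(2)[OF l0] by blast
    obtain d where d: "- a < d" "{- a..<d} \<subseteq> uminus ` J" "uminus ` J \<subseteq> {..<d}" "ends_on_equator e u' v' (at_left d)"
      using left(2) l0 by auto
    have "J = {- d<..<c}"
    proof (intro equalityI subsetI)
      fix t assume t: "t \<in> J"
      then have "- t \<in> uminus ` J" by simp
      then show "t \<in> {- d<..<c}" using c(3) d(3) t by fastforce
    next
      fix t assume t: "t \<in> {- d<..<c}"
      show "t \<in> J"
      proof (cases "t \<ge> a")
        case False
        then have "- t \<in> uminus ` J" using d(2) t by auto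
        then show ?thesis by auto
      qed (use c(2) t in auto)
    qed
    moreover have "ends_on_equator e u v (at_right (- d))"
    proof -
      have "((\<lambda>t. u (- t)) \<longlongrightarrow> u1) (at_left d) \<Longrightarrow> (u \<longlongrightarrow> u1) (at_right (- d))" for u1
        by (simp add: at_right_minus filterlim_filtermap)
      moreover have "filterlim (\<lambda>t. norm (v (- t))) at_top (at_left d) \<Longrightarrow> filterlim (\<lambda>t. norm (v t)) at_top (at_right (- d))"
        by (simp add: at_right_minus filterlim_filtermap)
      ultimately show ?thesis using d(4) unfolding ends_on_equator_def u'_def v'_def by auto
    qed
    ultimately show ?thesis using c d by (intro exI[of _ "- d"] exI[of _ c]) auto
  qed
qed

section \<open>The normal form\<close>

lemma pole_North_South: "pole_pt North = - pole_pt South"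
  by (simp add: pole_pt.simps vec_eq_iff forall_3)

text \<open>In space, the angular momentum of the normal form is a quarter of the one about the north pole, for the
  height as conformal factor.\<close>

lemma angular_momentum_eq:
  "angular_momentum x X = of_real ((pole_pt North \<bullet> dir_param South x) *
     (pole_pt North \<bullet> (dir_param South x \<otimes> dparam South x X)) / 4)"
proof -
  let ?n = "pole_pt North"
  have 1: "?n \<bullet> dir_param South x = (2 - sq1 x) / sq1 x"
    unfolding pole_North_South using dir_param_inner_pole[of South x]
    by (simp add: inner_commute diff_divide_distrib)
  have "quad South ?n x = - 2 * x"
    by (simp add: quad_def pole_North_South)
  then have "?n \<otimes> dir_param South x = dparam South x (\<i> * x)"
    using dparam_rotation[of South x ?n] by simp
  moreover have "?n \<bullet> (dir_param South x \<otimes> dparam South x X) = (?n \<otimes> dir_param South x) \<bullet> dparam South x X"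
    by (simp add: cross3_def inner_vec_def sum_3 algebra_simps)
  ultimately have 2: "?n \<bullet> (dir_param South x \<otimes> dparam South x X) = 4 / (sq1 x)\<^sup>2 * Im (cnj x * X)"
    by (simp add: dparam_inner_dparam inner_complex_def)
  have 3: "cnj x * X - x * cnj X = 2 * \<i> * of_real (Im (cnj x * X))"
    by (simp add: complex_eq_iff)
  have 4: "1 + x * cnj x = of_real (sq1 x)" "1 - x * cnj x = of_real (2 - sq1 x)"
    by (simp_all add: complex_eq_iff sq1_def inner_complex_def)
  show ?thesis
    unfolding angular_momentum_def 1 2 3 4
    by (simp add: power2_eq_square power3_eq_cube field_simps)
qed

text \<open>In the chart \<^const>\<open>South\<close> the height \<open>h\<close> over the equator is \<open>(1 - R\<^sup>2) / (1 + R\<^sup>2)\<close>, where \<open>R\<close> is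
  the absolute value of the coordinate.\<close>

definition radius_of_height :: "real \<Rightarrow> real" where
  "radius_of_height h = sqrt ((1 - h) / (1 + h))"

lemma cmod_dir_coord_South:
  assumes "u \<in> S2" "u \<noteq> pole_pt South"
  shows "cmod (dir_coord South u) = radius_of_height (pole_pt North \<bullet> u)"
proof -
  define x where "x = dir_coord South u"
  have u: "u = dir_param South x" using dir_param_coord assms x_def by simp
  have D: "(cmod x)\<^sup>2 = sq1 x - 1" by (simp add: sq1_cmod)
  have "pole_pt North \<bullet> u = 2 / sq1 x - 1"
    unfolding u pole_North_South using dir_param_inner_pole[of South x] by (simp add: inner_commute)
  then have h: "1 + pole_pt North \<bullet> u = 2 / sq1 x" "1 - pole_pt North \<bullet> u = 2 - 2 / sq1 x" by simp_all
  have "(1 - pole_pt North \<bullet> u) / (1 + pole_pt North \<bullet> u) = (cmod x)\<^sup>2"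
    unfolding h D by (simp add: field_simps)
  then show ?thesis unfolding radius_of_height_def x_def[symmetric] by simp
qed

lemma radius_of_height_mono:
  assumes "-1 < h" "h \<le> h'" "h' < 1"
  shows "radius_of_height h' \<le> radius_of_height h"
  unfolding radius_of_height_def using assms by (intro real_sqrt_le_mono frac_le) auto

lemma radius_of_height_1: "0 < h \<Longrightarrow> h < 1 \<Longrightarrow> radius_of_height h < 1" "-1 < h \<Longrightarrow> h < 0 \<Longrightarrow> 1 < radius_of_height h"
  by (auto simp: radius_of_height_def divide_less_eq less_divide_eq)

lemma dparam_norm: "norm (dparam P x X) = 2 / sq1 x * cmod X"
proof -
  have "(norm (dparam P x X))\<^sup>2 = (2 / sq1 x * cmod X)\<^sup>2"
    using dparam_inner_dparam[of P x X X] by (simp add: dot_square_norm power_mult_distrib power_divide)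
  then show ?thesis by (simp add: less_imp_le)
qed

context hsphere
begin

text \<open>A motion rotates \<open>w\<close>, and its translation part only changes \<open>b\<close>. So the normal form is reached by
  turning \<open>w\<close> to the north pole and shifting \<open>b\<close> to the origin.\<close>

lemma euclidean_act_hsec:
  assumes A: "orthogonal_matrix A" "det A = 1"
  shows "euclidean_act A d (hsec b w u) = hsec (A *v b + d) (A *v w) (A *v u)"
proof -
  have cr: "(A *v w) \<otimes> (A *v u) = A *v (w \<otimes> u)"
    using A by (intro cross_rotation_matrix) (simp add: rotation_matrix_def)
  have ot: "orthogonal_transformation (\<lambda>x. A *v x)" using A by (simp add: orthogonal_transformation_matrix matrix_vector_mul_linear)
  then have "(A *v b) \<bullet> (A *v u) = b \<bullet> u" by (simp add: orthogonal_transformation_def)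
  then show ?thesis
    unfolding hsec_def euclidean_act_def cr
    by (simp add: matrix_vector_right_distrib matrix_vector_mult_diff_distrib matrix_vector_mult_scaleR
        inner_add_left scaleR_add_left algebra_simps)
qed

lemma normalises_axis:
  assumes N: "normalises A d c s"
  shows "A *v w = c *\<^sub>R pole_pt North"
proof -
  have A: "orthogonal_matrix A" "det A = 1" using N by (auto simp: normalises_def)
  have ot: "orthogonal_transformation (\<lambda>x. A *v x)" using A by (simp add: orthogonal_transformation_matrix matrix_vector_mul_linear)
  define b' w' where "b' = A *v b + d" and "w' = A *v w"
  have eq: "quad South b' x / 2 - (\<i> / 2) * quad South w' x = of_real c * \<i> * x" for x
  proof -
    define u where "u = transpose A *v dir_param South x"
    have Au: "A *v u = dir_param South x"
      unfolding u_def matrix_vector_mul_assoc using A(1) by (simp add: orthogonal_matrix_def)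
    have "u \<bullet> u = 1" using ot norm_dir_param[of South x] unfolding orthogonal_transformation_def Au[symmetric] by metis
    then have uS: "u \<in> S2" by (simp add: S2_iff)
    have act: "euclidean_act A d (s u) = hsec b' w' (dir_param South x)"
      unfolding s[OF uS] euclidean_act_hsec[OF A] Au b'_def w'_def ..
    then have "hsec b' w' (dir_param South x) \<in> euclidean_act A d ` surf s"
      unfolding surf_def using uS by (metis image_eqI)
    moreover have fst: "fst (hsec b' w' (dir_param South x)) = dir_param South x" by (simp add: hsec_def)
    ultimately have "fibre_coord South (hsec b' w' (dir_param South x))
        = of_real c * \<i> * dir_coord South (dir_param South x)"
      using N dir_param_not_pole unfolding normalises_def by metis
    then have "fibre_coord South (hsec b' w' (dir_param South x)) = of_real c * \<i> * x" by simp
    then show ?thesis unfolding fibre_coord_hsec .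
  qed
  \<comment> \<open>Two quadratic polynomials agree; three values suffice to compare them.\<close>
  define \<omega> where "\<omega> = coemb South w'"
  note eqs = eq[of 0] eq[of 1] eq[of "-1"]
  have "Re \<omega> = 0" "Im \<omega> = 0" "w' \<bullet> pole_pt South = - c"
    using eqs by (simp_all add: quad_def complex_eq_iff \<omega>_def)
  then have "\<omega> = 0" "w' \<bullet> pole_pt South = - c" by (simp_all add: complex_eq_iff)
  moreover have "w' = (w' \<bullet> pole_pt South) *\<^sub>R pole_pt South"
    using emb_coemb[of South w'] \<open>\<omega> = 0\<close> by (simp add: \<omega>_def)
  ultimately have "w' = - c *\<^sub>R pole_pt South" by metis
  then show ?thesis by (simp add: w'_def pole_North_South)
qed

lemma ex_normalises: assumes "w \<noteq> 0" shows "\<exists>A d c. c > 0 \<and> normalises A d c s"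
proof -
  have nn: "norm (pole_pt North) = 1" using pole_inner_pole[of North] by (simp add: norm_eq_1)
  obtain f where f: "orthogonal_transformation f" "det (matrix f) = 1" "f w = norm w *\<^sub>R pole_pt North"
    by (rule rotation_exists[of w "norm w *\<^sub>R pole_pt North"]) (auto simp: nn)
  define A where "A = matrix f"
  have Av: "A *v x = f x" for x
    using f(1) by (simp add: A_def matrix_works orthogonal_transformation_linear)
  have A: "orthogonal_matrix A" "det A = 1"
    using f(1,2) orthogonal_transformation_matrix by (auto simp: A_def)
  have "normalises A (- (A *v b)) (norm w) s"
    unfolding normalises_def
  proof (intro conjI ballI impI A)
    fix l assume "l \<in> euclidean_act A (- (A *v b)) ` surf s" and l: "fst l \<noteq> pole_pt South"
    then obtain u where u: "u \<in> S2" "l = hsec 0 (A *v w) (A *v u)"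
      unfolding surf_def by (auto simp: s euclidean_act_hsec[OF A])
    have "f u \<bullet> f u = u \<bullet> u" using f(1) by (simp add: orthogonal_transformation_def)
    then have "A *v u \<in> S2" using u(1) by (simp add: S2_iff Av)
    then have "A *v u = dir_param South (dir_coord South (A *v u))"
      using l u by (simp add: hsec_def dir_param_coord)
    then have "fibre_coord South l = quad South 0 (dir_coord South (A *v u)) / 2
        - (\<i> / 2) * quad South (A *v w) (dir_coord South (A *v u))"
      unfolding u(2) using fibre_coord_hsec by metis
    also have "\<dots> = of_real (norm w) * \<i> * dir_coord South (fst l)"
      unfolding Av f(3) u(2) by (simp add: quad_def hsec_def pole_North_South)
    finally show "fibre_coord South l = of_real (norm w) * \<i> * dir_coord South (fst l)" .
  qed simp
  then show ?thesis using assms by (intro exI[of _ A] exI[of _ "- (A *v b)"] exI[of _ "norm w"]) simp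
qed

lemma maximal_geodesic_inextendible:
  assumes max: "maximal_geodesic s J \<gamma>" and \<gamma>: "\<And>t. t \<in> J \<Longrightarrow> \<gamma> t = s (fst (\<gamma> t))"
  shows "inextendible w J (\<lambda>t. fst (\<gamma> t))"
  unfolding inextendible_def
proof (intro allI impI)
  fix J' u' v'
  assume *: "open J' \<and> is_interval J' \<and> J \<subseteq> J' \<and> geo w J' u' v' \<and> (\<forall>t\<in>J. u' t = fst (\<gamma> t))"
  have geod: "geodesic s J \<gamma>" and ext: "\<And>J' \<gamma>'. geodesic s J' \<gamma>' \<Longrightarrow> J \<subseteq> J' \<Longrightarrow> (\<And>t. t \<in> J \<Longrightarrow> \<gamma>' t = \<gamma> t) \<Longrightarrow> J' = J"
    using max unfolding maximal_geodesic_def by blast+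
  have "\<not> u' constant_on J'"
  proof
    assume "u' constant_on J'"
    then obtain y where "\<And>t. t \<in> J' \<Longrightarrow> u' t = y" unfolding constant_on_def by blast
    then have "fst (\<gamma> t) = y" if "t \<in> J" for t using that * by force
    then have "\<gamma> t = s y" if "t \<in> J" for t using that \<gamma>[OF that] by simp
    then show False using geod unfolding geodesic_def constant_on_def by blast
  qed
  then have "geodesic s J' (\<lambda>t. s (u' t))"
    using * by (intro geo_imp_geodesic[of J' u' v']) auto
  then show "J' = J"
  proof (rule ext)
    show "s (u' t) = \<gamma> t" if "t \<in> J" for t using * \<gamma>[OF that] that by metis
  qed (use * in blast)
qed

text \<open>The results on the unit sphere are translated to the coordinate of the normal form. The two discs are
  treated at once by using the normal of the equator that points into the hemisphere of the
  geodesic.\<close>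

theorem maximal_geodesic_behaviour:
  assumes N: "normalises A d c s" and w0: "w \<noteq> 0" and max: "maximal_geodesic s J \<gamma>"
  shows "\<exists>\<mu>. has_angular_momentum A d J \<gamma> \<mu> \<and>
    (\<mu> = 0 \<longrightarrow> reaches_circle_in_finite_time A d s J \<gamma>) \<and> (\<mu> \<noteq> 0 \<longrightarrow> oscillates A d J \<gamma>)"
proof -
  have A: "orthogonal_matrix A" "det A = 1" and c0: "c \<ge> 0" using N by (auto simp: normalises_def)
  have ot: "orthogonal_transformation (\<lambda>x. A *v x)" using A by (simp add: orthogonal_transformation_matrix matrix_vector_mul_linear)
  have Ai: "(A *v x) \<bullet> (A *v y) = x \<bullet> y" for x y using ot by (simp add: orthogonal_transformation_def)
  have cr: "(A *v x) \<otimes> (A *v y) = A *v (x \<otimes> y)" for x y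
    using A by (intro cross_rotation_matrix) (simp add: rotation_matrix_def)
  have Aw: "A *v w = c *\<^sub>R pole_pt North" by (rule normalises_axis[OF N])
  have nn: "pole_pt North \<bullet> pole_pt North = 1" by simp
  have ww: "w \<bullet> w = c\<^sup>2" using Ai[of w w] unfolding Aw by (simp add: power2_eq_square)
  have c: "c > 0" using ww w0 c0 by (cases "c = 0") auto
  have north: "pole_pt North \<bullet> (A *v x) = (w \<bullet> x) / c" for x
    using Ai[of w x] c unfolding Aw by (simp add: field_simps)
  have geod: "geodesic s J \<gamma>" using max by (simp add: maximal_geodesic_def)
  then have J: "open J" "is_interval J" and nc: "\<not> \<gamma> constant_on J" by (auto simp: geodesic_def)
  define u where "u = (\<lambda>t. fst (\<gamma> t))"
  obtain v where g: "geo w J u v" and \<gamma>: "\<And>t. t \<in> J \<Longrightarrow> \<gamma> t = s (u t)"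
    using geodesic_imp_geo[OF geod] unfolding u_def by metis
  have u': "(u has_vector_derivative v t) (at t)" and uS: "u t \<in> S2" and h0: "w \<bullet> u t \<noteq> 0" if "t \<in> J" for t
    using g that by (auto simp: geo_def S2_iff)
  have inext: "inextendible w J u"
    unfolding u_def by (rule maximal_geodesic_inextendible[OF max]) (use \<gamma> u_def in auto)
  obtain a where a: "a \<in> J" using nc unfolding constant_on_def by blast
  \<comment> \<open>The height \<open>w \<bullet> u\<close> has no zero, so its sign \<open>\<sigma>\<close> is constant.\<close>
  define \<sigma> where "\<sigma> = sgn (w \<bullet> u a)"
  have \<sigma>: "\<sigma> * \<sigma> = 1" "\<sigma> = 1 \<or> \<sigma> = -1" using h0[OF a] by (auto simp: \<sigma>_def sgn_if)
  have pos: "0 < \<sigma> * (w \<bullet> u t)" if t: "t \<in> J" for t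
  proof (rule ccontr)
    assume "\<not> 0 < \<sigma> * (w \<bullet> u t)"
    moreover have "0 < \<sigma> * (w \<bullet> u a)" using h0[OF a] by (auto simp: \<sigma>_def sgn_if)
    moreover have "continuous_on J u"
      by (rule continuous_at_imp_continuous_on) (use u' has_vector_derivative_continuous in blast)
    then have "connected ((\<lambda>t. \<sigma> * (w \<bullet> u t)) ` J)"
      using J(2) by (intro connected_continuous_image continuous_intros) (auto simp: is_interval_connected_1)
    ultimately have "0 \<in> (\<lambda>t. \<sigma> * (w \<bullet> u t)) ` J"
      using t a connectedD_interval[of "(\<lambda>t. \<sigma> * (w \<bullet> u t)) ` J" "\<sigma> * (w \<bullet> u t)" "\<sigma> * (w \<bullet> u a)" 0] by auto
    then show False using h0 \<sigma>(2) by auto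
  qed
  define e where "e = (\<sigma> / c) *\<^sub>R w"
  have \<sigma>c: "\<sigma> / c \<noteq> 0" using c \<sigma> by auto
  have e1: "e \<bullet> e = 1" using \<sigma>(1) c by (simp add: e_def ww power2_eq_square)
  have eu: "e \<bullet> x = \<sigma> * (pole_pt North \<bullet> (A *v x))" for x unfolding north by (simp add: e_def)
  have ge: "geo e J u v" unfolding e_def geo_scale[OF \<sigma>c] by (rule g)
  have inexte: "inextendible e J u" using inext unfolding inextendible_def e_def geo_scale[OF \<sigma>c] .
  have pose: "0 < e \<bullet> u t" if "t \<in> J" for t
    using pos[OF that] c by (simp add: e_def)
  obtain k where k: "\<And>t. t \<in> J \<Longrightarrow> (e \<bullet> u t) * (v t \<bullet> v t) = k" using geo_energy[OF ge J] by blast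
  obtain l where l: "\<And>t. t \<in> J \<Longrightarrow> (e \<bullet> u t) * (e \<bullet> (u t \<otimes> v t)) = l" using geo_momentum[OF ge J] by blast
  have k0: "k > 0"
  proof (rule ccontr)
    assume "\<not> k > 0"
    have v0: "v t = 0" if "t \<in> J" for t
    proof (rule ccontr)
      assume "v t \<noteq> 0"
      then have "0 < (e \<bullet> u t) * (v t \<bullet> v t)" using pose[OF that] by simp
      then show False using k[OF that] \<open>\<not> k > 0\<close> by simp
    qed
    obtain y where "\<And>t. t \<in> J \<Longrightarrow> u t = y"
    proof (rule has_vector_derivative_zero_constant[of J u])
      show "convex J" using J(2) by (simp add: is_interval_convex_1)
      show "(u has_vector_derivative 0) (at t within J)" if "t \<in> J" for t
        using u'[OF that] v0[OF that] by (simp add: has_vector_derivative_at_within)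
    qed blast
    then have "\<gamma> t = s y" if "t \<in> J" for t using \<gamma>[OF that] that by simp
    then show False using nc unfolding constant_on_def by blast
  qed
  define U where "U = (\<lambda>t. A *v u t)"
  have act: "fst (euclidean_act A d (\<gamma> t)) = U t" if "t \<in> J" for t
    unfolding U_def \<gamma>[OF that] s[OF uS[OF that]] by (simp add: euclidean_act_def hsec_def)
  have US: "U t \<in> S2" if "t \<in> J" for t using uS[OF that] Ai by (simp add: U_def S2_iff)
  have U': "(U has_vector_derivative A *v v t) (at t)" if "t \<in> J" for t
    unfolding U_def by (rule bounded_linear.has_vector_derivative[OF _ u'[OF that]])
      (simp add: matrix_vector_mul_bounded_linear)
  have xi: "normal_xi A d \<gamma> t = dir_coord South (U t)" if "t \<in> J" for t
    using act[OF that] by (simp add: normal_xi_def)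
  have xi': "vector_derivative (normal_xi A d \<gamma>) (at t) = dcoord South (U t) (A *v v t)"
    if t: "t \<in> J" and ne: "U t \<noteq> pole_pt South" for t
  proof (rule vector_derivative_at)
    have "((\<lambda>r. dir_coord South (U r)) has_derivative (\<lambda>h. dcoord South (U t) (h *\<^sub>R (A *v v t)))) (at t)"
      using U'[OF t] S2_not_pole_iff[OF US[OF t]] ne unfolding has_vector_derivative_def
      by (intro has_derivative_compose[OF _ has_derivative_dir_coord]) auto
    then have "((\<lambda>r. dir_coord South (U r)) has_vector_derivative dcoord South (U t) (A *v v t)) (at t)"
      unfolding has_vector_derivative_def linear_scale[OF linear_dcoord] .
    then show "(normal_xi A d \<gamma> has_vector_derivative dcoord South (U t) (A *v v t)) (at t)"
      by (rule has_vector_derivative_transform_within_open[OF _ J(1) t]) (simp add: xi)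
  qed
  have dparam_xi: "dparam South (dir_coord South (U t)) (dcoord South (U t) (A *v v t)) = A *v v t"
    and dp_xi: "dir_param South (dir_coord South (U t)) = U t"
    if t: "t \<in> J" and ne: "U t \<noteq> pole_pt South" for t
  proof -
    show dp: "dir_param South (dir_coord South (U t)) = U t" by (rule dir_param_coord[OF US[OF t] ne])
    have "U t \<bullet> (A *v v t) = 0" unfolding U_def Ai by (rule geo_velocity[OF ge J(1) t])
    with dp show "dparam South (dir_coord South (U t)) (dcoord South (U t) (A *v v t)) = A *v v t" by (rule dparam_dcoord)
  qed
  have am: "has_angular_momentum A d J \<gamma> (l / 4)"
    unfolding has_angular_momentum_def
  proof (intro ballI impI)
    fix t assume t: "t \<in> J" and "fst (euclidean_act A d (\<gamma> t)) \<noteq> pole_pt South"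
    then have ne: "U t \<noteq> pole_pt South" using act by simp
    have "(pole_pt North \<bullet> U t) * (pole_pt North \<bullet> (U t \<otimes> (A *v v t))) = (\<sigma> * \<sigma>) * ((pole_pt North \<bullet> U t) * (pole_pt North \<bullet> (U t \<otimes> (A *v v t))))"
      using \<sigma> by simp
    also have "\<dots> = (e \<bullet> u t) * (e \<bullet> (u t \<otimes> v t))"
      unfolding eu U_def cr by simp
    also have "\<dots> = l" by (rule l[OF t])
    finally show "angular_momentum (normal_xi A d \<gamma> t) (vector_derivative (normal_xi A d \<gamma>) (at t)) = of_real (l / 4)"
      unfolding xi'[OF t ne] xi[OF t] angular_momentum_eq dp_xi[OF t ne] dparam_xi[OF t ne] by simp
  qed
  have dich1: "l \<noteq> 0 \<Longrightarrow> J = UNIV \<and> (\<exists>z1 z2. 0 < z1 \<and> z2 < 1 \<and> (\<forall>t. e \<bullet> u t \<in> {z1..z2}) \<and>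
      (\<forall>R\<in>{z1, z2}. \<forall>T. (\<exists>t>T. e \<bullet> u t = R) \<and> (\<exists>t<T. e \<bullet> u t = R)))"
   and dich0: "l = 0 \<Longrightarrow> \<exists>t0 t1. t0 < t1 \<and> J = {t0<..<t1} \<and>
      ends_on_equator e u v (at_right t0) \<and> ends_on_equator e u v (at_left t1)"
    using geo_dichotomy[OF ge J e1 pose inexte k k0 l a] by blast+
  have "reaches_circle_in_finite_time A d s J \<gamma>" if l0: "l = 0"
  proof -
    obtain t0 t1 where t: "t0 < t1" "J = {t0<..<t1}" "ends_on_equator e u v (at_right t0)" "ends_on_equator e u v (at_left t1)"
      using dich0[OF l0] by blast
    have blow: "blows_up_at A d s \<gamma> F" if ends: "ends_on_equator e u v F" and ev: "\<forall>\<^sub>F t in F. t \<in> J" for F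
    proof -
      obtain u1 where u1: "(u \<longlongrightarrow> u1) F" "u1 \<bullet> u1 = 1" "e \<bullet> u1 = 0" and vinf: "filterlim (\<lambda>t. norm (v t)) at_top F"
        using ends unfolding ends_on_equator_def by blast
      have u1S: "u1 \<in> S2" "w \<bullet> u1 = 0" using u1 \<sigma>c by (auto simp: S2_iff e_def)
      have "((\<lambda>t. hsec b w (u t)) \<longlongrightarrow> hsec b w u1) F"
        unfolding hsec_def by (intro tendsto_intros u1 bounded_bilinear.tendsto[OF bounded_bilinear_cross3])
      moreover have "\<forall>\<^sub>F t in F. hsec b w (u t) = \<gamma> t"
        using ev by eventually_elim (simp add: \<gamma> s uS)
      ultimately have "(\<gamma> \<longlongrightarrow> s u1) F" unfolding s[OF u1S(1)] by (rule Lim_transform_eventually)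
      moreover have "s u1 \<in> lagrangian_circle s" unfolding lagrangian_circle_eq using u1S by blast
      moreover have "filterlim (\<lambda>t. cmod (vector_derivative (normal_xi A d \<gamma>) (at t))) at_top F"
      proof (rule filterlim_at_top_mono)
        show "filterlim (\<lambda>t. (1 / 2) * norm (v t)) at_top F"
          by (rule filterlim_tendsto_pos_mult_at_top[OF tendsto_const _ vinf]) simp
        have "((\<lambda>t. e \<bullet> u t) \<longlongrightarrow> 0) F" using tendsto_inner[OF tendsto_const u1(1), of e] u1(3) by simp
        then have "\<forall>\<^sub>F t in F. \<bar>e \<bullet> u t\<bar> < 1" using tendstoD[of "\<lambda>t. e \<bullet> u t" 0 F 1] by simp
        then show "\<forall>\<^sub>F t in F. (1 / 2) * norm (v t) \<le> cmod (vector_derivative (normal_xi A d \<gamma>) (at t))"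
          using ev
        proof eventually_elim
          case (elim t)
          have ne: "U t \<noteq> pole_pt South"
          proof
            assume "U t = pole_pt South"
            then have "\<bar>e \<bullet> u t\<bar> = 1" using \<sigma>(2) unfolding eu U_def by (auto simp: pole_North_South)
            then show False using elim(1) by simp
          qed
          define X where "X = dcoord South (U t) (A *v v t)"
          have "norm (A *v v t) = 2 / sq1 (dir_coord South (U t)) * cmod X"
            using dparam_norm[of South "dir_coord South (U t)" X] dparam_xi[OF elim(2) ne] by (simp add: X_def)
          moreover have "norm (A *v v t) = norm (v t)" using Ai[of "v t" "v t"] by (simp add: norm_eq_sqrt_inner)
          moreover have "2 / sq1 (dir_coord South (U t)) \<le> 2" by (simp add: divide_le_eq) (simp add: sq1_def)
          then have "2 / sq1 (dir_coord South (U t)) * cmod X \<le> 2 * cmod X" by (intro mult_right_mono) auto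
          ultimately show ?case unfolding xi'[OF elim(2) ne] X_def[symmetric] by simp
        qed
      qed
      ultimately show ?thesis unfolding blows_up_at_def by blast
    qed
    have "\<forall>\<^sub>F t in at_right t0. t \<in> J" "\<forall>\<^sub>F t in at_left t1. t \<in> J"
      unfolding eventually_at_left_field eventually_at_right_field using t(1,2) by (auto intro: exI[of _ t0] exI[of _ t1])
    then show ?thesis
      unfolding reaches_circle_in_finite_time_def using t blow by blast
  qed
  moreover have "oscillates A d J \<gamma>" if l0: "l \<noteq> 0"
  proof -
    have JU: "J = UNIV" using dich1[OF l0] by (rule conjunct1)
    obtain z1 z2 where z: "0 < z1" "z2 < 1" "\<forall>t. e \<bullet> u t \<in> {z1..z2}"
      and att_z: "\<forall>R\<in>{z1, z2}. \<forall>T. (\<exists>t>T. e \<bullet> u t = R) \<and> (\<exists>t<T. e \<bullet> u t = R)"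
      using conjunct2[OF dich1[OF l0]] by blast
    have z12: "z1 \<le> z2" using z(3)[rule_format, of 0] by auto
    have height: "pole_pt North \<bullet> U t = \<sigma> * (e \<bullet> u t)" for t unfolding eu U_def using \<sigma>(2) by auto
    have ne: "U t \<noteq> pole_pt South" for t
    proof
      assume "U t = pole_pt South"
      then have "\<sigma> * (e \<bullet> u t) = -1" using height[of t] by (simp add: pole_North_South)
      then show False using \<sigma>(2) z(1,2) z(3)[rule_format, of t] by auto
    qed
    have R: "cmod (normal_xi A d \<gamma> t) = radius_of_height (\<sigma> * (e \<bullet> u t))" for t
      unfolding height[symmetric] using xi[of t] cmod_dir_coord_South[OF US ne, of t] JU by simp
    define \<rho> where "\<rho> = (\<lambda>z. radius_of_height (\<sigma> * z))"
    define m M where "m = min (\<rho> z1) (\<rho> z2)" and "M = max (\<rho> z1) (\<rho> z2)"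
    have bnd: "cmod (normal_xi A d \<gamma> t) \<in> {m..M}" for t
    proof -
      have "e \<bullet> u t \<in> {z1..z2}" using z(3) by blast
      then show ?thesis
        using \<sigma>(2) z(1,2) radius_of_height_mono unfolding R m_def M_def \<rho>_def
        by (auto simp: min_le_iff_disj le_max_iff_disj)
    qed
    have side: "M < 1 \<or> 1 < m"
      using \<sigma>(2) z(1,2) z12 radius_of_height_1 unfolding m_def M_def \<rho>_def by auto
    have att: "(\<exists>t>T. cmod (normal_xi A d \<gamma> t) = R) \<and> (\<exists>t<T. cmod (normal_xi A d \<gamma> t) = R)"
      if "R \<in> {m, M}" for R T
    proof -
      obtain z' where z': "z' \<in> {z1, z2}" "R = \<rho> z'"
        using \<open>R \<in> {m, M}\<close> by (auto simp: m_def M_def min_def max_def split: if_splits)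
      from att_z[rule_format, OF z'(1), of T] show ?thesis
        unfolding R z'(2) \<rho>_def by auto
    qed
    have "fst (euclidean_act A d (\<gamma> t)) \<noteq> pole_pt South" for t using act[of t] ne[of t] JU by simp
    then have "\<forall>t. fst (euclidean_act A d (\<gamma> t)) \<noteq> pole_pt South \<and> cmod (normal_xi A d \<gamma> t) \<in> {m..M}"
      using bnd by blast
    moreover have "\<forall>R\<in>{m, M}. \<forall>T. (\<exists>t>T. cmod (normal_xi A d \<gamma> t) = R) \<and> (\<exists>t<T. cmod (normal_xi A d \<gamma> t) = R)"
      by (intro ballI allI att)
    ultimately have "\<exists>m M. (M < 1 \<or> 1 < m) \<and>
        (\<forall>t. fst (euclidean_act A d (\<gamma> t)) \<noteq> pole_pt South \<and> cmod (normal_xi A d \<gamma> t) \<in> {m..M}) \<and>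
        (\<forall>R\<in>{m, M}. \<forall>T. (\<exists>t>T. cmod (normal_xi A d \<gamma> t) = R) \<and> (\<exists>t<T. cmod (normal_xi A d \<gamma> t) = R))"
      using side by (intro exI[of _ m] exI[of _ M]) (rule conjI, assumption, rule conjI)
    then show ?thesis unfolding oscillates_def using JU by (rule conjI[rotated])
  qed
  ultimately show ?thesis using am by (intro exI[of _ "l / 4"]) auto
qed

end

section \<open>Complete integrability\<close>

lemma Ck_on_SucD: "Ck_on (Suc k) S f \<Longrightarrow> Ck_on k S f"
proof (induction k arbitrary: f)
  case 0
  then show ?case by (auto intro!: continuous_at_imp_continuous_on differentiable_imp_continuous_within)
next
  case (Suc k)
  then show ?case by (metis Ck_on.simps(2))
qed

lemma Ck_on_subset: "Ck_on k S f \<Longrightarrow> T \<subseteq> S \<Longrightarrow> Ck_on k T f"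
  by (induction k arbitrary: f) (auto intro: continuous_on_subset)

lemma Ck_on_SucI:
  assumes "\<And>x. (f has_derivative D x) (at x)" "\<And>v. Ck_on k UNIV (\<lambda>x. D x v)"
  shows "Ck_on (Suc k) UNIV f"
proof -
  have "frechet_derivative f (at x) = D x" for x
    using frechet_derivative_at[OF assms(1)] by simp
  then show ?thesis using assms by (auto simp: differentiable_def)
qed

lemma Ck_on_SucE:
  assumes "Ck_on (Suc k) UNIV f"
  obtains D where "\<And>x. (f has_derivative D x) (at x)" "\<And>v. Ck_on k UNIV (\<lambda>x. D x v)"
  using assms frechet_derivative_works[of f] by (intro that[of "\<lambda>x. frechet_derivative f (at x)"]) auto

lemma Ck_on_const: "Ck_on k UNIV (\<lambda>_. c)"
proof (induction k arbitrary: c)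
  case (Suc k)
  show ?case by (rule Ck_on_SucI[where D = "\<lambda>_ _. 0"]) (auto intro: Suc)
qed simp

lemma Ck_on_linear:
  assumes "bounded_linear f" shows "Ck_on k UNIV f"
proof (cases k)
  case (Suc k')
  then show ?thesis
    using Ck_on_SucI[where D = "\<lambda>_. f", OF bounded_linear_imp_has_derivative[OF assms]] Ck_on_const by blast
qed (use assms linear_continuous_on in auto)

lemma Ck_on_add: "Ck_on k UNIV f \<Longrightarrow> Ck_on k UNIV g \<Longrightarrow> Ck_on k UNIV (\<lambda>x. f x + g x)"
proof (induction k arbitrary: f g)
  case (Suc k)
  obtain Df where Df: "\<And>x. (f has_derivative Df x) (at x)" "\<And>v. Ck_on k UNIV (\<lambda>x. Df x v)"
    using Ck_on_SucE[OF Suc.prems(1)] by blast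
  obtain Dg where Dg: "\<And>x. (g has_derivative Dg x) (at x)" "\<And>v. Ck_on k UNIV (\<lambda>x. Dg x v)"
    using Ck_on_SucE[OF Suc.prems(2)] by blast
  show ?case
    by (rule Ck_on_SucI[where D = "\<lambda>x v. Df x v + Dg x v"])
       (intro has_derivative_add Df Dg Suc.IH)+
qed (simp add: continuous_on_add)

lemma Ck_on_bilinear:
  assumes "bounded_bilinear pr"
  shows "Ck_on k UNIV f \<Longrightarrow> Ck_on k UNIV g \<Longrightarrow> Ck_on k UNIV (\<lambda>x. pr (f x) (g x))"
proof (induction k arbitrary: f g)
  case (Suc k)
  obtain Df where Df: "\<And>x. (f has_derivative Df x) (at x)" "\<And>v. Ck_on k UNIV (\<lambda>x. Df x v)"
    using Ck_on_SucE[OF Suc.prems(1)] by blast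
  obtain Dg where Dg: "\<And>x. (g has_derivative Dg x) (at x)" "\<And>v. Ck_on k UNIV (\<lambda>x. Dg x v)"
    using Ck_on_SucE[OF Suc.prems(2)] by blast
  show ?case
  proof (rule Ck_on_SucI[where D = "\<lambda>x v. pr (f x) (Dg x v) + pr (Df x v) (g x)"])
    show "((\<lambda>x. pr (f x) (g x)) has_derivative (\<lambda>v. pr (f x) (Dg x v) + pr (Df x v) (g x))) (at x)" for x
      by (rule bounded_bilinear.FDERIV[OF assms Df(1) Dg(1)])
    show "Ck_on k UNIV (\<lambda>x. pr (f x) (Dg x v) + pr (Df x v) (g x))" for v
      by (intro Ck_on_add Suc.IH Df Dg Ck_on_SucD[OF Suc.prems(1)] Ck_on_SucD[OF Suc.prems(2)])
  qed
qed (simp add: bounded_bilinear.continuous_on[OF assms])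

lemma Ck_on_inverse:
  fixes h :: "'a::euclidean_space \<Rightarrow> real"
  assumes "\<And>x. h x \<noteq> 0"
  shows "Ck_on k UNIV h \<Longrightarrow> Ck_on k UNIV (\<lambda>x. inverse (h x))"
proof (induction k)
  case (Suc k)
  obtain D where D: "\<And>x. (h has_derivative D x) (at x)" "\<And>v. Ck_on k UNIV (\<lambda>x. D x v)"
    using Ck_on_SucE[OF Suc.prems] by blast
  have i: "Ck_on k UNIV (\<lambda>x. inverse (h x))" by (rule Suc.IH[OF Ck_on_SucD[OF Suc.prems]])
  show ?case
  proof (rule Ck_on_SucI[where D = "\<lambda>x v. (- 1) * (inverse (h x) * (D x v * inverse (h x)))"])
    show "((\<lambda>x. inverse (h x)) has_derivative (\<lambda>v. (- 1) * (inverse (h x) * (D x v * inverse (h x))))) (at x)" for x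
      using Deriv.has_derivative_inverse[OF assms D(1)] by (simp add: mult.assoc)
    show "Ck_on k UNIV (\<lambda>x. (- 1) * (inverse (h x) * (D x v * inverse (h x))))" for v
      by (intro Ck_on_bilinear[OF bounded_bilinear_mult] Ck_on_const i D)
  qed
qed (simp add: assms continuous_on_inverse)

definition dconf :: "pole \<Rightarrow> vec3 \<Rightarrow> complex \<Rightarrow> complex \<Rightarrow> real" where
  "dconf P w x X = - 4 * (w \<bullet> dparam P x X) / (sq1 x)\<^sup>2 + 16 * (w \<bullet> dir_param P x) * (x \<bullet> X) / (sq1 x)^3"

lemma has_derivative_conf: "(conf P w has_derivative dconf P w x) (at x within S)"
  unfolding conf_def[abs_def] dconf_def[abs_def]
  by (auto intro!: derivative_eq_intros has_derivative_dir_param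
      simp: fun_eq_iff field_simps power2_eq_square power3_eq_cube)

definition rot :: "pole \<Rightarrow> vec3 \<Rightarrow> complex \<Rightarrow> complex" where
  "rot P w x = - (\<i> / 2) * quad P w x"

definition drot :: "pole \<Rightarrow> vec3 \<Rightarrow> complex \<Rightarrow> complex" where
  "drot P w x = - (\<i> / 2) * dquad P w x"

lemma dparam_rot: "dparam P x (rot P w x) = w \<otimes> dir_param P x"
  unfolding rot_def by (rule dparam_rotation)

lemma has_derivative_rot: "(rot P w has_derivative (\<lambda>X. drot P w x * X)) (at x within S)"
  using has_field_derivative_quad[of P w x S] unfolding rot_def[abs_def] drot_def has_field_derivative_def[symmetric]
  by (auto intro!: derivative_eq_intros)

lemma has_derivative_conf_fst: "((\<lambda>z. conf P w (fst z)) has_derivative (\<lambda>Z. dconf P w (fst z) (fst Z))) (at z)"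
  by (rule has_derivative_compose[OF has_derivative_fst[OF has_derivative_ident] has_derivative_conf])

lemma has_derivative_rot_fst: "((\<lambda>z. rot P w (fst z)) has_derivative (\<lambda>Z. drot P w (fst z) * fst Z)) (at z)"
  by (rule has_derivative_compose[OF has_derivative_fst[OF has_derivative_ident] has_derivative_rot])

text \<open>The rotation field about \<open>w\<close> is a Killing field of the induced metric: the change of the
  conformal factor along the field compensates the scaling of lengths by its flow. This is what
  makes energy and momentum commute.\<close>

lemma conf_along_rot: "dconf P w x (rot P w x) = - 2 * Re (drot P w x) * conf P w x"
proof -
  have 1: "w \<bullet> dparam P x (rot P w x) = 0" by (simp add: dparam_rot dot_cross_self)
  have "2 * (x \<bullet> rot P w x) = sq1 x * Re (drot P w x)"
    by (simp add: rot_def drot_def quad_def dquad_def sq1_def inner_complex_def power2_eq_square field_simps)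
  then have 2: "x \<bullet> rot P w x = sq1 x * Re (drot P w x) / 2" by simp
  show ?thesis
    unfolding dconf_def conf_def 1 2 by (simp add: power2_eq_square power3_eq_cube)
qed

definition energy :: "vec3 \<Rightarrow> line \<times> line \<Rightarrow> real" where
  "energy w q = (w \<bullet> fst (fst q)) * (fst (snd q) \<bullet> fst (snd q))"

definition momentum :: "vec3 \<Rightarrow> line \<times> line \<Rightarrow> real" where
  "momentum w q = (w \<bullet> fst (fst q)) * (w \<bullet> (fst (fst q) \<otimes> fst (snd q)))"

definition dhsec :: "vec3 \<Rightarrow> vec3 \<Rightarrow> vec3 \<Rightarrow> vec3 \<Rightarrow> line" where
  "dhsec b w u U = (U, - ((b \<bullet> u) *\<^sub>R U + (b \<bullet> U) *\<^sub>R u) + w \<otimes> U)"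

lemma has_derivative_hsec: "(hsec b w has_derivative dhsec b w u) (at u within S)"
  unfolding hsec_def[abs_def] dhsec_def[abs_def]
  by (auto intro!: derivative_eq_intros bounded_linear.has_derivative[OF bounded_linear_cross_right])

context hsphere
begin

lemma tangent_param_eq:
  "tangent_param s P z = (hsec b w (dir_param P (fst z)), dhsec b w (dir_param P (fst z)) (dparam P (fst z) (snd z)))"
proof -
  have "surf_param s P = (\<lambda>x. hsec b w (dir_param P x))" using surf_param_eq by blast
  then have "(surf_param s P has_derivative (\<lambda>X. dhsec b w (dir_param P x) (dparam P x X))) (at x)" for x
    using has_derivative_compose[OF has_derivative_dir_param has_derivative_hsec] by simp
  from frechet_derivative_at[OF this, symmetric] show ?thesis
    by (simp add: tangent_param_def case_prod_beta dir_deriv_def surf_param_eq)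
qed

text \<open>Up to sign these are the squared length of the velocity and its inner product with the rotation
  field, for the induced metric.\<close>

lemma energy_tangent_param: "energy w (tangent_param s P z) = - conf P w (fst z) * (snd z \<bullet> snd z)"
  by (simp add: energy_def tangent_param_eq hsec_def dhsec_def dparam_inner_dparam conf_def)

lemma momentum_tangent_param: "momentum w (tangent_param s P z) = - conf P w (fst z) * (rot P w (fst z) \<bullet> snd z)"
proof -
  have "w \<bullet> (dir_param P x \<otimes> dparam P x X) = dparam P x (rot P w x) \<bullet> dparam P x X" for x X
    unfolding dparam_rot by (simp add: cross3_def inner_vec_def sum_3 algebra_simps)
  then show ?thesis
    by (simp add: momentum_def tangent_param_eq hsec_def dhsec_def dparam_inner_dparam conf_def)
qed

lemma phase_dom_eq: "phase_dom s P = {z. w \<bullet> dir_param P (fst z) \<noteq> 0}"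
  by (auto simp: phase_dom_def surf_param_reg_iff)

lemma continuous_dir_param: "continuous_on S (dir_param P)"
  by (rule has_derivative_continuous_on) (rule has_derivative_dir_param)

lemma open_phase_dom: "open (phase_dom s P)"
  unfolding phase_dom_eq
  by (intro open_Collect_neq continuous_intros continuous_on_compose2[OF continuous_dir_param[of UNIV]]) auto

lemma conf_nonzero: "z \<in> phase_dom s P \<Longrightarrow> conf P w (fst z) \<noteq> 0"
  by (simp add: phase_dom_eq conf_def)

lemma Ck_on_conf: "Ck_on k UNIV (\<lambda>z::complex \<times> complex. conf P w (fst z))"
proof -
  have f: "Ck_on k UNIV (fst :: complex \<times> complex \<Rightarrow> complex)"
    by (rule Ck_on_linear[OF bounded_linear_fst])
  note bil = Ck_on_bilinear[OF bounded_bilinear_mult] Ck_on_bilinear[OF bounded_bilinear_inner]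
  have D: "Ck_on k UNIV (\<lambda>z::complex \<times> complex. inverse (sq1 (fst z)))"
  proof (rule Ck_on_inverse)
    show "Ck_on k UNIV (\<lambda>z::complex \<times> complex. sq1 (fst z))"
      unfolding sq1_def by (intro Ck_on_add Ck_on_const bil f)
  qed simp
  have "conf P w x = - 4 * ((2 * inverse (sq1 x) * (x \<bullet> coemb P w + - (w \<bullet> pole_pt P)) + w \<bullet> pole_pt P)
      * (inverse (sq1 x) * inverse (sq1 x)))" for x
    by (simp add: conf_def dir_param_inner power2_eq_square field_simps)
  then show ?thesis by (simp only:) (intro bil D f Ck_on_add Ck_on_const)
qed

lemma Ck_on_rot: "Ck_on k UNIV (\<lambda>z::complex \<times> complex. rot P w (fst z))"
proof -
  have f: "Ck_on k UNIV (fst :: complex \<times> complex \<Rightarrow> complex)"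
    by (rule Ck_on_linear[OF bounded_linear_fst])
  have "rot P w x = - (\<i> / 2) * (coemb P w + of_real (2 * (w \<bullet> pole_pt P)) * x + (- cnj (coemb P w)) * (x * x))" for x
    by (simp add: rot_def quad_def power2_eq_square)
  then show ?thesis
    by (simp only:) (intro Ck_on_bilinear[OF bounded_bilinear_mult] f Ck_on_add Ck_on_const)
qed

lemma smooth_energy: "smooth_phase_fun s (energy w)"
  unfolding smooth_phase_fun_def smooth_on_def
proof (intro allI, rule Ck_on_subset[OF _ subset_UNIV])
  fix P k
  have "Ck_on k UNIV (\<lambda>z::complex \<times> complex. (- 1) * (conf P w (fst z) * (snd z \<bullet> snd z)))"
    by (intro Ck_on_bilinear[OF bounded_bilinear_mult] Ck_on_bilinear[OF bounded_bilinear_inner]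
        Ck_on_const Ck_on_conf Ck_on_linear[OF bounded_linear_snd])
  then show "Ck_on k UNIV (energy w \<circ> tangent_param s P)" by (simp add: o_def energy_tangent_param)
qed

lemma smooth_momentum: "smooth_phase_fun s (momentum w)"
  unfolding smooth_phase_fun_def smooth_on_def
proof (intro allI, rule Ck_on_subset[OF _ subset_UNIV])
  fix P k
  have "Ck_on k UNIV (\<lambda>z::complex \<times> complex. (- 1) * (conf P w (fst z) * (rot P w (fst z) \<bullet> snd z)))"
    by (intro Ck_on_bilinear[OF bounded_bilinear_mult] Ck_on_bilinear[OF bounded_bilinear_inner]
        Ck_on_const Ck_on_conf Ck_on_rot Ck_on_linear[OF bounded_linear_snd])
  then show "Ck_on k UNIV (momentum w \<circ> tangent_param s P)" by (simp add: o_def momentum_tangent_param)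
qed

lemma integrals_along_geodesic:
  assumes "geodesic s J \<gamma>"
  shows "(\<lambda>t. energy w (\<gamma> t, vector_derivative \<gamma> (at t))) constant_on J"
    and "(\<lambda>t. momentum w (\<gamma> t, vector_derivative \<gamma> (at t))) constant_on J"
proof -
  obtain v where g: "geo w J (\<lambda>t. fst (\<gamma> t)) v" and \<gamma>: "\<And>t. t \<in> J \<Longrightarrow> \<gamma> t = s (fst (\<gamma> t))"
    using geodesic_imp_geo[OF assms] by metis
  have J: "open J" "is_interval J" using assms by (auto simp: geodesic_def)
  have vd: "fst (vector_derivative \<gamma> (at t)) = v t" if t: "t \<in> J" for t
  proof -
    have u': "((\<lambda>t. fst (\<gamma> t)) has_derivative (\<lambda>h. h *\<^sub>R v t)) (at t)"
      using g t by (auto simp: geo_def has_vector_derivative_def)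
    have "((\<lambda>t. hsec b w (fst (\<gamma> t))) has_derivative (\<lambda>h. dhsec b w (fst (\<gamma> t)) (h *\<^sub>R v t))) (at t)"
      by (rule has_derivative_compose[OF u' has_derivative_hsec])
    then have "((\<lambda>t. hsec b w (fst (\<gamma> t))) has_vector_derivative dhsec b w (fst (\<gamma> t)) (v t)) (at t)"
      unfolding has_vector_derivative_def linear_scale[OF has_derivative_linear[OF has_derivative_hsec]] .
    then have "(\<gamma> has_vector_derivative dhsec b w (fst (\<gamma> t)) (v t)) (at t)"
    proof (rule has_vector_derivative_transform_within_open[OF _ J(1) t])
      fix r assume r: "r \<in> J"
      have "fst (\<gamma> r) \<in> S2" using g r by (auto simp: geo_def S2_iff)
      then show "hsec b w (fst (\<gamma> r)) = \<gamma> r" using \<gamma>[OF r] s by metis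
    qed
    then show ?thesis by (simp add: vector_derivative_at dhsec_def)
  qed
  obtain k where "\<And>t. t \<in> J \<Longrightarrow> (w \<bullet> fst (\<gamma> t)) * (v t \<bullet> v t) = k" using geo_energy[OF g J] by blast
  then show "(\<lambda>t. energy w (\<gamma> t, vector_derivative \<gamma> (at t))) constant_on J"
    unfolding constant_on_def energy_def using vd by auto
  obtain l where "\<And>t. t \<in> J \<Longrightarrow> (w \<bullet> fst (\<gamma> t)) * (w \<bullet> (fst (\<gamma> t) \<otimes> v t)) = l" using geo_momentum[OF g J] by blast
  then show "(\<lambda>t. momentum w (\<gamma> t, vector_derivative \<gamma> (at t))) constant_on J"
    unfolding constant_on_def momentum_def using vd by auto
qed

text \<open>On covectors \<open>p\<close> the two integrals become \<open>- |p|\<^sup>2 / \<lambda>\<close>, with \<open>\<lambda>\<close> the conformal factor, and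
  minus the pairing of \<open>p\<close> with the rotation field.\<close>

lemma sharp_eq: assumes "conf P w x \<noteq> 0" shows "sharp (induced_metric s P) x p = (1 / conf P w x) *\<^sub>R p"
  unfolding sharp_def induced_metric_eq
proof (rule the_equality)
  show "\<forall>Y. conf P w x * ((1 / conf P w x) *\<^sub>R p \<bullet> Y) = p \<bullet> Y" using assms by simp
  fix v assume *: "\<forall>Y. conf P w x * (v \<bullet> Y) = p \<bullet> Y"
  have "(v - (1 / conf P w x) *\<^sub>R p) \<bullet> Y = 0" for Y
    using *[rule_format, of Y] assms by (simp add: inner_diff_left field_simps)
  then have "v - (1 / conf P w x) *\<^sub>R p = 0" by (metis inner_eq_zero_iff)
  then show "v = (1 / conf P w x) *\<^sub>R p" by simp
qed

text \<open>Contracting with the basis turns the bracket into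
  \<open>- (|p|\<^sup>2 / \<lambda>\<^sup>2) (D\<^sub>K \<lambda> + 2 \<lambda> Re K')\<close>, where \<open>\<lambda>\<close> is the conformal factor and \<open>K\<close> the rotation field.
  This is zero by \<open>conf_along_rot\<close>.\<close>

lemma energy_momentum_commute: "poisson_commute s (energy w) (momentum w)"
  unfolding poisson_commute_def
proof (intro allI ballI)
  fix P and z :: "complex \<times> complex" assume z: "z \<in> phase_dom s P"
  define x p where "x = fst z" and "p = snd z"
  have zx: "z = (x, p)" by (simp add: x_def p_def)
  define \<Lambda> where "\<Lambda> = conf P w x"
  have L0: "\<Lambda> \<noteq> 0" using conf_nonzero[OF z] by (simp add: \<Lambda>_def x_def)
  note lamz = has_derivative_conf_fst[of P w z, folded x_def]
  note Kz = has_derivative_rot_fst[of P w z, folded x_def]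
  have E: "dir_deriv (cotangent_form s P (energy w)) z Z = (p \<bullet> p) * dconf P w x (fst Z) / \<Lambda>\<^sup>2 - 2 * (p \<bullet> snd Z) / \<Lambda>" for Z
  proof -
    have "((\<lambda>z. - (snd z \<bullet> snd z) / conf P w (fst z)) has_derivative
        (\<lambda>Z. (p \<bullet> p) * dconf P w x (fst Z) / \<Lambda>\<^sup>2 - 2 * (p \<bullet> snd Z) / \<Lambda>)) (at z)"
      using conf_nonzero[OF z]
      by (auto intro!: derivative_eq_intros lamz simp: fun_eq_iff x_def p_def \<Lambda>_def power2_eq_square field_simps inner_commute)
    then have "(cotangent_form s P (energy w) has_derivative
        (\<lambda>Z. (p \<bullet> p) * dconf P w x (fst Z) / \<Lambda>\<^sup>2 - 2 * (p \<bullet> snd Z) / \<Lambda>)) (at z)"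
      by (rule has_derivative_transform_within_open[OF _ open_phase_dom z])
         (auto simp: cotangent_form_def case_prod_beta sharp_eq conf_nonzero energy_tangent_param field_simps)
    from frechet_derivative_at[OF this, symmetric] show ?thesis by (simp add: dir_deriv_def)
  qed
  have M: "dir_deriv (cotangent_form s P (momentum w)) z Z = - ((drot P w x * fst Z) \<bullet> p) - rot P w x \<bullet> snd Z" for Z
  proof -
    have "((\<lambda>z. - (rot P w (fst z) \<bullet> snd z)) has_derivative
        (\<lambda>Z. - ((drot P w x * fst Z) \<bullet> p) - rot P w x \<bullet> snd Z)) (at z)"
      by (auto intro!: derivative_eq_intros Kz simp: fun_eq_iff x_def p_def)
    then have "(cotangent_form s P (momentum w) has_derivative
        (\<lambda>Z. - ((drot P w x * fst Z) \<bullet> p) - rot P w x \<bullet> snd Z)) (at z)"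
      by (rule has_derivative_transform_within_open[OF _ open_phase_dom z])
         (auto simp: cotangent_form_def case_prod_beta sharp_eq conf_nonzero momentum_tangent_param field_simps)
    from frechet_derivative_at[OF this, symmetric] show ?thesis by (simp add: dir_deriv_def)
  qed
  have dl: "linear (dconf P w x)" using has_derivative_conf has_derivative_linear by blast
  have sumK: "(\<Sum>e\<in>Basis. dconf P w x e * (rot P w x \<bullet> e)) = dconf P w x (rot P w x)"
  proof -
    have "dconf P w x (rot P w x) = dconf P w x (\<Sum>e\<in>Basis. (rot P w x \<bullet> e) *\<^sub>R e)" by (simp add: euclidean_representation)
    also have "\<dots> = (\<Sum>e\<in>Basis. dconf P w x e * (rot P w x \<bullet> e))"
      by (simp add: linear_sum[OF dl] linear_scale[OF dl] mult.commute)
    finally show ?thesis ..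
  qed
  have sump: "(\<Sum>e\<in>Basis. (p \<bullet> e) * ((drot P w x * e) \<bullet> p)) = Re (drot P w x) * (p \<bullet> p)"
    by (simp add: Basis_complex_def inner_complex_def algebra_simps)
  have "poisson (cotangent_form s P (energy w)) (cotangent_form s P (momentum w)) z
     = (\<Sum>e\<in>Basis. - (p \<bullet> p) / \<Lambda>\<^sup>2 * (dconf P w x e * (rot P w x \<bullet> e)) - 2 / \<Lambda> * ((p \<bullet> e) * ((drot P w x * e) \<bullet> p)))"
    unfolding poisson_def E M
    by (rule sum.cong) (simp_all add: linear_0[OF dl] field_simps)
  also have "\<dots> = - (p \<bullet> p) / \<Lambda>\<^sup>2 * dconf P w x (rot P w x) - 2 / \<Lambda> * (Re (drot P w x) * (p \<bullet> p))"
    unfolding sum_subtractf sum_distrib_left[symmetric] sumK sump ..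
  also have "\<dots> = 0" unfolding conf_along_rot \<Lambda>_def[symmetric] using L0 by (simp add: power2_eq_square field_simps)
  finally show "poisson (cotangent_form s P (energy w)) (cotangent_form s P (momentum w)) z = 0" .
qed

text \<open>Up to a common factor, the derivatives in the fibre direction are represented by twice the velocity
  and by the rotation field. These are linearly independent unless \<open>w\<close> is orthogonal to the velocity.\<close>

lemma independent_energy_momentum:
  assumes "w \<bullet> fst (snd q) \<noteq> 0"
  shows "independent_at s (energy w) (momentum w) q"
  unfolding independent_at_def
proof (intro allI ballI impI)
  fix P and z :: "complex \<times> complex" and \<alpha> \<beta> :: real
  assume z: "z \<in> phase_dom s P" and q: "tangent_param s P z = q"
    and dep: "\<forall>Z. \<alpha> * dir_deriv (energy w \<circ> tangent_param s P) z Z + \<beta> * dir_deriv (momentum w \<circ> tangent_param s P) z Z = 0"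
  define x X where "x = fst z" and "X = snd z"
  have wX: "w \<bullet> dparam P x X \<noteq> 0" using assms q by (auto simp: tangent_param_eq dhsec_def x_def X_def)
  have L0: "conf P w x \<noteq> 0" using conf_nonzero[OF z] by (simp add: x_def)
  note lamz = has_derivative_conf_fst[of P w z, folded x_def]
  note Kz = has_derivative_rot_fst[of P w z, folded x_def]
  have dl0: "dconf P w x 0 = 0" using has_derivative_conf has_derivative_linear linear_0 by blast
  have "((energy w \<circ> tangent_param s P) has_derivative
      (\<lambda>Z. - conf P w x * (2 * (X \<bullet> snd Z)) - dconf P w x (fst Z) * (X \<bullet> X))) (at z)"
    unfolding o_def energy_tangent_param
    by (auto intro!: derivative_eq_intros lamz simp: fun_eq_iff x_def X_def inner_commute algebra_simps)
  from frechet_derivative_at[OF this, symmetric]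
  have E: "dir_deriv (energy w \<circ> tangent_param s P) z (0, Y) = - conf P w x * (2 * (X \<bullet> Y))" for Y
    by (simp add: dir_deriv_def dl0)
  have "((momentum w \<circ> tangent_param s P) has_derivative
      (\<lambda>Z. - conf P w x * (rot P w x \<bullet> snd Z + (drot P w x * fst Z) \<bullet> X) - dconf P w x (fst Z) * (rot P w x \<bullet> X))) (at z)"
    unfolding o_def momentum_tangent_param
    by (auto intro!: derivative_eq_intros lamz Kz simp: fun_eq_iff x_def X_def algebra_simps)
  from frechet_derivative_at[OF this, symmetric]
  have M: "dir_deriv (momentum w \<circ> tangent_param s P) z (0, Y) = - conf P w x * (rot P w x \<bullet> Y)" for Y
    by (simp add: dir_deriv_def dl0)
  define V where "V = (2 * \<alpha>) *\<^sub>R X + \<beta> *\<^sub>R rot P w x"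
  have "conf P w x * (V \<bullet> Y) = 0" for Y
    using dep[rule_format, of "(0, Y)"] unfolding E M V_def by (simp add: inner_add_left algebra_simps)
  then have V0: "V = 0" using L0 by (metis inner_eq_zero_iff mult_eq_0_iff)
  have "w \<bullet> dparam P x V = 2 * \<alpha> * (w \<bullet> dparam P x X) + \<beta> * (w \<bullet> dparam P x (rot P w x))"
    unfolding V_def by (simp add: linear_add[OF linear_dparam] linear_scale[OF linear_dparam] inner_add_right)
  moreover have "w \<bullet> dparam P x (rot P w x) = 0" by (simp add: dparam_rot dot_cross_self)
  ultimately have "\<alpha> = 0" using V0 wX linear_0[OF linear_dparam] by simp
  moreover have "rot P w x \<noteq> 0" using wX by (auto simp: inner_dparam rot_def)
  ultimately show "\<alpha> = 0 \<and> \<beta> = 0" using V0 by (simp add: V_def)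
qed

lemma quad_zeros_finite: assumes "w \<noteq> 0" shows "finite {x. quad P w x = 0}"
proof -
  let ?p = "[:coemb P w, of_real (2 * (w \<bullet> pole_pt P)), - cnj (coemb P w):]"
  have p0: "?p \<noteq> 0" using emb_coemb[of P w] assms by auto
  have "{x. quad P w x = 0} = {x. poly ?p x = 0}"
    by (simp add: quad_def power2_eq_square algebra_simps)
  then show ?thesis using poly_roots_finite[OF p0] by metis
qed

text \<open>Dependence means that the velocity satisfies a linear equation whose coefficients vanish at the roots
  of a nonzero polynomial only. Perturbing first the point and then the velocity leaves this set.\<close>

lemma generic_phase_dense:
  assumes "w \<noteq> 0"
  shows "closure {z::complex \<times> complex. quad P w (fst z) \<bullet> snd z \<noteq> 0} = UNIV"
proof -
  let ?A = "{z::complex \<times> complex. quad P w (fst z) \<bullet> snd z \<noteq> 0}"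
  have 1: "(x, X) \<in> closure ?A" if x: "quad P w x \<noteq> 0" for x X
  proof -
    have "closure (- {X. quad P w x \<bullet> X = 0}) = UNIV"
      using interior_hyperplane[OF x, of 0] by (simp add: closure_complement)
    then have "X \<in> closure (- {X. quad P w x \<bullet> X = 0})" by simp
    moreover have "Pair x ` closure (- {X. quad P w x \<bullet> X = 0}) \<subseteq> closure (Pair x ` (- {X. quad P w x \<bullet> X = 0}))"
      by (intro closure_bounded_linear_image_subset image_closure_subset) (auto intro!: continuous_intros closure_subset)
    moreover have "closure (Pair x ` (- {X. quad P w x \<bullet> X = 0})) \<subseteq> closure ?A" by (intro closure_mono) auto
    ultimately show ?thesis by blast
  qed
  have "(x, X) \<in> closure ?A" for x X
  proof -
    have "interior {x. quad P w x = 0} = {}"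
      using quad_zeros_finite[OF assms] by (intro empty_interior_finite)
    then have "closure (- {x. quad P w x = 0}) = UNIV" by (simp add: closure_complement)
    then have x: "x \<in> closure (- {x. quad P w x = 0})" by simp
    have "(\<lambda>x. (x, X)) ` closure (- {x. quad P w x = 0}) \<subseteq> closure ?A"
      by (rule image_closure_subset) (auto intro!: continuous_intros 1)
    then show ?thesis using x by blast
  qed
  then show ?thesis by auto
qed

lemma continuous_tangent_param: "continuous_on S (tangent_param s P)"
proof -
  have d: "continuous_on S (\<lambda>z::complex \<times> complex. dir_param P (fst z))"
    by (intro continuous_on_compose2[OF continuous_dir_param[of UNIV]] continuous_intros) auto
  have e: "continuous_on S (\<lambda>z::complex \<times> complex. dparam P (fst z) (snd z))"
    unfolding dparam_def sq1_def
    by (intro continuous_intros bounded_linear.continuous_on[OF bounded_linear_emb])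
       (use sq1_pos(2) in \<open>auto simp: sq1_def\<close>)
  show ?thesis
    unfolding tangent_param_eq[abs_def] hsec_def dhsec_def
    by (intro continuous_intros continuous_on_cross d e)
qed

theorem integrable_flow: assumes "w \<noteq> 0" shows "completely_integrable s"
proof -
  \<comment> \<open>The velocities along which the height changes to first order.\<close>
  define U where "U = phase_space s \<inter> {q. w \<bullet> fst (snd q) \<noteq> 0}"
  have "open {q :: line \<times> line. w \<bullet> fst (snd q) \<noteq> 0}"
    by (intro open_Collect_neq continuous_intros)
  then have "openin (top_of_set (phase_space s)) U" unfolding U_def by (rule openin_open_Int)
  moreover have "phase_space s \<subseteq> closure U"
  proof -
    have "tangent_param s P ` phase_dom s P \<subseteq> closure U" for P
    proof -
      let ?A = "{z::complex \<times> complex. quad P w (fst z) \<bullet> snd z \<noteq> 0}"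
      have "tangent_param s P ` (phase_dom s P \<inter> ?A) \<subseteq> U"
        unfolding U_def phase_space_def by (auto simp: tangent_param_eq dhsec_def inner_dparam)
      then have "tangent_param s P ` closure (phase_dom s P \<inter> ?A) \<subseteq> closure U"
        using closure_subset by (intro image_closure_subset continuous_tangent_param closed_closure) blast
      moreover have "phase_dom s P \<subseteq> closure (phase_dom s P \<inter> ?A)"
        using open_Int_closure_subset[OF open_phase_dom, of P ?A] generic_phase_dense[OF assms] by simp
      ultimately show ?thesis by blast
    qed
    then show ?thesis unfolding phase_space_def by blast
  qed
  moreover have "\<forall>q\<in>U. independent_at s (energy w) (momentum w) q"
    using independent_energy_momentum by (simp add: U_def)
  ultimately show ?thesis
    unfolding completely_integrable_def first_integral_def
    using smooth_energy smooth_momentum integrals_along_geodesic energy_momentum_commute by blast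
qed

end

section \<open>Twisting holomorphic spheres\<close>

theorem mainTheorem1:
  fixes s :: "vec3 \<Rightarrow> line"
  assumes "global_holomorphic_section s" and "twisting s"
  shows "completely_integrable s \<and>
    (\<exists>A b c. c > 0 \<and> normalises A b c s) \<and>
    (\<forall>A b c J \<gamma>. normalises A b c s \<longrightarrow> maximal_geodesic s J \<gamma> \<longrightarrow>
       (\<exists>\<mu>. has_angular_momentum A b J \<gamma> \<mu> \<and>
          (\<mu> = 0 \<longrightarrow> reaches_circle_in_finite_time A b s J \<gamma>) \<and>
          (\<mu> \<noteq> 0 \<longrightarrow> oscillates A b J \<gamma>)))"
proof -
  obtain b w where "\<And>u. u \<in> S2 \<Longrightarrow> s u = hsec b w u"
    using global_holomorphic_section_hsec[OF assms(1)] by metis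
  then interpret hsphere s b w by unfold_locales
  have "w \<noteq> 0" using assms(2) by (simp add: twisting_def lagrangian_iff)
  then show ?thesis
    using integrable_flow ex_normalises maximal_geodesic_behaviour by blast
qed

end
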